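(* Let $\mathbb{S}:=\{z\in\mathbb{C}: 0<|z|<0.6,\ \arg(z)\in[\pi/4,7\pi/4]\}$ (arguments taken in $[0,2\pi)$), and for $r>0$ let $\mathbb{D}_r\subset\mathbb{C}$ be the open disk of radius $r$ centered at $0$. (1) For every $q\in \mathbb{S}\cup\mathbb{D}_{c_0}$, $q\neq 0$, the zeros of $\theta(q,\cdot)$ are strongly separated in modulus. (2) The only spectral number of $\theta$ in the set $\mathbb{S}\cup\mathbb{D}_{0.31}$ is $\tilde q_1=0.309249\ldots$.
   Context: For $q\in\mathbb{C}$, $|q|<1$, and $x\in\mathbb{C}$, the partial theta function is $\theta(q,x):=\sum_{j=0}^{\infty}q^{j(j+1)/2}x^j$. For fixed $q$ with $0<|q|<1$ it is an entire function of $x$ of order $0$ with countably (infinitely) many zeros. A number $q$ with $|q|<1$ is called a spectral number (or spectral value) of $\theta$ if the function $\theta(q,\cdot)$ has a multiple zero. The number $\tilde q_1=0.309249\ldots$ denotes the smallest positive spectral number of $\theta$. The constant $c_0=0.2078750206\ldots$ is the solution $s\in(0,1)$ of the equation $2\sum_{\nu=1}^{\infty}s^{\nu^2/2}=1$. For $0<|q|<1$, the zeros of $\theta(q,\cdot)$ are said to be strongly separated in modulus if they can be listed, with multiplicity, as a sequence $\xi_1,\xi_2,\xi_3,\ldots$ such that $0<|\xi_1|<|q|^{-3/2}$ and $|q|^{-(k-1/2)}<|\xi_k|<|q|^{-(k+1/2)}$ for all integers $k\ge 2$. *)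

theory Defs
  imports "HOL-Complex_Analysis.Complex_Analysis"
begin

definition partial_theta :: "complex \<Rightarrow> complex \<Rightarrow> complex" where
  "partial_theta q x = (\<Sum>j. q ^ (j * (j + 1) div 2) * x ^ j)"

definition multiple_zero :: "(complex \<Rightarrow> complex) \<Rightarrow> complex \<Rightarrow> bool" where
  "multiple_zero f x \<longleftrightarrow> f x = 0 \<and> zorder f x \<ge> 2"

definition spectral_number :: "complex \<Rightarrow> bool" where
  "spectral_number q \<longleftrightarrow> norm q < 1 \<and> (\<exists>x. multiple_zero (partial_theta q) x)"

definition q1_tilde :: real where
  "q1_tilde = (LEAST q. 0 < q \<and> spectral_number (complex_of_real q))"

text \<open>The index is shifted: \<open>\<nu> = Suc n\<close> runs over the positive integers.\<close>

definition c0 :: real where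
  "c0 = (THE s. 0 < s \<and> s < 1 \<and> 2 * (\<Sum>n. s powr ((real (Suc n))\<^sup>2 / 2)) = 1)"

text \<open>
  Only the values of \<open>\<xi>\<close> at indices \<open>k \<ge> 1\<close> matter. Each zero of \<open>f\<close> occurs exactly as often
  as its multiplicity, and no other point occurs at all. The finiteness condition is
  needed because an infinite set has cardinality \<open>0\<close>.
\<close>

definition lists_zeros :: "(complex \<Rightarrow> complex) \<Rightarrow> (nat \<Rightarrow> complex) \<Rightarrow> bool" where
  "lists_zeros f \<xi> \<longleftrightarrow>
     (\<forall>z. finite {k. k \<ge> 1 \<and> \<xi> k = z} \<and>
          card {k. k \<ge> 1 \<and> \<xi> k = z} = (if f z = 0 then nat (zorder f z) else 0))"

definition strongly_separated :: "complex \<Rightarrow> bool" where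
  "strongly_separated q \<longleftrightarrow>
     0 < norm q \<and> norm q < 1 \<and>
     (\<exists>\<xi>. lists_zeros (partial_theta q) \<xi> \<and>
          0 < norm (\<xi> 1) \<and> norm (\<xi> 1) < norm q powr (- (3 / 2)) \<and>
          (\<forall>k\<ge>2. norm q powr (- (real k - 1 / 2)) < norm (\<xi> k) \<and>
                 norm (\<xi> k) < norm q powr (- (real k + 1 / 2))))"

definition sector_S :: "complex set" where
  "sector_S = {z. 0 < norm z \<and> norm z < 0.6 \<and> Arg2pi z \<in> {pi / 4 .. 7 * pi / 4}}"

end

theory Submission
  imports Defs
begin

text \<open>
  Put \<open>q = p\<^sup>2\<close>. On the circle of radius \<open>\<bar>q\<bar>\<close> to the power \<open>-(k + 1/2)\<close> the function
  \<open>\<theta>(q, \<cdot>)\<close> is, up to a nonzero factor, the sum of \<open>p\<close> to the power \<open>n\<^sup>2\<close> times \<open>w\<close> to the power \<open>n\<close>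
  over all \<open>n \<ge> -k\<close>, with \<open>\<bar>w\<bar> = 1\<close>. If this sum does not vanish for \<open>tp\<close> instead of \<open>p\<close>,
  \<open>0 < t \<le> 1\<close>, then Rouche's theorem applied to the homotopy \<open>t \<rightarrow> 0\<close> shows that the circle
  encloses exactly \<open>k\<close> zeros, and the zeros are strongly separated. In the disk of radius
  \<open>c\<^sub>0\<close> the term \<open>n = 0\<close> dominates. In the sector, dividing the sum by \<open>p\<close> makes the terms
  \<open>n = \<plusminus>1\<close> real, so that they drop out of the imaginary part, while \<open>Im (1 / p)\<close> stays away from \<open>0\<close>.

  For \<open>\<bar>q\<bar> < 0.31\<close> outside the sector, substitute \<open>x = -u / q\<^sup>2\<close>. Only two zeros satisfy
  \<open>\<bar>u\<bar> < 5/4\<close> and all others are simple, so a multiple zero is a common zero of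
  \<open>H(q, u) = q \<theta>(q, -u / q\<^sup>2)\<close> and \<open>\<partial>H/\<partial>u\<close>, and it lies close to \<open>1/2\<close>. There \<open>\<partial>H/\<partial>u\<close> has a
  unique zero \<open>u(q)\<close>, by the contraction principle, and the critical value \<open>V(q) = H(q, u(q))\<close>
  satisfies \<open>V' = \<partial>H/\<partial>q\<close>, which is within distance \<open>0.94\<close> of \<open>1\<close>. Hence \<open>V\<close> is injective
  and there is at most one spectral number; the intermediate value theorem yields a real one.
\<close>

section \<open>Counting zeros of entire functions\<close>

text \<open>The square root \<open>p\<close> turns the exponents into squares, so that the terms
  \<open>n\<close> and \<open>-n\<close> carry the same power of \<open>p\<close>. In the disk of
  radius \<open>c0\<close> the triangle inequality suffices, and the equation defining
  \<open>c0\<close> is precisely its limit case. Near the positive axis separation must fail: at the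
  spectral number the first two zeros coincide, and no circle can pass between them. There the two
  are treated together. \<open>H_fun\<close> is the rescaling that keeps both bounded as
  \<open>q\<close> tends to 0, where it becomes \<open>u^2 - u\<close> with zeros 0 and 1. This is
  the origin of the critical point near 1/2; the critical value starts from \<open>-1/4\<close> at
  \<open>q = 0\<close> and has to reach 0. The margins are thin because all estimates must hold up
  to 0.31, barely above 0.309249, where the contraction constant is already 0.99 and the distance of
  the derivative of \<open>V\<close> from 1 is only bounded by 0.94.\<close>

definition zeros_count :: "(complex \<Rightarrow> complex) \<Rightarrow> real \<Rightarrow> int" where
  "zeros_count f r = (\<Sum>z | norm z < r \<and> f z = 0. zorder f z)"

lemma entire_finite_zeros:
  assumes "f holomorphic_on UNIV" "f a \<noteq> 0"
  shows "finite {z. norm z \<le> r \<and> f z = 0}"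
proof -
  have "finite {z\<in>cball 0 r. f z = 0}"
  proof (cases "f constant_on UNIV")
    case True
    hence "{z\<in>cball 0 r. f z = 0} = {}" using assms(2) by (auto simp: constant_on_def)
    thus ?thesis by (metis finite.emptyI)
  next
    case False
    show ?thesis
      by (rule holomorphic_compact_finite_zeros[of f UNIV]) (use assms False in auto)
  qed
  thus ?thesis by simp
qed

lemma entire_eventually_nonzero:
  assumes "f holomorphic_on UNIV" "f a \<noteq> 0"
  shows "\<forall>\<^sub>F z in at b. f z \<noteq> 0"
proof -
  have "finite {z. norm z \<le> norm b + 1 \<and> f z = 0}"
    using entire_finite_zeros[OF assms] .
  hence "\<forall>\<^sub>F z in at b. z \<notin> {z. norm z \<le> norm b + 1 \<and> f z = 0}"
    using islimpt_finite islimpt_iff_eventually by metis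
  moreover have "\<forall>\<^sub>F z in at b. z \<in> ball 0 (norm b + 1)"
    by (rule eventually_at_in_open') auto
  ultimately show ?thesis by eventually_elim auto
qed

lemma entire_zorder_pos:
  assumes "f holomorphic_on UNIV" "f a \<noteq> 0" "f z = 0"
  shows "zorder f z \<ge> 1"
  using zorder_pos_iff[OF assms(1) open_UNIV, of z] entire_eventually_nonzero[OF assms(1,2), of z] assms(3)
  by (auto simp: eventually_frequently)

text \<open>\<open>Rouche_theorem\<close> weights zeros by winding numbers in an open connected set.
  For a circle these are 1 inside and 0 outside, and the strict inequality keeps the zeros of both
  functions off the circle, so the weighted sums become \<open>zeros_count\<close>.\<close>

lemma zeros_count_Rouche:
  assumes f: "f holomorphic_on UNIV" and g: "g holomorphic_on UNIV" and r: "r > 0"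
    and less: "\<And>z. norm z = r \<Longrightarrow> norm (g z) < norm (f z)"
  shows "zeros_count (\<lambda>z. f z + g z) r = zeros_count f r"
proof -
  have on_sphere: "f z \<noteq> 0" "f z + g z \<noteq> 0" if "norm z = r" for z
    using less[OF that] by (auto simp: add_eq_0_iff2)
  have a: "norm (complex_of_real r) = r" using r by simp
  have fg: "(\<lambda>z. f z + g z) holomorphic_on UNIV" using f g by (intro holomorphic_intros)
  \<comment> \<open>A margin around the closed disk, so that the circle lies inside
    \<open>S\<close>; zeros in the margin get winding number 0.\<close>
  define S where "S = ball (0::complex) (r + 1)"
  define \<gamma> where "\<gamma> = circlepath 0 r"
  have fin: "finite {z\<in>S. h z = 0}" if "h holomorphic_on UNIV" "h (of_real r) \<noteq> 0" for h
    by (rule finite_subset[OF _ entire_finite_zeros[OF that, of "r + 1"]]) (auto simp: S_def)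
  have wn: "winding_number \<gamma> z = (if norm z < r then 1 else 0)" if "norm z \<noteq> r" for z
  proof (cases "norm z < r")
    case True
    thus ?thesis unfolding \<gamma>_def by (subst winding_number_circlepath) auto
  next
    case False
    hence "winding_number \<gamma> z = 0" unfolding \<gamma>_def
      by (intro winding_number_zero_outside[of _ "cball 0 r"]) (use that r in auto)
    thus ?thesis using False by simp
  qed
  have count: "(\<Sum>p\<in>{z\<in>S. h z = 0}. winding_number \<gamma> p * zorder h p) = zeros_count h r"
    if h: "h holomorphic_on UNIV" and nz: "\<And>z. norm z = r \<Longrightarrow> h z \<noteq> 0" for h
  proof -
    have "(\<Sum>p\<in>{z\<in>S. h z = 0}. winding_number \<gamma> p * zorder h p)
        = (\<Sum>p\<in>{z\<in>S. h z = 0}. of_int (if norm p < r then zorder h p else 0))"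
      by (intro sum.cong refl) (use wn nz in force)
    also have "\<dots> = of_int (\<Sum>p\<in>{z\<in>S. h z = 0}. if norm p < r then zorder h p else 0)"
      by simp
    also have "(\<Sum>p\<in>{z\<in>S. h z = 0}. if norm p < r then zorder h p else 0) = zeros_count h r"
      unfolding zeros_count_def
      by (rule sum.mono_neutral_cong_right) (use fin[OF h nz[OF a]] in \<open>auto simp: S_def\<close>)
    finally show ?thesis .
  qed
  have "(\<Sum>p\<in>{p\<in>S. f p + g p = 0}. winding_number \<gamma> p * zorder (\<lambda>p. f p + g p) p)
      = (\<Sum>p\<in>{p\<in>S. f p = 0}. winding_number \<gamma> p * zorder f p)"
  proof (rule Rouche_theorem)
    show "open S" "connected S" by (auto simp: S_def)
    show "finite {p \<in> S. f p + g p = 0}" using fin[OF fg on_sphere(2)[OF a]] .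
    show "finite {p \<in> S. f p = 0}" using fin[OF f on_sphere(1)[OF a]] .
    show "f holomorphic_on S" "g holomorphic_on S"
      using f g holomorphic_on_subset by blast+
    show "valid_path \<gamma>" "pathfinish \<gamma> = pathstart \<gamma>" by (auto simp: \<gamma>_def)
    show "path_image \<gamma> \<subseteq> S" using r by (auto simp: \<gamma>_def S_def)
    show "\<forall>z\<in>path_image \<gamma>. cmod (g z) < cmod (f z)" using less r by (auto simp: \<gamma>_def)
    show "\<forall>z. z \<notin> S \<longrightarrow> winding_number \<gamma> z = 0" using wn by (auto simp: S_def)
  qed
  thus ?thesis
    using count[OF fg on_sphere(2)] count[OF f on_sphere(1)] by (simp del: of_int_sum)
qed

text \<open>On the compact cylinder \<open>|F|\<close> has a positive minimum. By uniform
  continuity, nearby parameters give functions that differ by less than this minimum on the circle,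
  so by Rouche the count is locally constant in \<open>t\<close>, and \<open>{0..1}\<close> is
  connected.\<close>

lemma zeros_count_homotopy:
  fixes F :: "real \<Rightarrow> complex \<Rightarrow> complex"
  assumes cont: "continuous_on ({0..1} \<times> sphere 0 r) (\<lambda>(t, z). F t z)"
    and holo: "\<And>t. t \<in> {0..1} \<Longrightarrow> F t holomorphic_on UNIV" and r: "r > 0"
    and nz: "\<And>t z. t \<in> {0..1} \<Longrightarrow> norm z = r \<Longrightarrow> F t z \<noteq> 0"
  shows "zeros_count (F 1) r = zeros_count (F 0) r"
proof -
  let ?K = "{0..1::real} \<times> sphere (0::complex) r"
  have "compact ?K" by (intro compact_Times) auto
  have unif: "uniformly_continuous_on ?K (\<lambda>(t, z). F t z)"
    using compact_uniformly_continuous[OF cont \<open>compact ?K\<close>] .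
  have "\<exists>x\<in>?K. \<forall>y\<in>?K. norm (case x of (t, z) \<Rightarrow> F t z) \<le> norm (case y of (t, z) \<Rightarrow> F t z)"
    by (rule continuous_attains_inf[OF \<open>compact ?K\<close>])
       (use r cont in \<open>auto intro: continuous_on_norm\<close>)
  then obtain t0 z0 where m: "t0 \<in> {0..1}" "norm z0 = r"
    "\<And>t z. t \<in> {0..1} \<Longrightarrow> norm z = r \<Longrightarrow> norm (F t0 z0) \<le> norm (F t z)"
    by fastforce
  have "norm (F t0 z0) > 0" using nz m by simp
  then obtain d where d: "d > 0"
    "\<And>x x'. x \<in> ?K \<Longrightarrow> x' \<in> ?K \<Longrightarrow> dist x' x < d \<Longrightarrow>
      dist (case x' of (t, z) \<Rightarrow> F t z) (case x of (t, z) \<Rightarrow> F t z) < norm (F t0 z0)"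
    using unif unfolding uniformly_continuous_on_def by metis
  have local: "zeros_count (F s) r = zeros_count (F t) r"
    if "s \<in> {0..1}" "t \<in> {0..1}" "dist t s < d" for s t
  proof -
    have "zeros_count (\<lambda>z. F s z + (F t z - F s z)) r = zeros_count (F s) r"
    proof (rule zeros_count_Rouche)
      fix z :: complex assume z: "norm z = r"
      have "dist (F t z) (F s z) < norm (F t0 z0)"
        using d(2)[of "(s, z)" "(t, z)"] that z by (auto simp: dist_Pair_Pair)
      also have "\<dots> \<le> norm (F s z)" using m that z by auto
      finally show "norm (F t z - F s z) < norm (F s z)" by (simp add: dist_norm)
    qed (use holo that r in \<open>auto intro!: holomorphic_intros\<close>)
    thus ?thesis by simp
  qed
  show ?thesis
  proof (rule connected_local_const[of "{0..1::real}" 1 0 "\<lambda>t. zeros_count (F t) r"])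
    show "\<forall>a\<in>{0..1}. \<forall>\<^sub>F b in at a within {0..1}. zeros_count (F a) r = zeros_count (F b) r"
    proof
      fix a :: real assume a: "a \<in> {0..1}"
      have "\<forall>\<^sub>F b in at a within {0..1}. b \<in> {0..1} \<and> dist b a < d"
        using d(1) unfolding eventually_at by auto
      thus "\<forall>\<^sub>F b in at a within {0..1}. zeros_count (F a) r = zeros_count (F b) r"
        by eventually_elim (use local a in auto)
    qed
  qed auto
qed

lemma zeros_count_power:
  assumes "r > 0"
  shows "zeros_count (\<lambda>z. z ^ k) r = int k"
proof (cases "k = 0")
  case False
  have "zorder (\<lambda>z. z ^ k) (0::complex) = int k"
    by (rule zorder_eqI[of UNIV _ "\<lambda>_. 1"]) auto
  moreover have "{z::complex. norm z < r \<and> z ^ k = 0} = {0}" using assms False by auto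
  ultimately show ?thesis by (simp add: zeros_count_def)
qed (simp add: zeros_count_def)

lemma zeros_count_scale:
  assumes f: "f holomorphic_on UNIV" and a: "a \<noteq> 0" and c: "c \<noteq> 0"
  shows "zeros_count (\<lambda>z. c * f (a * z)) r = zeros_count f (norm a * r)"
proof -
  have zo: "zorder (\<lambda>z. c * f (a * z)) z = zorder f (a * z)" for z
  proof -
    have "zorder (\<lambda>z. c * f (a * z)) z = zorder (\<lambda>z. f (a * z)) z"
      by (rule zorder_cmult[OF c])
    also have "\<dots> = zorder f (a * z)"
      by (rule zorder_scale) (use f a in
        \<open>auto intro!: analytic_on_imp_meromorphic_on holomorphic_on_imp_analytic_at[of _ UNIV]\<close>)
    finally show ?thesis .
  qed
  show ?thesis unfolding zeros_count_def
    by (rule sum.reindex_bij_witness[of _ "\<lambda>z. z / a" "\<lambda>z. a * z"])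
       (use a c zo in \<open>auto simp: norm_mult norm_divide divide_simps mult_ac\<close>)
qed

text \<open>Used with counts that differ by 1 and a set \<open>Z\<close> of one or two points: it
  shows that a zero in the annulus is simple and that there is no second one.\<close>

lemma zeros_count_mono_diff:
  assumes f: "f holomorphic_on UNIV" "f a \<noteq> 0" and "r \<le> R"
    and Z: "Z \<subseteq> {z. r \<le> norm z \<and> norm z < R \<and> f z = 0}"
  shows "zeros_count f r + (\<Sum>z\<in>Z. zorder f z) \<le> zeros_count f R"
proof -
  have fin: "finite {z. norm z < R \<and> f z = 0}"
    by (rule finite_subset[OF _ entire_finite_zeros[OF f, of R]]) auto
  have fZ: "finite Z" by (rule finite_subset[OF _ fin]) (use Z in auto)
  have fr: "finite {z. norm z < r \<and> f z = 0}"
    by (rule finite_subset[OF _ fin]) (use \<open>r \<le> R\<close> in auto)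
  have "zeros_count f r + (\<Sum>z\<in>Z. zorder f z) = (\<Sum>z\<in>{z. norm z < r \<and> f z = 0} \<union> Z. zorder f z)"
    unfolding zeros_count_def
    by (rule sum.union_disjoint[symmetric]) (use fr fZ Z in auto)
  also have "\<dots> \<le> zeros_count f R"
    unfolding zeros_count_def
  proof (rule sum_mono2)
    show "0 \<le> zorder f b" if "b \<in> {z. norm z < R \<and> f z = 0} - ({z. norm z < r \<and> f z = 0} \<union> Z)" for b
      using entire_zorder_pos[OF f, of b] that by auto
  qed (use fin Z \<open>r \<le> R\<close> in auto)
  finally show ?thesis .
qed

lemma zeros_count_annulus_empty:
  assumes "zeros_count f r \<noteq> zeros_count f R" "r \<le> R"
  shows "\<exists>z. r \<le> norm z \<and> norm z < R \<and> f z = 0"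
proof (rule ccontr)
  assume "\<not> ?thesis"
  hence "{z. norm z < r \<and> f z = 0} = {z. norm z < R \<and> f z = 0}"
    using \<open>r \<le> R\<close> by force
  thus False using assms by (simp add: zeros_count_def)
qed

section \<open>The partial theta series\<close>

lemma le_triangle: "j \<le> j * (j + 1) div (2::nat)"
  by (cases j) auto

lemma triangle_eq_0_iff: "(j + j * j) div 2 = 0 \<longleftrightarrow> j = (0::nat)"
  using le_triangle[of j] by auto

text \<open>With \<open>s = sqrt \<rho>\<close> the term is \<open>(s^(j+1) * R)^j\<close>, and its
  base tends to 0.\<close>

lemma summable_gauss:
  fixes \<rho> R :: real
  assumes "0 \<le> \<rho>" "\<rho> < 1" "0 \<le> R"
  shows "summable (\<lambda>j. \<rho> ^ (j * (j + 1) div 2) * R ^ j)"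
proof (cases "\<rho> = 0")
  case True
  have "(\<lambda>j. \<rho> ^ (j * (j + 1) div 2) * R ^ j) = (\<lambda>j. if j = 0 then 1 else 0)"
    by (auto simp: True power_0_left fun_eq_iff triangle_eq_0_iff)
  thus ?thesis by simp
next
  case False
  define s where "s = sqrt \<rho>"
  have s: "0 < s" "s < 1" "\<rho> = s\<^sup>2" using assms False by (auto simp: s_def real_sqrt_lt_1_iff)
  have "(\<lambda>j. s ^ Suc j * R) \<longlonglongrightarrow> 0 * R"
    using s by (intro tendsto_mult tendsto_const LIMSEQ_power_zero[THEN LIMSEQ_Suc]) auto
  hence "\<forall>\<^sub>F j in sequentially. s ^ Suc j * R < 1 / 2"
    by (auto dest: order_tendstoD(2)[of _ _ _ "1 / 2"])
  hence "\<forall>\<^sub>F j in sequentially. norm (\<rho> ^ (j * (j + 1) div 2) * R ^ j) \<le> (1 / 2) ^ j"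
  proof eventually_elim
    case (elim j)
    have "2 * (j * (j + 1) div 2) = Suc j * j" by simp
    hence "\<rho> ^ (j * (j + 1) div 2) * R ^ j = (s ^ Suc j * R) ^ j"
      unfolding s(3) power_mult [symmetric] power_mult_distrib by (simp only: mult.commute)
    also have "\<dots> \<le> (1 / 2) ^ j"
      using elim s assms by (intro power_mono) auto
    finally show ?case using assms by simp
  qed
  thus ?thesis by (rule summable_comparison_test_ev) (simp add: summable_geometric)
qed

lemma theta_term_bound:
  fixes q x :: complex
  assumes "norm q \<le> \<rho>" "norm x \<le> R"
  shows "norm (q ^ (j * (j + 1) div 2) * x ^ j) \<le> \<rho> ^ (j * (j + 1) div 2) * R ^ j"
proof -
  have "0 \<le> \<rho>" "0 \<le> R" using assms norm_ge_zero order_trans by blast+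
  thus ?thesis unfolding norm_mult norm_power
    by (intro mult_mono power_mono assms) auto
qed

lemma theta_summable:
  assumes "norm q < 1"
  shows "summable (\<lambda>j. q ^ (j * (j + 1) div 2) * x ^ j :: complex)"
  by (rule summable_comparison_test'[OF summable_gauss[of "norm q" "norm x"]])
     (use assms theta_term_bound[of q "norm q" x "norm x"] in auto)

text \<open>The homotopies vary both arguments at once, so joint continuity is needed; holomorphy in
  each variable separately comes from the same limit.\<close>

lemma theta_uniform_limit:
  assumes "\<rho> < 1"
  shows "uniform_limit (cball 0 \<rho> \<times> cball 0 R)
    (\<lambda>n (q, x). \<Sum>j<n. q ^ (j * (j + 1) div 2) * x ^ j) (\<lambda>(q, x). partial_theta q x) sequentially"
proof (cases "0 \<le> \<rho> \<and> 0 \<le> R")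
  case True
  have "uniform_limit (cball 0 \<rho> \<times> cball 0 R)
    (\<lambda>n a. \<Sum>j<n. (\<lambda>j (q, x). q ^ (j * (j + 1) div 2) * x ^ j) j a)
    (\<lambda>a. \<Sum>j. (\<lambda>j (q, x). q ^ (j * (j + 1) div 2) * x ^ j :: complex) j a) sequentially"
    by (rule Weierstrass_m_test[OF _ summable_gauss[of \<rho> R]])
       (use True assms theta_term_bound in auto)
  thus ?thesis unfolding partial_theta_def by (simp add: case_prod_unfold)
next
  case False
  hence "cball (0::complex) \<rho> \<times> cball (0::complex) R = {}"
    by auto
  thus ?thesis by (simp only: uniform_limit_iff) simp
qed

lemma continuous_on_theta_cball:
  assumes "\<rho> < 1"
  shows "continuous_on (cball 0 \<rho> \<times> cball 0 R) (\<lambda>(q, x). partial_theta q x)"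
  by (rule uniform_limit_theorem[OF _ theta_uniform_limit[OF assms]])
     (auto intro!: always_eventually continuous_intros simp: case_prod_unfold)

lemma continuous_on_theta [continuous_intros]:
  assumes "continuous_on A f" "continuous_on A g" "\<And>a. a \<in> A \<Longrightarrow> norm (f a) < 1"
  shows "continuous_on A (\<lambda>a. partial_theta (f a) (g a))"
proof -
  have "continuous_on (ball 0 1 \<times> UNIV) (\<lambda>(q, x). partial_theta q x)"
  proof (subst continuous_on_eq_continuous_at)
    show "open (ball (0::complex) 1 \<times> (UNIV :: complex set))" by (intro open_Times) auto
    show "\<forall>a\<in>ball 0 1 \<times> UNIV. isCont (\<lambda>(q, x). partial_theta q x) a"
    proof
      fix a :: "complex \<times> complex" assume a: "a \<in> ball 0 1 \<times> UNIV"
      obtain \<rho> where \<rho>: "norm (fst a) < \<rho>" "\<rho> < 1" using a dense by (cases a) auto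
      have "continuous_on (ball 0 \<rho> \<times> ball 0 (norm (snd a) + 1)) (\<lambda>(q, x). partial_theta q x)"
        by (rule continuous_on_subset[OF continuous_on_theta_cball[OF \<rho>(2), of "norm (snd a) + 1"]]) auto
      moreover have "open (ball (0::complex) \<rho> \<times> ball (0::complex) (norm (snd a) + 1))"
        by (intro open_Times) auto
      moreover have "a \<in> ball 0 \<rho> \<times> ball 0 (norm (snd a) + 1)"
        using \<rho> by (cases a) auto
      ultimately show "isCont (\<lambda>(q, x). partial_theta q x) a"
        using continuous_on_eq_continuous_at by blast
    qed
  qed
  from continuous_on_compose2[OF this continuous_on_Pair[OF assms(1,2)]] show ?thesis
    using assms(3) by fastforce
qed

lemma theta_holomorphic:
  assumes "norm q < 1"
  shows "partial_theta q holomorphic_on UNIV"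
proof (rule holomorphic_uniform_sequence[of _ "\<lambda>n x. \<Sum>j<n. q ^ (j * (j + 1) div 2) * x ^ j"])
  fix x :: complex
  have "uniform_limit (cball x 1) (\<lambda>n x. \<Sum>j<n. q ^ (j * (j + 1) div 2) * x ^ j) (partial_theta q) sequentially"
  proof -
    have "(\<lambda>y. (q, y)) ` cball x 1 \<subseteq> cball 0 (norm q) \<times> cball 0 (norm x + 1)"
    proof clarsimp
      fix y assume "dist x y \<le> 1"
      thus "norm y \<le> norm x + 1" using norm_triangle_ineq2[of y x] by (simp add: dist_norm norm_minus_commute)
    qed
    from uniform_limit_on_subset[OF theta_uniform_limit[OF assms] this]
    show ?thesis by (auto simp: uniform_limit_iff)
  qed
  thus "\<exists>d>0. cball x d \<subseteq> UNIV \<and> uniform_limit (cball x d)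
      (\<lambda>n x. \<Sum>j<n. q ^ (j * (j + 1) div 2) * x ^ j) (partial_theta q) sequentially"
    by (intro exI[of _ 1]) auto
qed (auto intro!: holomorphic_intros)

lemma theta_holomorphic_compose [holomorphic_intros]:
  assumes "norm q < 1" "f holomorphic_on A"
  shows "(\<lambda>z. partial_theta q (f z)) holomorphic_on A"
  using holomorphic_on_compose_gen[OF assms(2) theta_holomorphic[OF assms(1)]] by (simp add: o_def)

lemma theta_holomorphic_in_q:
  "(\<lambda>q. partial_theta q x) holomorphic_on ball 0 1"
proof (rule holomorphic_uniform_sequence[of _ "\<lambda>n q. \<Sum>j<n. q ^ (j * (j + 1) div 2) * x ^ j"])
  fix q :: complex assume q: "q \<in> ball 0 1"
  define d where "d = (1 - norm q) / 2"
  have d: "d > 0" "norm q + d < 1" using q by (auto simp: d_def field_simps)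
  have le: "norm r \<le> norm q + d" if "dist q r \<le> d" for r
    using that norm_triangle_ineq2[of r q] by (simp add: dist_norm norm_minus_commute)
  have "(\<lambda>y. (y, x)) ` cball q d \<subseteq> cball 0 (norm q + d) \<times> cball 0 (norm x)"
    using le by auto
  from uniform_limit_on_subset[OF theta_uniform_limit[OF d(2)] this]
  have "uniform_limit (cball q d) (\<lambda>n q. \<Sum>j<n. q ^ (j * (j + 1) div 2) * x ^ j) (\<lambda>q. partial_theta q x) sequentially"
    by (auto simp: uniform_limit_iff)
  moreover have "cball q d \<subseteq> ball 0 1" using le d by fastforce
  ultimately show "\<exists>d>0. cball q d \<subseteq> ball 0 1 \<and> uniform_limit (cball q d)
      (\<lambda>n q. \<Sum>j<n. q ^ (j * (j + 1) div 2) * x ^ j) (\<lambda>q. partial_theta q x) sequentially"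
    using d by blast
qed (auto intro!: holomorphic_intros)

lemma theta_0 [simp]: "partial_theta q 0 = 1"
proof -
  have "(\<lambda>j. q ^ (j * (j + 1) div 2) * 0 ^ j) = (\<lambda>j. if j = 0 then 1 else 0)"
    by (rule ext) auto
  thus ?thesis using sums_unique[OF sums_single[of 0 "\<lambda>_. 1::complex"]]
    by (simp add: partial_theta_def)
qed

lemma theta_0_left [simp]: "partial_theta 0 x = 1"
proof -
  have "(\<lambda>j. 0 ^ (j * (j + 1) div 2) * x ^ j) = (\<lambda>j. if j = 0 then 1 else 0)"
    by (auto simp: power_0_left fun_eq_iff triangle_eq_0_iff)
  thus ?thesis using sums_unique[OF sums_single[of 0 "\<lambda>_. 1::complex"]]
    by (simp add: partial_theta_def)
qed

text \<open>Consecutive triangular numbers differ by \<open>j + 1\<close>, so removing the first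
  term rescales the argument by \<open>q\<close>. This equation moves from one circle to the next in
  \<open>theta_trunc\<close> and removes the poles in \<open>H_fun\<close>.\<close>

lemma theta_functional:
  assumes "norm q < 1"
  shows "partial_theta q x = 1 + q * x * partial_theta q (q * x)"
proof -
  let ?t = "\<lambda>x j. q ^ (j * (j + 1) div 2) * x ^ j"
  have step: "?t x (Suc j) = q * x * ?t (q * x) j" for j
  proof -
    have "Suc j * (Suc j + 1) div 2 = Suc (j + j * (j + 1) div 2)"
      by (simp add: algebra_simps) 
    thus ?thesis by (simp add: power_add power_mult_distrib)
  qed
  have "partial_theta q x = ?t x 0 + (\<Sum>j. ?t x (Suc j))"
    unfolding partial_theta_def using suminf_split_head[OF theta_summable[OF assms, of x]] by simp
  also have "(\<Sum>j. ?t x (Suc j)) = q * x * partial_theta q (q * x)"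
    unfolding step partial_theta_def by (rule suminf_mult[OF theta_summable[OF assms]])
  finally show ?thesis by simp
qed

lemma theta_expand:
  assumes "norm q < 1"
  shows "partial_theta q x = 1 + q * x + q ^ 3 * x ^ 2 + q ^ 6 * x ^ 3 * partial_theta q (q ^ 3 * x)"
    and "partial_theta q x = 1 + q * x + q ^ 3 * x ^ 2 + q ^ 6 * x ^ 3 + q ^ 10 * x ^ 4 * partial_theta q (q ^ 4 * x)"
proof -
  have f: "partial_theta q (q ^ n * x) = 1 + q ^ Suc n * x * partial_theta q (q ^ Suc n * x)" for n
    using theta_functional[OF assms, of "q ^ n * x"] by (simp add: mult_ac)
  show "partial_theta q x = 1 + q * x + q ^ 3 * x ^ 2 + q ^ 6 * x ^ 3 * partial_theta q (q ^ 3 * x)"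
  proof -
    have "partial_theta q x = 1 + q * x * (1 + q ^ 2 * x * (1 + q ^ 3 * x * partial_theta q (q ^ 3 * x)))"
      using f[of 0] f[of 1] f[of 2] by (simp add: numeral_2_eq_2 numeral_3_eq_3)
    also have "\<dots> = 1 + q * x + q ^ 3 * x ^ 2 + q ^ 6 * x ^ 3 * partial_theta q (q ^ 3 * x)"
      by algebra
    finally show ?thesis .
  qed
  also have "partial_theta q (q ^ 3 * x) = 1 + q ^ 4 * x * partial_theta q (q ^ 4 * x)"
    using f[of 3] by (simp add: eval_nat_numeral)
  also have "1 + q * x + q ^ 3 * x ^ 2 + q ^ 6 * x ^ 3 * (1 + q ^ 4 * x * partial_theta q (q ^ 4 * x))
      = 1 + q * x + q ^ 3 * x ^ 2 + q ^ 6 * x ^ 3 + q ^ 10 * x ^ 4 * partial_theta q (q ^ 4 * x)"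
    by algebra
  finally show "partial_theta q x = 1 + q * x + q ^ 3 * x ^ 2 + q ^ 6 * x ^ 3 + q ^ 10 * x ^ 4 * partial_theta q (q ^ 4 * x)" .
qed

text \<open>A crude geometric bound. It suffices because the remainders produced by
  \<open>theta_expand\<close> evaluate the function at points where \<open>q * x\<close> is
  small.\<close>

lemma theta_norm_le:
  assumes "norm q < 1" "norm (q * x) < 1"
  shows "norm (partial_theta q x) \<le> 1 / (1 - norm (q * x))"
proof -
  let ?t = "\<lambda>j. q ^ (j * (j + 1) div 2) * x ^ j"
  have le: "norm (?t j) \<le> norm (q * x) ^ j" for j
  proof -
    have "norm q ^ (j * (j + 1) div 2) \<le> norm q ^ j"
      using assms(1) le_triangle by (intro power_decreasing) auto
    thus ?thesis by (simp add: norm_mult norm_power power_mult_distrib mult_right_mono)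
  qed
  have geo: "summable (\<lambda>j. norm (q * x) ^ j)" using assms(2) by (simp add: summable_geometric)
  have sn: "summable (\<lambda>j. norm (?t j))"
    by (rule summable_comparison_test'[OF geo]) (use le in auto)
  have "norm (partial_theta q x) \<le> (\<Sum>j. norm (?t j))"
    unfolding partial_theta_def by (rule summable_norm[OF sn])
  also have "\<dots> \<le> (\<Sum>j. norm (q * x) ^ j)" by (rule suminf_le[OF le sn geo])
  also have "\<dots> = 1 / (1 - norm (q * x))" using assms(2) by (simp add: suminf_geometric)
  finally show ?thesis .
qed

text \<open>Equals \<open>w\<close> to the power \<open>k\<close> times the sum of \<open>p\<close> to the power \<open>n\<^sup>2\<close> times \<open>w\<close> to the power
  \<open>n\<close> over \<open>n \<ge> -k\<close>. Unlike \<open>\<theta>\<close> with rescaled argument it extends continuously to \<open>p = 0\<close>.\<close>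

fun theta_trunc :: "nat \<Rightarrow> complex \<Rightarrow> complex \<Rightarrow> complex" where
  "theta_trunc 0 p w = 1 + p * w * partial_theta (p\<^sup>2) (p * w)"
| "theta_trunc (Suc k) p w = w * theta_trunc k p w + p ^ (Suc k)\<^sup>2"

text \<open>The unit circle for \<open>w = p^(2k+1) * x\<close> is the circle of radius
  \<open>|q|\<close> to the power \<open>-(k + 1/2)\<close> for \<open>x\<close>, which is the
  boundary between consecutive zeros in the definition of strong separation. The induction step
  replaces \<open>x\<close> by \<open>p^2 * x\<close> and uses the functional equation.\<close>

lemma theta_trunc_eq:
  assumes "norm p < 1"
  shows "theta_trunc k p (p ^ (2 * k + 1) * x) = p ^ k\<^sup>2 * partial_theta (p\<^sup>2) x"
proof (induction k arbitrary: x)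
  have p2: "norm (p\<^sup>2) < 1" using assms by (simp add: norm_power power_less_one_iff abs_square_less_1)
  case 0
  show ?case using theta_functional[OF p2, of x] by (simp add: power2_eq_square mult.assoc)
next
  have p2: "norm (p\<^sup>2) < 1" using assms by (simp add: norm_power power_less_one_iff abs_square_less_1)
  case (Suc k)
  let ?T = "partial_theta (p\<^sup>2) (p\<^sup>2 * x)"
  have "p ^ (2 * Suc k + 1) * x = p ^ (2 * k + 1) * (p\<^sup>2 * x)"
    by (simp add: power2_eq_square)
  hence "theta_trunc (Suc k) p (p ^ (2 * Suc k + 1) * x)
      = p ^ (2 * k + 1) * (p\<^sup>2 * x) * (p ^ k\<^sup>2 * ?T) + p ^ (Suc k)\<^sup>2"
    by (simp only: theta_trunc.simps Suc.IH)
  also have "p ^ (2 * k + 1) * (p\<^sup>2 * x) * (p ^ k\<^sup>2 * ?T) = p ^ (k\<^sup>2 + (2 * k + 1)) * (p\<^sup>2 * x * ?T)"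
    by (simp only: power_add mult_ac)
  also have "k\<^sup>2 + (2 * k + 1) = (Suc k)\<^sup>2" by (simp add: power2_eq_square)
  also have "p ^ (Suc k)\<^sup>2 * (p\<^sup>2 * x * ?T) + p ^ (Suc k)\<^sup>2 = p ^ (Suc k)\<^sup>2 * (1 + p\<^sup>2 * x * ?T)"
    by (simp only: distrib_left mult_1_right add.commute)
  also have "1 + p\<^sup>2 * x * ?T = partial_theta (p\<^sup>2) x"
    using theta_functional[OF p2, of x] by simp
  finally show ?case .
qed

lemma theta_trunc_0_left [simp]: "theta_trunc k 0 w = w ^ k"
  by (induction k) (auto simp: power_0_left)

lemma theta_trunc_holomorphic:
  assumes "norm p < 1"
  shows "theta_trunc k p holomorphic_on UNIV"
proof -
  have p2: "norm (p\<^sup>2) < 1" using assms by (simp add: norm_power power_less_one_iff abs_square_less_1)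
  show ?thesis
    by (induction k) (use p2 in \<open>auto intro!: holomorphic_intros\<close>)
qed

lemma continuous_on_theta_trunc:
  assumes "continuous_on A f" "continuous_on A g" "\<And>a. a \<in> A \<Longrightarrow> norm (f a) < 1"
  shows "continuous_on A (\<lambda>a. theta_trunc k (f a) (g a))"
proof -
  have p2: "norm ((f a)\<^sup>2) < 1" if "a \<in> A" for a
    using assms(3)[OF that] by (simp add: norm_power power_less_one_iff abs_square_less_1)
  show ?thesis
    by (induction k) (use p2 in \<open>auto intro!: continuous_intros assms(1,2)\<close>)
qed

text \<open>On the unit circle \<open>cnj w\<close> is \<open>1/w\<close>, so this is the two-sided
  form: \<open>theta_trunc 0\<close> collects the indices \<open>n \<ge> 0\<close>, the finite sum
  the indices from \<open>-k\<close> to \<open>-1\<close>.\<close>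

lemma theta_trunc_on_circle:
  assumes "norm w = 1"
  shows "theta_trunc k p w = w ^ k * (theta_trunc 0 p w + (\<Sum>n=1..k. p ^ n\<^sup>2 * cnj w ^ n))"
proof (induction k)
  case (Suc k)
  have "w * cnj w = 1" using assms by (simp add: complex_norm_square[symmetric])
  hence "w ^ Suc k * cnj w ^ Suc k = 1" by (metis power_mult_distrib power_one)
  thus ?case by (simp add: Suc.IH algebra_simps)
qed simp

lemma zeros_count_theta_trunc:
  assumes p: "norm p < 1"
    and nz: "\<And>t w. 0 < t \<Longrightarrow> t \<le> 1 \<Longrightarrow> norm w = 1 \<Longrightarrow> theta_trunc k (of_real t * p) w \<noteq> 0"
  shows "zeros_count (theta_trunc k p) 1 = int k"
proof -
  have lt: "norm (of_real t * p) < 1" if "t \<in> {0..1}" for t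
    using that p mult_left_le_one_le[of "norm p" t] by (auto simp: norm_mult)
  have "zeros_count (theta_trunc k (of_real 1 * p)) 1 = zeros_count (theta_trunc k (of_real 0 * p)) 1"
  proof (rule zeros_count_homotopy)
    show "continuous_on ({0..1} \<times> sphere 0 1) (\<lambda>(t, z). theta_trunc k (of_real t * p) z)"
      unfolding case_prod_unfold
      by (intro continuous_on_theta_trunc continuous_intros) (use lt in force)
    show "theta_trunc k (of_real t * p) holomorphic_on UNIV" if "t \<in> {0..1}" for t
      using theta_trunc_holomorphic[OF lt[OF that]] .
    show "theta_trunc k (of_real t * p) z \<noteq> 0" if "t \<in> {0..1}" "norm z = 1" for t z
      using nz[of t z] that by (cases "t = 0") auto
  qed auto
  also have "theta_trunc k (of_real 0 * p) = (\<lambda>w. w ^ k)" by (rule ext) simp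
  finally show ?thesis by (simp add: zeros_count_power)
qed

lemma zeros_count_theta:
  assumes p: "norm p < 1" "p \<noteq> 0"
    and nz: "\<And>t w. 0 < t \<Longrightarrow> t \<le> 1 \<Longrightarrow> norm w = 1 \<Longrightarrow> theta_trunc k (of_real t * p) w \<noteq> 0"
  shows "zeros_count (partial_theta (p\<^sup>2)) (1 / norm p ^ (2 * k + 1)) = int k"
proof -
  have p2: "norm (p\<^sup>2) < 1" using assms by (simp add: norm_power power_less_one_iff abs_square_less_1)
  define c where "c = p ^ (2 * k + 1)"
  have c: "c \<noteq> 0" "norm c = norm p ^ (2 * k + 1)"
    unfolding c_def norm_power using p(2) by simp_all
  have eq: "theta_trunc k p = (\<lambda>w. p ^ k\<^sup>2 * partial_theta (p\<^sup>2) (inverse c * w))"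
  proof
    fix w
    have cw: "c * (inverse c * w) = w" by (simp only: mult.assoc[symmetric] right_inverse[OF c(1)] mult_1_left)
    show "theta_trunc k p w = p ^ k\<^sup>2 * partial_theta (p\<^sup>2) (inverse c * w)"
      using theta_trunc_eq[OF p(1), of k "inverse c * w"] unfolding c_def[symmetric] cw .
  qed
  have "zeros_count (theta_trunc k p) 1 = int k"
    by (rule zeros_count_theta_trunc[OF p(1)]) (rule nz)
  hence "int k = zeros_count (\<lambda>w. p ^ k\<^sup>2 * partial_theta (p\<^sup>2) (inverse c * w)) 1"
    unfolding eq by (rule sym)
  also have "\<dots> = zeros_count (partial_theta (p\<^sup>2)) (norm (inverse c) * 1)"
    by (rule zeros_count_scale[OF theta_holomorphic[OF p2]]) (use p c in auto)
  also have "norm (inverse c) * 1 = 1 / norm p ^ (2 * k + 1)"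
    unfolding c(2)[symmetric] by (simp add: norm_inverse divide_inverse)
  finally show ?thesis by (rule sym)
qed

section \<open>Separation from zero-free circles\<close>

lemma powr_half_odd:
  assumes "norm p > 0"
  shows "norm ((p::complex)\<^sup>2) powr (- (real k + 1 / 2)) = 1 / norm p ^ (2 * k + 1)"
proof -
  have "norm (p\<^sup>2) powr (- (real k + 1 / 2)) = (norm p powr 2) powr (- (real k + 1 / 2))"
    using assms by (simp add: norm_power powr_numeral)
  also have "\<dots> = norm p powr (- real (2 * k + 1))"
  proof -
    have "2 * (- (real k + 1 / 2)) = - real (2 * k + 1)" by simp
    thus ?thesis unfolding powr_powr by (simp only:)
  qed
  also have "\<dots> = 1 / norm p ^ (2 * k + 1)"
    unfolding powr_minus powr_realpow[OF assms] by (simp only: inverse_eq_divide)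
  finally show ?thesis .
qed

text \<open>Circle number \<open>k\<close> encloses exactly \<open>k\<close> zeros, so two
  consecutive circles bound an annulus with one simple zero, which becomes \<open>\<xi> k\<close>.
  The circles exhaust the plane, hence every zero is listed.\<close>

lemma strongly_separatedI:
  assumes p: "norm p < 1" "p \<noteq> 0"
    and nz: "\<And>k t w. k \<ge> 1 \<Longrightarrow> 0 < t \<Longrightarrow> t \<le> 1 \<Longrightarrow> norm w = 1 \<Longrightarrow> theta_trunc k (of_real t * p) w \<noteq> 0"
  shows "strongly_separated (p\<^sup>2)"
proof -
  define \<theta> where "\<theta> = partial_theta (p\<^sup>2)"
  define r where "r k = 1 / norm p ^ (2 * k + 1)" for k
  \<comment> \<open>The first region is a full disk, since only the circles with
    \<open>k \<ge> 1\<close> are known to be free of zeros.\<close>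
  define lo where "lo k = (if k = 1 then 0 else r (k - 1))" for k :: nat
  have p2: "norm (p\<^sup>2) < 1" "p\<^sup>2 \<noteq> 0"
    using p by (auto simp: norm_power power_less_one_iff abs_square_less_1)
  have holo: "\<theta> holomorphic_on UNIV" unfolding \<theta>_def by (rule theta_holomorphic[OF p2(1)])
  have \<theta>0: "\<theta> 0 \<noteq> 0" by (simp add: \<theta>_def)
  have rpos: "r k > 0" for k using p(2) by (simp add: r_def)
  have r_mono: "r j \<le> r k" if "j \<le> k" for j k
  proof -
    have "norm p ^ (2 * k + 1) \<le> norm p ^ (2 * j + 1)"
      using p that by (intro power_decreasing) auto
    thus ?thesis using p(2) unfolding r_def by (intro divide_left_mono) auto
  qed
  have count: "zeros_count \<theta> (r k) = int k" if "k \<ge> 1" for k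
    unfolding \<theta>_def r_def by (rule zeros_count_theta[OF p]) (rule nz[OF that])
  have circle: "\<theta> z \<noteq> 0" if "k \<ge> 1" "norm z = r k" for k z
  proof
    assume "\<theta> z = 0"
    hence "theta_trunc k p (p ^ (2 * k + 1) * z) = 0"
      using theta_trunc_eq[OF p(1), of k z] by (simp add: \<theta>_def)
    moreover have "norm (p ^ (2 * k + 1) * z) = 1"
      using that p(2) unfolding norm_mult norm_power r_def by simp
    ultimately show False using nz[OF that(1), of 1 "p ^ (2 * k + 1) * z"] by simp
  qed
  have count_lo: "zeros_count \<theta> (lo k) = int k - 1" if "k \<ge> 1" for k
  proof (cases "k = 1")
    case True
    thus ?thesis by (simp add: lo_def zeros_count_def)
  next
    case False
    thus ?thesis using that count[of "k - 1"] by (simp add: lo_def)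
  qed
  have lo_le: "lo k \<le> r k" for k
    using r_mono[of "k - 1" k] rpos[of k] by (auto simp: lo_def)
  have annulus: "\<exists>\<xi>. \<theta> \<xi> = 0 \<and> lo k \<le> norm \<xi> \<and> norm \<xi> < r k \<and> zorder \<theta> \<xi> = 1 \<and>
      (\<forall>z. \<theta> z = 0 \<and> lo k \<le> norm z \<and> norm z < r k \<longrightarrow> z = \<xi>)" if k: "k \<ge> 1" for k
  proof -
    have "zeros_count \<theta> (lo k) \<noteq> zeros_count \<theta> (r k)"
      using count_lo[OF k] count[OF k] by simp
    then obtain \<xi> where \<xi>: "lo k \<le> norm \<xi>" "norm \<xi> < r k" "\<theta> \<xi> = 0"
      using zeros_count_annulus_empty lo_le by meson
    have "zorder \<theta> \<xi> \<le> 1"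
    proof -
      have "zeros_count \<theta> (lo k) + (\<Sum>z\<in>{\<xi>}. zorder \<theta> z) \<le> zeros_count \<theta> (r k)"
        by (rule zeros_count_mono_diff[OF holo \<theta>0 lo_le]) (use \<xi> in auto)
      thus ?thesis using count_lo[OF k] count[OF k] by simp
    qed
    moreover have "zorder \<theta> \<xi> \<ge> 1" using entire_zorder_pos[OF holo \<theta>0 \<xi>(3)] .
    moreover have "z = \<xi>" if z: "\<theta> z = 0" "lo k \<le> norm z" "norm z < r k" for z
    proof (rule ccontr)
      assume "z \<noteq> \<xi>"
      have "zeros_count \<theta> (lo k) + (\<Sum>z\<in>{z, \<xi>}. zorder \<theta> z) \<le> zeros_count \<theta> (r k)"
        by (rule zeros_count_mono_diff[OF holo \<theta>0 lo_le]) (use \<xi> z in auto)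
      hence "zorder \<theta> z + zorder \<theta> \<xi> \<le> 1"
        using \<open>z \<noteq> \<xi>\<close> count_lo[OF k] count[OF k] by simp
      moreover have "zorder \<theta> z \<ge> 1" using entire_zorder_pos[OF holo \<theta>0 z(1)] .
      ultimately show False using \<open>zorder \<theta> \<xi> \<ge> 1\<close> by simp
    qed
    ultimately have z1: "zorder \<theta> \<xi> = 1" and uniq: "\<And>z. \<theta> z = 0 \<Longrightarrow> lo k \<le> norm z \<Longrightarrow> norm z < r k \<Longrightarrow> z = \<xi>"
      by (auto intro: antisym)
    show ?thesis by (rule exI[of _ \<xi>]) (use z1 uniq \<xi> in blast)
  qed
  then obtain \<xi> where \<xi>: "\<And>k. k \<ge> 1 \<Longrightarrow> \<theta> (\<xi> k) = 0 \<and> lo k \<le> norm (\<xi> k) \<and> norm (\<xi> k) < r k \<and>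
      zorder \<theta> (\<xi> k) = 1 \<and> (\<forall>z. \<theta> z = 0 \<and> lo k \<le> norm z \<and> norm z < r k \<longrightarrow> z = \<xi> k)"
    by metis
  have cover: "\<exists>k\<ge>1. lo k \<le> norm z \<and> norm z < r k" for z
  proof -
    have "\<exists>n. (1 / norm p) ^ n > norm z"
      using p by (intro real_arch_pow) (simp add: field_simps)
    then obtain n where "norm z < (1 / norm p) ^ n" by auto
    also have "\<dots> \<le> (1 / norm p) ^ (2 * Suc n + 1)"
      using p by (intro power_increasing) (auto simp: field_simps)
    also have "\<dots> = r (Suc n)" by (simp only: r_def power_divide power_one)
    finally have ex: "\<exists>k. k \<ge> 1 \<and> norm z < r k" by (intro exI[of _ "Suc n"]) simp
    define k where "k = (LEAST k. k \<ge> 1 \<and> norm z < r k)"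
    have k: "k \<ge> 1" "norm z < r k" using LeastI_ex[OF ex] by (auto simp: k_def)
    have "lo k \<le> norm z"
    proof (cases "k = 1")
      case False
      have "\<not> (k - 1 \<ge> 1 \<and> norm z < r (k - 1))"
        by (rule not_less_Least, unfold k_def[symmetric]) (use k in simp)
      thus ?thesis using False k by (auto simp: lo_def)
    qed (simp add: lo_def)
    thus ?thesis using k by blast
  qed
  have inj: "k = k'" if "k \<ge> 1" "k' \<ge> 1" "\<xi> k = \<xi> k'" for k k'
  proof -
    have "\<not> (a < b)" if "a \<ge> 1" "b \<ge> 1" "\<xi> a = \<xi> b" for a b
    proof
      assume "a < b"
      hence "r a \<le> lo b" using that r_mono[of a "b - 1"] by (auto simp: lo_def)
      thus False using \<xi>[OF that(1)] \<xi>[OF that(2)] that(3) by auto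
    qed
    thus ?thesis using that by (metis linorder_neqE_nat)
  qed
  have "lists_zeros \<theta> \<xi>"
    unfolding lists_zeros_def
  proof
    fix z
    show "finite {k. 1 \<le> k \<and> \<xi> k = z} \<and>
        card {k. 1 \<le> k \<and> \<xi> k = z} = (if \<theta> z = 0 then nat (zorder \<theta> z) else 0)"
    proof (cases "\<theta> z = 0")
      case True
      obtain k where k: "k \<ge> 1" "lo k \<le> norm z" "norm z < r k" using cover by blast
      hence z: "\<xi> k = z" using \<xi>[OF k(1)] True by auto
      hence "{k. 1 \<le> k \<and> \<xi> k = z} = {k}" using inj k(1) by auto
      moreover have "zorder \<theta> z = 1" using \<xi>[OF k(1)] z by simp
      ultimately show ?thesis using True by simp
    next
      case False
      hence e: "{k. 1 \<le> k \<and> \<xi> k = z} = {}" using \<xi> by auto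
      show ?thesis using False unfolding e by simp
    qed
  qed
  hence lz: "lists_zeros (partial_theta (p\<^sup>2)) \<xi>" by (simp add: \<theta>_def)
  have pw: "norm (p\<^sup>2) powr (- (real k + 1 / 2)) = r k" for k
    unfolding r_def by (rule powr_half_odd) (use p in simp)
  have "- (real 1 + 1 / 2) = - (3 / 2 :: real)" by simp
  hence first: "norm (p\<^sup>2) powr (- (3 / 2)) = r 1" using pw[of 1] by (simp only:)
  have pos: "0 < norm (\<xi> 1)" using \<xi>[of 1] \<theta>0 by auto
  have rest: "norm (p\<^sup>2) powr (- (real k - 1 / 2)) < norm (\<xi> k) \<and>
      norm (\<xi> k) < norm (p\<^sup>2) powr (- (real k + 1 / 2))" if k: "k \<ge> 2" for k
  proof -
    have "- (real k - 1 / 2) = - (real (k - 1) + 1 / 2)" using k by (simp add: of_nat_diff)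
    hence lo1: "norm (p\<^sup>2) powr (- (real k - 1 / 2)) = r (k - 1)" using pw[of "k - 1"] by (simp only:)
    have lo2: "lo k = r (k - 1)" using k by (simp add: lo_def)
    have "1 \<le> k" "1 \<le> k - 1" using k by simp_all
    have ne: "norm (\<xi> k) \<noteq> r (k - 1)" using circle[OF \<open>1 \<le> k - 1\<close>] \<xi>[OF \<open>1 \<le> k\<close>] by blast
    from \<xi>[OF \<open>1 \<le> k\<close>] have "r (k - 1) \<le> norm (\<xi> k)" "norm (\<xi> k) < r k" unfolding lo2 by simp_all
    thus ?thesis unfolding lo1 pw using ne by simp
  qed
  show ?thesis
    unfolding strongly_separated_def
  proof (intro conjI exI[of _ \<xi>] allI impI)
    show "norm (\<xi> 1) < norm (p\<^sup>2) powr (- (3 / 2))" unfolding first using \<xi>[of 1] by simp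
  qed (use p2 lz pos rest in \<open>simp_all only: zero_less_norm_iff not_False_eq_True\<close>)
qed

text \<open>A multiple zero would occur at two indices of the list, but the bounds make the moduli
  strictly increasing.\<close>

lemma strongly_separated_not_spectral:
  assumes "strongly_separated q"
  shows "\<not> spectral_number q"
proof
  assume "spectral_number q"
  then obtain z where z: "partial_theta q z = 0" "zorder (partial_theta q) z \<ge> 2"
    by (auto simp: spectral_number_def multiple_zero_def)
  from assms obtain \<xi> where \<xi>: "0 < norm q" "norm q < 1" "lists_zeros (partial_theta q) \<xi>"
    "norm (\<xi> 1) < norm q powr (- (3 / 2))"
    "\<And>k. k \<ge> 2 \<Longrightarrow> norm q powr (- (real k - 1 / 2)) < norm (\<xi> k) \<and>
        norm (\<xi> k) < norm q powr (- (real k + 1 / 2))"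
    by (auto simp: strongly_separated_def)
  have "card {k. k \<ge> 1 \<and> \<xi> k = z} \<ge> 2"
  proof -
    have "card {k. k \<ge> 1 \<and> \<xi> k = z} = nat (zorder (partial_theta q) z)"
      using \<xi>(3) z(1) unfolding lists_zeros_def by metis
    thus ?thesis using z(2) by linarith
  qed
  hence "\<not> card {k. k \<ge> 1 \<and> \<xi> k = z} \<le> Suc 0" by simp
  moreover have "finite {k. k \<ge> 1 \<and> \<xi> k = z}" using \<xi>(3) by (simp add: lists_zeros_def)
  ultimately obtain k l where kl: "k \<ge> 1" "l \<ge> 1" "\<xi> k = z" "\<xi> l = z" "k \<noteq> l"
    using card_le_Suc0_iff_eq by blast
  have "\<xi> k \<noteq> \<xi> l" if "k \<ge> 1" "k < l" for k l
  proof -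
    have "norm (\<xi> k) < norm q powr (- (real k + 1 / 2))"
      using \<xi>(4) \<xi>(5)[of k] that(1) by (cases "k = 1") auto
    also have "\<dots> \<le> norm q powr (- (real l - 1 / 2))"
      using \<xi>(1,2) that by (intro powr_mono') auto
    also have "\<dots> < norm (\<xi> l)" using \<xi>(5)[of l] that by auto
    finally show ?thesis by auto
  qed
  thus False using kl by (metis linorder_neqE_nat)
qed

section \<open>The disk of radius \<open>c\<^sub>0\<close>\<close>

lemma norm_square_less_1: "norm (p::complex) < 1 \<Longrightarrow> norm (p\<^sup>2) < 1"
  by (simp add: norm_power power_less_one_iff abs_square_less_1)

lemma theta_trunc_0_expand:
  assumes "norm p < 1"
  shows "theta_trunc 0 p w = 1 + p * w + p ^ 4 * w ^ 2 + p ^ 9 * w ^ 3 + p ^ 16 * w ^ 4 * partial_theta (p\<^sup>2) (p ^ 7 * w)"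
proof -
  have "partial_theta (p\<^sup>2) (p * w) = 1 + p\<^sup>2 * (p * w) + (p\<^sup>2) ^ 3 * (p * w) ^ 2
      + (p\<^sup>2) ^ 6 * (p * w) ^ 3 * partial_theta (p\<^sup>2) ((p\<^sup>2) ^ 3 * (p * w))"
    by (rule theta_expand(1)[OF norm_square_less_1[OF assms]])
  also have "(p\<^sup>2) ^ 3 * (p * w) = p ^ 7 * w" by algebra
  finally have e: "partial_theta (p\<^sup>2) (p * w) = 1 + p\<^sup>2 * (p * w) + (p\<^sup>2) ^ 3 * (p * w) ^ 2
      + (p\<^sup>2) ^ 6 * (p * w) ^ 3 * partial_theta (p\<^sup>2) (p ^ 7 * w)" .
  show ?thesis unfolding theta_trunc.simps e by algebra
qed

text \<open>One half of the two-sided sum at \<open>w = 1\<close> without its central term. In these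
  terms \<open>c0\<close> is the square of the solution of
  \<open>2 * gauss_sum \<rho> = 1\<close>.\<close>

definition gauss_sum :: "real \<Rightarrow> real" where
  "gauss_sum \<rho> = (\<Sum>n. \<rho> ^ (Suc n)\<^sup>2)"

lemma gauss_sum_summable:
  fixes \<rho> :: real
  assumes "0 \<le> \<rho>" "\<rho> < 1"
  shows "summable (\<lambda>n. \<rho> ^ (Suc n)\<^sup>2)"
proof (rule summable_comparison_test')
  show "summable (\<lambda>n. \<rho> ^ n)" using assms by (simp add: summable_geometric)
  have "n \<le> (Suc n)\<^sup>2" for n by (simp add: power2_eq_square)
  thus "norm (\<rho> ^ (Suc n)\<^sup>2) \<le> \<rho> ^ n" if "n \<ge> 0" for n
    using assms by (simp add: power_decreasing)
qed

lemma square_Suc_triangle: "2 * (j * (j + 1) div 2) + j + 1 = (Suc j)\<^sup>2"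
  by (simp add: power2_eq_square algebra_simps)

lemma theta_term_square:
  "p * w * ((p\<^sup>2) ^ (j * (j + 1) div 2) * (p * w) ^ j) = (p::complex) ^ (Suc j)\<^sup>2 * w ^ Suc j"
proof -
  have "p * w * ((p\<^sup>2) ^ (j * (j + 1) div 2) * (p * w) ^ j)
      = p ^ (2 * (j * (j + 1) div 2) + j + 1) * w ^ Suc j"
    by (simp only: power_mult[symmetric] power_mult_distrib power_add power_one_right power_Suc mult_ac)
  thus ?thesis unfolding square_Suc_triangle .
qed

lemma theta_trunc_0_sums:
  assumes "norm p < 1"
  shows "(\<lambda>j. p ^ (Suc j)\<^sup>2 * w ^ Suc j) sums (p * w * partial_theta (p\<^sup>2) (p * w))"
  using sums_mult[OF summable_sums[OF theta_summable[OF norm_square_less_1[OF assms], of "p * w"]], of "p * w"]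
  unfolding theta_term_square by (simp add: partial_theta_def)

text \<open>Lets \<open>gauss_sum\<close> inherit its continuity from
  \<open>partial_theta\<close>.\<close>

lemma gauss_sum_eq:
  assumes "0 \<le> \<rho>" "\<rho> < 1"
  shows "complex_of_real (gauss_sum \<rho>) = of_real \<rho> * partial_theta ((of_real \<rho>)\<^sup>2) (of_real \<rho>)"
proof -
  have "(\<lambda>j. complex_of_real (\<rho> ^ (Suc j)\<^sup>2)) sums of_real (gauss_sum \<rho>)"
    unfolding gauss_sum_def by (intro sums_of_real summable_sums gauss_sum_summable assms)
  moreover have "(\<lambda>j. complex_of_real (\<rho> ^ (Suc j)\<^sup>2)) sums (of_real \<rho> * partial_theta ((of_real \<rho>)\<^sup>2) (of_real \<rho>))"
    using theta_trunc_0_sums[of "of_real \<rho>" 1] assms by (simp add: norm_power)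
  ultimately show ?thesis by (rule sums_unique2)
qed

lemma continuous_on_gauss_sum: "continuous_on {0..<1} gauss_sum"
proof -
  have "continuous_on {0..<1} (\<lambda>\<rho>. Re (of_real \<rho> * partial_theta ((of_real \<rho>)\<^sup>2) (of_real \<rho>)))"
    by (intro continuous_intros) (auto simp: norm_power power_less_one_iff abs_square_less_1)
  also have "?this \<longleftrightarrow> ?thesis"
  proof (rule continuous_on_cong)
    fix \<rho> :: real assume "\<rho> \<in> {0..<1}"
    hence "complex_of_real (gauss_sum \<rho>) = of_real \<rho> * partial_theta ((of_real \<rho>)\<^sup>2) (of_real \<rho>)"
      by (intro gauss_sum_eq) auto
    thus "Re (of_real \<rho> * partial_theta ((of_real \<rho>)\<^sup>2) (of_real \<rho>)) = gauss_sum \<rho>"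
      by (metis Re_complex_of_real)
  qed simp
  finally show ?thesis .
qed

lemma gauss_sum_strict_mono:
  assumes "0 \<le> \<rho>" "\<rho> < \<sigma>" "\<sigma> < 1"
  shows "gauss_sum \<rho> < gauss_sum \<sigma>"
proof -
  have s: "summable (\<lambda>n. \<rho> ^ (Suc n)\<^sup>2)" "summable (\<lambda>n. \<sigma> ^ (Suc n)\<^sup>2)"
    using assms by (intro gauss_sum_summable; simp)+
  have "0 < (\<Sum>n. \<sigma> ^ (Suc n)\<^sup>2 - \<rho> ^ (Suc n)\<^sup>2)"
  proof (rule suminf_pos)
    show "0 < \<sigma> ^ (Suc n)\<^sup>2 - \<rho> ^ (Suc n)\<^sup>2" for n
      using assms by (simp add: power_strict_mono)
  qed (rule summable_diff[OF s(2,1)])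
  also have "\<dots> = gauss_sum \<sigma> - gauss_sum \<rho>"
    unfolding gauss_sum_def by (rule suminf_diff[OF s(2,1), symmetric])
  finally show ?thesis by simp
qed

lemma gauss_sum_sqrt:
  assumes "0 < s" "s < 1"
  shows "(\<Sum>n. s powr ((real (Suc n))\<^sup>2 / 2)) = gauss_sum (sqrt s)"
proof -
  have "s powr ((real (Suc n))\<^sup>2 / 2) = sqrt s ^ (Suc n)\<^sup>2" for n
  proof -
    have "s powr ((real (Suc n))\<^sup>2 / 2) = (s powr (1 / 2)) powr (real ((Suc n)\<^sup>2))"
      by (simp add: powr_powr)
    also have "\<dots> = sqrt s ^ (Suc n)\<^sup>2"
      using assms by (subst powr_realpow) (auto simp: powr_half_sqrt)
    finally show ?thesis .
  qed
  thus ?thesis by (simp only: gauss_sum_def)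
qed

lemma gauss_sum_0: "gauss_sum 0 = 0"
proof -
  have "(0::real) ^ (Suc n)\<^sup>2 = 0" for n by (rule zero_power) simp
  thus ?thesis by (simp only: gauss_sum_def suminf_zero)
qed

lemma gauss_sum_half: "gauss_sum (1 / 2) > 1 / 2"
proof -
  have "(\<Sum>n<2. (1 / 2 :: real) ^ (Suc n)\<^sup>2) \<le> gauss_sum (1 / 2)"
    unfolding gauss_sum_def by (rule sum_le_suminf) (auto intro: gauss_sum_summable)
  thus ?thesis by (simp add: eval_nat_numeral)
qed

text \<open>Justifies the definite description: a root exists by the intermediate value theorem,
  since the first two terms at 1/2 already exceed 1/2, and strict monotonicity makes it
  unique.\<close>

lemma c0_root: "0 < c0" "c0 < 1 / 4" "2 * gauss_sum (sqrt c0) = 1"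
proof -
  have "\<exists>\<rho>. 0 \<le> \<rho> \<and> \<rho> \<le> 1 / 2 \<and> gauss_sum \<rho> = 1 / 2"
  proof (rule IVT')
    show "gauss_sum 0 \<le> 1 / 2" by (simp add: gauss_sum_0)
    show "continuous_on {0..1 / 2} gauss_sum"
      by (rule continuous_on_subset[OF continuous_on_gauss_sum]) auto
  qed (use gauss_sum_half in auto)
  then obtain \<rho> where \<rho>: "0 \<le> \<rho>" "\<rho> \<le> 1 / 2" "gauss_sum \<rho> = 1 / 2" by blast
  have ne: "\<rho> \<noteq> 0" using \<rho>(3) gauss_sum_0 by auto
  have "\<rho> \<noteq> 1 / 2"
  proof
    assume "\<rho> = 1 / 2"
    thus False using \<rho>(3) gauss_sum_half by (simp only:)
  qed
  note ne = ne this
  have lt: "0 < \<rho>" "\<rho> < 1 / 2" using \<rho> ne by auto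
  have c0: "c0 = \<rho>\<^sup>2"
    unfolding c0_def
  proof (rule the_equality)
    have \<rho>1: "0 < \<rho>\<^sup>2" "\<rho>\<^sup>2 < 1" using lt by (auto simp: abs_square_less_1)
    show "0 < \<rho>\<^sup>2 \<and> \<rho>\<^sup>2 < 1 \<and> 2 * (\<Sum>n. \<rho>\<^sup>2 powr ((real (Suc n))\<^sup>2 / 2)) = 1"
      using \<rho>1 gauss_sum_sqrt[OF \<rho>1] \<rho> by simp
  next
    fix s assume s: "0 < s \<and> s < 1 \<and> 2 * (\<Sum>n. s powr ((real (Suc n))\<^sup>2 / 2)) = 1"
    hence g: "gauss_sum (sqrt s) = gauss_sum \<rho>" using gauss_sum_sqrt[of s] \<rho>(3) by simp
    have "sqrt s = \<rho>"
      using gauss_sum_strict_mono[of "sqrt s" \<rho>] gauss_sum_strict_mono[of \<rho> "sqrt s"] g s lt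
      by (cases "sqrt s" \<rho> rule: linorder_cases) auto
    thus "s = \<rho>\<^sup>2" using s by auto
  qed
  have "\<rho>\<^sup>2 < (1 / 2)\<^sup>2" using lt by (intro power_strict_mono) auto
  thus "0 < c0" "c0 < 1 / 4" using lt unfolding c0 by (simp_all add: power2_eq_square)
  have "sqrt c0 = \<rho>" unfolding c0 using lt by simp
  thus "2 * gauss_sum (sqrt c0) = 1" using \<rho>(3) by simp
qed

text \<open>The terms with positive and those with negative index have norm at most
  \<open>gauss_sum (norm p) < 1/2\<close> each, which cannot cancel the central term 1.\<close>

lemma theta_trunc_nonzero_small:
  assumes p: "norm (p\<^sup>2) < c0" and w: "norm w = 1"
  shows "theta_trunc k p w \<noteq> 0"
proof -
  have lt: "norm p < sqrt c0"
    using p by (metis norm_ge_zero norm_power real_less_rsqrt)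
  have p1: "norm p < 1"
    using lt c0_root(2) real_sqrt_lt_1_iff[of c0] by linarith
  have c1: "sqrt c0 < 1" using c0_root(2) real_sqrt_lt_1_iff[of c0] by linarith
  have g: "2 * gauss_sum (norm p) < 1"
    using gauss_sum_strict_mono[OF norm_ge_zero lt c1] c0_root(3) by simp
  note sm = gauss_sum_summable[OF norm_ge_zero p1]
  have "norm (p * w * partial_theta (p\<^sup>2) (p * w)) \<le> gauss_sum (norm p)"
  proof -
    have t: "norm (p ^ (Suc j)\<^sup>2 * w ^ Suc j) = norm p ^ (Suc j)\<^sup>2" for j
      unfolding norm_mult norm_power w by simp
    have "p * w * partial_theta (p\<^sup>2) (p * w) = (\<Sum>j. p ^ (Suc j)\<^sup>2 * w ^ Suc j)"
      using theta_trunc_0_sums[OF p1] by (rule sums_unique)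
    also have "norm \<dots> \<le> (\<Sum>j. norm (p ^ (Suc j)\<^sup>2 * w ^ Suc j))"
      by (rule summable_norm) (simp only: t sm)
    finally show ?thesis by (simp only: t gauss_sum_def)
  qed
  moreover have "norm (\<Sum>n=1..k. p ^ n\<^sup>2 * cnj w ^ n) \<le> gauss_sum (norm p)"
  proof -
    have "norm (\<Sum>n=1..k. p ^ n\<^sup>2 * cnj w ^ n) \<le> (\<Sum>n=1..k. norm p ^ n\<^sup>2)"
      by (rule order_trans[OF norm_sum]) (simp add: norm_mult norm_power w)
    also have "\<dots> = (\<Sum>n<k. norm p ^ (Suc n)\<^sup>2)"
      by (rule sum.reindex_bij_witness[of _ Suc "\<lambda>n. n - 1"]) auto
    also have "\<dots> \<le> gauss_sum (norm p)"
      unfolding gauss_sum_def by (rule sum_le_suminf[OF sm]) auto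
    finally show ?thesis .
  qed
  ultimately have "norm (p * w * partial_theta (p\<^sup>2) (p * w) + (\<Sum>n=1..k. p ^ n\<^sup>2 * cnj w ^ n)) < 1"
    using g norm_triangle_ineq[of "p * w * partial_theta (p\<^sup>2) (p * w)" "\<Sum>n=1..k. p ^ n\<^sup>2 * cnj w ^ n"]
    by linarith
  hence "1 + (p * w * partial_theta (p\<^sup>2) (p * w) + (\<Sum>n=1..k. p ^ n\<^sup>2 * cnj w ^ n)) \<noteq> 0"
    by (metis add.inverse_unique less_irrefl norm_minus_cancel norm_one)
  moreover have "theta_trunc k p w = w ^ k * (theta_trunc 0 p w + (\<Sum>n=1..k. p ^ n\<^sup>2 * cnj w ^ n))"
    by (rule theta_trunc_on_circle[OF w])
  moreover have "w ^ k \<noteq> 0" using w by auto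
  ultimately show ?thesis by (simp add: add.assoc)
qed

lemma strongly_separated_small:
  assumes "norm q < c0" "q \<noteq> 0"
  shows "strongly_separated q"
proof -
  obtain p where q: "q = p\<^sup>2" by (metis power2_csqrt)
  have "norm (p\<^sup>2) < 1" using assms c0_root unfolding q by linarith
  hence "norm p < 1" by (simp add: norm_power power_less_one_iff abs_square_less_1)
  moreover have "p \<noteq> 0" using assms(2) q by auto
  moreover have "theta_trunc k (of_real t * p) w \<noteq> 0" if "0 < t" "t \<le> 1" "norm w = 1" for k t w
  proof (rule theta_trunc_nonzero_small[OF _ that(3)])
    have "norm ((of_real t * p)\<^sup>2) = t\<^sup>2 * norm (p\<^sup>2)" by (simp add: norm_mult norm_power power_mult_distrib)
    also have "\<dots> \<le> 1 * norm (p\<^sup>2)" using that by (intro mult_right_mono) (auto simp: power_le_one)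
    finally show "norm ((of_real t * p)\<^sup>2) < c0" using assms(1) q by simp
  qed
  ultimately show ?thesis unfolding q by (intro strongly_separatedI) auto
qed

section \<open>The sector\<close>

lemma power_le_numeral_bound:
  fixes \<rho> :: real
  assumes "0 < \<rho>" "\<rho> \<le> 0.7746"
  shows "\<rho> ^ 3 \<le> 0.464765" "\<rho> ^ 4 \<le> 0.36001" "\<rho> ^ 5 \<le> 0.278861" "\<rho> ^ 8 \<le> 0.129605"
    "\<rho> ^ 12 \<le> 0.046659" "\<rho> ^ 15 \<le> 0.021686"
proof -
  have "\<rho> ^ n \<le> 0.7746 ^ n" for n using assms by (intro power_mono) auto
  from this[of 3] this[of 4] this[of 5] this[of 8] this[of 12] this[of 15]
  show "\<rho> ^ 3 \<le> 0.464765" "\<rho> ^ 4 \<le> 0.36001" "\<rho> ^ 5 \<le> 0.278861" "\<rho> ^ 8 \<le> 0.129605"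
    "\<rho> ^ 12 \<le> 0.046659" "\<rho> ^ 15 \<le> 0.021686"
    by (simp_all add: power_divide)
qed

lemma inverse_le_numeral_bound:
  fixes h \<rho> :: real
  assumes "0 < \<rho>" "\<rho> \<le> 0.7746" "h * \<rho> = 1"
  shows "1.29098 \<le> h"
proof -
  have "1 / 0.7746 \<le> 1 / \<rho>" using assms by (intro divide_left_mono) auto
  moreover have "h = 1 / \<rho>" using assms by (simp add: field_simps)
  ultimately show ?thesis by simp
qed

text \<open>As \<open>h = 1 / \<rho>\<close>, multiplying the hypothesis by \<open>h^3\<close> gives
  \<open>h^4 \<le> K\<close>.\<close>

lemma inverse_fourth_power_le:
  fixes h \<rho> K :: real
  assumes "0 < \<rho>" "h * \<rho> = 1" "h \<le> \<rho> ^ 3 * K" "K \<le> B ^ 4" "0 \<le> B"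
  shows "h \<le> B"
proof -
  have h: "h > 0" using assms(1,2) by (metis zero_less_mult_pos2 zero_less_one)
  have "h ^ 3 * h \<le> h ^ 3 * (\<rho> ^ 3 * K)" using assms h by (intro mult_left_mono) auto
  also have "\<dots> = (h * \<rho>) ^ 3 * K" by (simp only: power_mult_distrib mult.assoc)
  finally have "h ^ 4 \<le> B ^ 4" using assms by (simp add: power_numeral_reduce mult.commute)
  thus ?thesis using assms(5) h by (simp add: power_mono_iff)
qed

text \<open>For \<open>A = cos \<phi>\<close> and \<open>s = sin \<phi>\<close> with
  \<open>\<phi>\<close> between \<open>pi/8\<close> and \<open>pi/2\<close>, the expressions are
  \<open>cos (3\<phi>)\<close> and \<open>sin (3\<phi>) / sin \<phi>\<close>; the upper bounds are
  their values at \<open>pi/8\<close>, rounded up.\<close>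

lemma triple_angle_bounds:
  fixes A s :: real
  assumes A: "0 \<le> A" "A \<le> 0.92389" and s: "0.38267 \<le> s" and As: "A\<^sup>2 + s\<^sup>2 = 1"
  shows "A * (4 * A\<^sup>2 - 3) \<le> 0.3828" "- 1 \<le> A * (4 * A\<^sup>2 - 3)" "3 - 4 * s\<^sup>2 \<le> 2.41426" "s \<le> 1"
proof -
  have A2: "A\<^sup>2 \<le> 0.92389\<^sup>2" using A by (intro power_mono) auto
  have "A * (4 * A\<^sup>2 - 3) \<le> A * 0.414292"
    using A A2 by (intro mult_left_mono) (auto simp: power2_eq_square)
  also have "\<dots> \<le> 0.3828" using A by simp
  finally show "A * (4 * A\<^sup>2 - 3) \<le> 0.3828" .
  have "0 \<le> (A + 1) * (2 * A - 1)\<^sup>2" using A by simp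
  thus "- 1 \<le> A * (4 * A\<^sup>2 - 3)" by (simp add: power2_eq_square algebra_simps)
  have "0.38267\<^sup>2 \<le> s\<^sup>2" using s by (intro power_mono) auto
  thus "3 - 4 * s\<^sup>2 \<le> 2.41426" by (simp add: power2_eq_square)
  have "s\<^sup>2 \<le> 1" using As by (metis le_add_same_cancel2 zero_le_power2)
  thus "s \<le> 1" using power2_le_imp_le[of s 1] by simp
qed

text \<open>The case \<open>k = 2\<close>. The imaginary part divided by \<open>s\<close> bounds
  \<open>h\<close>, which is at least 1.29, in terms of \<open>c^2 - 2\<close>; this forces
  \<open>|c| > 1.67\<close>. The real part then makes \<open>c\<close> negative and bounds
  \<open>-c\<close> by \<open>h\<close> and \<open>c^2 - 2\<close>. The two bounds are
  incompatible.\<close>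

lemma sector_core_2:
  fixes h \<rho> A s c :: real and R :: complex
  assumes \<rho>: "0 < \<rho>" "\<rho> \<le> 0.7746" and h: "h * \<rho> = 1" 
    and s: "0.38267 \<le> s" and A: "0 \<le> A" "A \<le> 0.92389" and As: "A\<^sup>2 + s\<^sup>2 = 1"
    and c: "\<bar>c\<bar> \<le> 2" and R: "norm R \<le> \<rho> ^ 8 + 1.12 * \<rho> ^ 15"
    and Im: "s * h = \<rho> ^ 3 * (c\<^sup>2 - 2) * (s * (3 - 4 * s\<^sup>2)) + Im R"
    and Re: "A * h + c + \<rho> ^ 3 * (c\<^sup>2 - 2) * (A * (4 * A\<^sup>2 - 3)) + Re R = 0"
  shows False
proof -
  note pw = power_le_numeral_bound[OF \<rho>]
  note tr = triple_angle_bounds[OF A s As]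
  define T where "T = \<rho> ^ 8 + 1.12 * \<rho> ^ 15"
  define c' where "c' = c\<^sup>2 - 2"
  define g where "g = 3 - 4 * s\<^sup>2"
  define V where "V = A * (4 * A\<^sup>2 - 3)"
  have V: "- 1 \<le> V" "V \<le> 0.3828" using tr by (auto simp: V_def)
  have g: "g \<le> 2.41426" using tr by (simp add: g_def)
  have \<rho>3: "0 < \<rho> ^ 3" using \<rho> by simp
  have h1: "h \<ge> 1.29098"
    by (rule inverse_le_numeral_bound[OF \<rho> h])
  have c2: "c\<^sup>2 \<le> 4" using c power_mono[of "\<bar>c\<bar>" 2 2] by simp
  hence c': "- 2 \<le> c'" "c' \<le> 2" by (auto simp: c'_def)
  have T: "T \<le> 0.1539" "0 \<le> T" using pw(4,6) \<rho> by (auto simp: T_def)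
  have R': "\<bar>Re R\<bar> \<le> T" "\<bar>Im R\<bar> \<le> T"
    using R abs_Re_le_cmod[of R] abs_Im_le_cmod[of R] by (auto simp: T_def)
  have "s * h \<le> s * (\<rho> ^ 3 * c' * g + T / s)"
  proof -
    have "s * h = s * (\<rho> ^ 3 * c' * g) + Im R" using Im by (simp add: c'_def g_def mult.left_commute)
    thus ?thesis using R'(2) s by (simp add: distrib_left)
  qed
  hence hle: "h \<le> \<rho> ^ 3 * c' * g + T / s" by (rule mult_left_le_imp_le) (use s in simp)
  have Ts: "T / s \<le> 2.61322 * T"
  proof -
    have "T / s \<le> T / 0.38267" using T s by (intro divide_left_mono) auto
    thus ?thesis using T by simp
  qed
  \<comment> \<open>For \<open>c' \<le> 0\<close> the product \<open>c' * g\<close> is positive only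
    if \<open>g < 0\<close>, that is \<open>s > 0.866\<close>. There \<open>-g \<le> 1\<close>, so
    the right-hand side of \<open>hle\<close> remains below 1.29.\<close>
  have c'pos: "c' > 0"
  proof (rule ccontr)
    assume "\<not> ?thesis"
    hence neg: "c' \<le> 0" by simp
    show False
    proof (cases "g \<ge> 0")
      case True
      have "\<rho> ^ 3 * c' * g \<le> 0" using neg True \<rho>3 by (simp add: mult_nonneg_nonpos mult_nonneg_nonpos2)
      thus False using hle h1 Ts T by simp
    next
      case False
      have "s > 0.866"
      proof (rule ccontr)
        assume "\<not> ?thesis"
        hence "s\<^sup>2 \<le> 0.866\<^sup>2" using s by (intro power_mono) auto
        thus False using False by (simp add: g_def power2_eq_square)
      qed
      hence "T / s \<le> T / 0.866" using T by (intro divide_left_mono) auto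
      moreover have "- g \<le> 1" using tr(4) s power_mono[of s 1 2] by (simp add: g_def)
      hence "(- c') * (- g) \<le> 2 * 1" using neg False c' by (intro mult_mono) auto
      hence "\<rho> ^ 3 * (c' * g) \<le> 0.464765 * 2" using pw(1) \<rho>3 neg False
        by (intro mult_mono) (auto simp: mult_nonpos_nonpos)
      ultimately show False using hle h1 T by (simp add: mult.assoc)
    qed
  qed
  have c'g: "\<rho> ^ 3 * c' * g \<le> 2.41426 * (\<rho> ^ 3 * c')"
  proof -
    have "c' * g \<le> 2.41426 * c'" using g c'pos mult_left_mono[of g "2.41426" c'] by simp
    hence "\<rho> ^ 3 * (c' * g) \<le> \<rho> ^ 3 * (2.41426 * c')" using \<rho>3 by (intro mult_left_mono) auto
    thus ?thesis by (simp only: mult.assoc mult.left_commute[of "2.41426"])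
  qed
  have r3c: "\<rho> ^ 3 * c' \<le> 0.464765 * c'" using pw(1) c'pos by (intro mult_right_mono) auto
  have h2: "h \<le> 1.12207 * c' + 0.40218" 
  proof -
    have "h \<le> 1.12207 * c' + 0.40218"
      if "h \<le> a + t" "a \<le> 2.41426 * x" "x \<le> 0.464765 * c'" "t \<le> 2.61322 * T" for a t x
      using that T c'pos by simp
    from this[OF hle c'g r3c Ts] show ?thesis .
  qed
  hence c'79: "c' \<ge> 0.7919" using h1 by simp
  have Vb: "- 0.92953 \<le> \<rho> ^ 3 * c' * V" "\<rho> ^ 3 * c' * V \<le> 0.17792 * c'"
  proof -
    have p: "0 \<le> \<rho> ^ 3 * c'" "\<rho> ^ 3 * c' \<le> 0.92953"
      using \<rho>3 c'pos mult_mono[OF pw(1) c'(2)] by auto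
    have "\<rho> ^ 3 * c' * (- 1) \<le> \<rho> ^ 3 * c' * V" using p V by (intro mult_left_mono) auto
    thus "- 0.92953 \<le> \<rho> ^ 3 * c' * V" using p by simp
    have "\<rho> ^ 3 * c' * V \<le> \<rho> ^ 3 * c' * 0.3828" using p V by (intro mult_left_mono) auto
    moreover have "x * 0.3828 \<le> 0.17792 * c'" if "x \<le> 0.464765 * c'" for x using that c'pos by simp
    ultimately show "\<rho> ^ 3 * c' * V \<le> 0.17792 * c'" using r3c order_trans by blast
  qed
  have Re': "A * h + c + \<rho> ^ 3 * c' * V + Re R = 0" using Re by (simp add: c'_def V_def)
  have Ah: "0 \<le> A * h" "A * h \<le> 0.92389 * h" using A h1 by (auto intro: mult_right_mono)
  have abs_c: "\<bar>c\<bar> > 1.67"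
  proof (rule ccontr)
    assume "\<not> ?thesis"
    hence "\<bar>c\<bar>\<^sup>2 \<le> 1.67\<^sup>2" by (intro power_mono) auto
    thus False using c'79 by (simp add: c'_def power2_eq_square)
  qed
  have cneg: "c < - 1.67"
  proof -
    have "c < - 1.67" if "p + c + x + z = 0" "0 \<le> p" "- 0.92953 \<le> x" "- z \<le> T" for p x z
      using that abs_c T by (cases "c \<ge> 0") simp_all
    moreover have "- Re R \<le> T" using R'(1) by (simp only: abs_le_iff)
    ultimately show ?thesis using Re' Ah(1) Vb(1) by blast
  qed
  define d where "d = - c"
  have d: "1.67 < d" "d \<le> 2" "c' = d\<^sup>2 - 2" using cneg c by (auto simp: d_def c'_def)
  have dle: "d \<le> 0.92389 * h + 0.17792 * c' + 0.1539"
    using Re' Ah(2) Vb(2) R'(1) T by (simp add: d_def)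
  \<comment> \<open>The chord of the square over the interval from \<open>a\<close> to
    \<open>b\<close>. It replaces \<open>d^2\<close> by a linear expression, so that the cases below
    end in linear arithmetic.\<close>
  have conv: "d\<^sup>2 \<le> (a + b) * d - a * b" if "a \<le> d" "d \<le> b" for a b
  proof -
    have "0 \<le> (d - a) * (b - d)" using that by simp
    thus ?thesis by (simp add: algebra_simps power2_eq_square)
  qed
  have hK: "h \<le> \<rho> ^ 3 * (2.41426 * c' + 0.8654)"
  proof -
    have "T = \<rho> ^ 3 * (\<rho> ^ 5 + 1.12 * \<rho> ^ 12)" by (simp add: T_def algebra_simps power_add[symmetric])
    also have "\<dots> \<le> \<rho> ^ 3 * 0.33112" using pw \<rho>3 by (intro mult_left_mono) auto
    finally have "T \<le> \<rho> ^ 3 * 0.33112" .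
    moreover have "2.61322 * T \<le> x * 0.8654" if "T \<le> x * 0.33112" "0 < x" for x using that by simp
    ultimately have "2.61322 * T \<le> \<rho> ^ 3 * 0.8654" using \<rho>3 by blast
    hence "h \<le> 2.41426 * (\<rho> ^ 3 * c') + \<rho> ^ 3 * 0.8654" using hle c'g Ts by linarith
    thus ?thesis by (simp only: distrib_left mult.left_commute[of "\<rho> ^ 3" "2.41426"])
  qed
  \<comment> \<open>On the first interval \<open>h\<close> is bounded by \<open>h2\<close>; on the
    other two by the fourth root of \<open>2.41426 * c' + 0.8654\<close> at the right
    endpoint.\<close>
  consider "d \<le> 1.7263" | "1.7263 \<le> d" "d \<le> 1.8709" | "1.8709 \<le> d" by linarith
  thus False
  proof cases
    case 1
    thus False using conv[of "1.67" "1.7263"] d dle h2 by (simp add: algebra_simps)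
  next
    case 2
    have "c' \<le> 1.5003" using power_mono[OF 2(2), of 2] d by (simp add: power2_eq_square)
    hence "h \<le> 1.4556"
      by (intro inverse_fourth_power_le[OF \<rho>(1) h hK]) (auto simp: power_divide)
    thus False using conv[OF 2] d dle by (simp add: algebra_simps)
  next
    case 3
    have "h \<le> 1.5449"
      by (rule inverse_fourth_power_le[OF \<rho>(1) h hK]) (use c' in \<open>auto simp: power_divide\<close>)
    thus False using conv[OF 3 d(2)] 3 d dle by (simp add: algebra_simps)
  qed
qed

text \<open>Both bounds come from the tangent inequality \<open>m^3 \<ge> 3 a^2 m - 2 a^3\<close>,
  taken close to the maximiser: \<open>a = 1 / sqrt 6\<close> for the first,
  \<open>a = 1 / sqrt 24.24\<close> for the second.\<close>

lemma chebyshev_cubic_bound: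
  fixes m :: real
  shows "0 \<le> m \<Longrightarrow> m * (1 - 2 * m\<^sup>2) \<le> 0.2722"
    and "0 \<le> m \<Longrightarrow> m * (1 - 8.08 * m\<^sup>2) \<le> 0.1355"
proof -
  assume m: "0 \<le> m"
  have c: "3 * a\<^sup>2 * m - 2 * a ^ 3 \<le> m ^ 3" if "0 \<le> a" for a
  proof -
    have "0 \<le> (m - a)\<^sup>2 * (m + 2 * a)" using m that by simp
    thus ?thesis by (simp add: power2_eq_square power3_eq_cube algebra_simps)
  qed
  show "m * (1 - 2 * m\<^sup>2) \<le> 0.2722"
    using c[of "0.40825"] m by (simp add: power2_eq_square power3_eq_cube algebra_simps)
  show "m * (1 - 8.08 * m\<^sup>2) \<le> 0.1355"
    using c[of "0.20312"] m by (simp add: power2_eq_square power3_eq_cube algebra_simps)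
qed

text \<open>Here \<open>m\<close> is \<open>cos (2\<phi>)\<close> and the expression is
  \<open>sin (8\<phi>) / sin \<phi>\<close>. The range \<open>m \<le> -0.5\<close> is where
  \<open>3 - 4 s^2 \<le> 0\<close>; there \<open>sector_core_3\<close> uses the sharper
  bound.\<close>

lemma octuple_angle_bounds:
  fixes A s :: real
  assumes A: "0 \<le> A" "A \<le> 0.92389" and s: "0.38267 \<le> s" and As: "A\<^sup>2 + s\<^sup>2 = 1"
  defines "m \<equiv> 1 - 2 * s\<^sup>2"
  shows "\<bar>8 * A * m * (2 * m\<^sup>2 - 1)\<bar> \<le> 2.02" "m \<le> - 0.5 \<Longrightarrow> \<bar>8 * A * m * (2 * m\<^sup>2 - 1)\<bar> \<le> 1.1"
proof -
  define y where "y = A\<^sup>2"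
  have y: "0 \<le> y" "m = 2 * y - 1" using As by (auto simp: y_def m_def)
  have s2: "s\<^sup>2 \<ge> 0.38267\<^sup>2" using s by (intro power_mono) auto
  have m: "- 1 \<le> m" "m \<le> 0.70713" using y s2 by (auto simp: m_def power2_eq_square)
  have abs_eq: "\<bar>8 * A * m * (2 * m\<^sup>2 - 1)\<bar> = 8 * (A * (\<bar>m\<bar> * \<bar>2 * m\<^sup>2 - 1\<bar>))"
    using A by (simp add: abs_mult)
  define n where "n = \<bar>m\<bar>"
  have n: "0 \<le> n" "m\<^sup>2 = n\<^sup>2" by (auto simp: n_def)
  \<comment> \<open>The angle is close to \<open>pi/2\<close>, so \<open>y = A^2\<close> is small.
    For \<open>y \<le> 0.08\<close> the quadratic in \<open>y\<close> reduces to the second cubic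
    bound; above that, \<open>A\<close> and the remaining factor are bounded separately.\<close>
  have neg: "A * (\<bar>m\<bar> * \<bar>2 * m\<^sup>2 - 1\<bar>) \<le> 0.1355" if "m < 0" "2 * m\<^sup>2 \<ge> 1"
  proof -
    have m7: "m \<le> - 0.7071"
    proof (rule ccontr)
      assume "\<not> ?thesis"
      hence "(- m)\<^sup>2 \<le> 0.7071\<^sup>2" using that by (intro power_mono) auto
      thus False using that by (simp add: power2_eq_square)
    qed
    hence y15: "y \<le> 0.14645" using y by simp
    have "\<bar>m\<bar> * \<bar>2 * m\<^sup>2 - 1\<bar> = (1 - 2 * y) * (2 * (1 - 2 * y)\<^sup>2 - 1)"
    proof -
      have "\<bar>m\<bar> = 1 - 2 * y" "m\<^sup>2 = (1 - 2 * y)\<^sup>2"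
        using that unfolding y(2) by (simp_all add: power2_eq_square algebra_simps)
      thus ?thesis using that(2) by simp
    qed
    also have "\<dots> = 1 - 10 * y + 24 * y\<^sup>2 - 16 * y ^ 3"
      by (simp add: power2_eq_square power3_eq_cube algebra_simps)
    also have "\<dots> \<le> 1 - 10 * y + 24 * y\<^sup>2" using y by simp
    finally have le: "\<bar>m\<bar> * \<bar>2 * m\<^sup>2 - 1\<bar> \<le> 1 - 10 * y + 24 * y\<^sup>2" .
    show ?thesis
    proof (cases "y \<le> 0.08")
      case True
      have "24 * y\<^sup>2 \<le> 1.92 * y" using True y mult_right_mono[of y "0.08" y] by (simp add: power2_eq_square)
      hence "A * (\<bar>m\<bar> * \<bar>2 * m\<^sup>2 - 1\<bar>) \<le> A * (1 - 8.08 * A\<^sup>2)"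
        using A le by (intro mult_left_mono) (auto simp: y_def)
      thus ?thesis using chebyshev_cubic_bound(2)[OF A(1)] by simp
    next
      case False
      have "0 \<le> (y - 0.08) * (0.14645 - y)" using False y15 by simp
      moreover have "(y - 0.08) * (0.14645 - y) = 0.22645 * y - 0.011716 - y\<^sup>2"
        by (simp add: power2_eq_square field_simps)
      ultimately have "y\<^sup>2 \<le> 0.22645 * y - 0.011716" by linarith
      hence "1 - 10 * y + 24 * y\<^sup>2 \<le> 0.3537" using False by simp
      with le have "\<bar>m\<bar> * \<bar>2 * m\<^sup>2 - 1\<bar> \<le> 0.3537" by (rule order_trans)
      moreover have "A \<le> 0.383"
      proof (rule ccontr)
        assume "\<not> ?thesis"
        hence "0.383\<^sup>2 \<le> A\<^sup>2" by (intro power_mono) auto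
        thus False using y15 by (simp add: y_def power2_eq_square)
      qed
      ultimately have "A * (\<bar>m\<bar> * \<bar>2 * m\<^sup>2 - 1\<bar>) \<le> 0.383 * 0.3537"
        using A by (intro mult_mono) auto
      thus ?thesis by simp
    qed
  qed
  have small: "\<bar>m\<bar> * \<bar>2 * m\<^sup>2 - 1\<bar> \<le> 0.2722" if "2 * m\<^sup>2 \<le> 1"
    using chebyshev_cubic_bound(1)[OF n(1)] that unfolding n_def[symmetric] n(2) by simp
  show "\<bar>8 * A * m * (2 * m\<^sup>2 - 1)\<bar> \<le> 2.02"
  proof (cases "2 * m\<^sup>2 \<le> 1")
    case True
    have "A * (\<bar>m\<bar> * \<bar>2 * m\<^sup>2 - 1\<bar>) \<le> 0.92389 * 0.2722"
      using A small[OF True] by (intro mult_mono) auto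
    thus ?thesis unfolding abs_eq by simp
  next
    case False
    show ?thesis
    proof (cases "m < 0")
      case True
      thus ?thesis using neg False unfolding abs_eq by simp
    next
      case m0: False
      have "m\<^sup>2 \<le> 0.70713\<^sup>2" using m m0 by (intro power_mono) auto
      hence "\<bar>m\<bar> * \<bar>2 * m\<^sup>2 - 1\<bar> \<le> 1 * 0.01" using m m0 False
        by (intro mult_mono) (auto simp: power2_eq_square)
      hence "A * (\<bar>m\<bar> * \<bar>2 * m\<^sup>2 - 1\<bar>) \<le> 0.92389 * 0.01"
        using A by (intro mult_mono) auto
      thus ?thesis unfolding abs_eq by simp
    qed
  qed
  assume m5: "m \<le> - 0.5"
  show "\<bar>8 * A * m * (2 * m\<^sup>2 - 1)\<bar> \<le> 1.1"
  proof (cases "2 * m\<^sup>2 \<le> 1")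
    case True
    have "y \<le> 0.5\<^sup>2" using m5 y by (simp add: power2_eq_square)
    hence A5: "A \<le> 0.5" unfolding y_def using power2_le_imp_le by fastforce
    have "A * (\<bar>m\<bar> * \<bar>2 * m\<^sup>2 - 1\<bar>) \<le> 0.5 * 0.2722"
      using A A5 small[OF True] by (intro mult_mono) auto
    thus ?thesis unfolding abs_eq by simp
  next
    case False
    thus ?thesis using neg m5 unfolding abs_eq by simp
  qed
qed

text \<open>In the three cores \<open>p = \<rho>(A + is)\<close> and \<open>h = 1/\<rho>\<close>; \<open>c = w + 1/w\<close>, and the two equations are the
  imaginary and the real part of the sum divided by \<open>p\<close>. The bounds on \<open>s\<close> and \<open>A\<close> are
  \<open>sin(\<pi>/8)\<close> and \<open>cos(\<pi>/8)\<close>, rounded outwards, and \<open>0.7746\<close> exceeds the square root of \<open>0.6\<close>.\<close>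

lemma sector_core_1:
  fixes h \<rho> A s c C1 S1 :: real and R :: complex
  assumes \<rho>: "0 < \<rho>" "\<rho> \<le> 0.7746" and h: "h * \<rho> = 1"
    and s: "0.38267 \<le> s" and A: "0 \<le> A" "A \<le> 0.92389" and As: "A\<^sup>2 + s\<^sup>2 = 1"
    and R: "norm R \<le> \<rho> ^ 8 + 1.12 * \<rho> ^ 15" and CS: "C1\<^sup>2 + S1\<^sup>2 = 1"
    and w2: "c\<^sup>2 / 2 - 1 = C1 * (A * (4 * A\<^sup>2 - 3)) + S1 * (s * (3 - 4 * s\<^sup>2))"
    and Im: "s * h = \<rho> ^ 3 * S1 + Im R"
    and Re: "A * h + c + \<rho> ^ 3 * C1 + Re R = 0"
  shows False
proof -
  note pw = power_le_numeral_bound[OF \<rho>]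
  note tr = triple_angle_bounds[OF A s As]
  define T where "T = \<rho> ^ 8 + 1.12 * \<rho> ^ 15"
  have T: "T \<le> 0.1539" "0 \<le> T" using pw(4,6) \<rho> by (auto simp: T_def)
  have R': "\<bar>Re R\<bar> \<le> T" "\<bar>Im R\<bar> \<le> T"
    using R abs_Re_le_cmod[of R] abs_Im_le_cmod[of R] by (auto simp: T_def)
  have h1: "h \<ge> 1.29098" by (rule inverse_le_numeral_bound[OF \<rho> h])
  have \<rho>3: "0 < \<rho> ^ 3" using \<rho> by simp
  have C1: "\<bar>C1\<bar> \<le> 1" "\<bar>S1\<bar> \<le> 1"
    using CS by (metis abs_square_le_1 le_add_same_cancel1 zero_le_power2, metis abs_square_le_1 le_add_same_cancel2 zero_le_power2)
  \<comment> \<open>The imaginary part times \<open>\<rho>\<close> bounds \<open>s\<close> by powers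
    of \<open>\<rho>\<close>. As \<open>s\<close> is at least 0.38267, this confines
    \<open>\<rho>\<close> to the range from 0.74 to 0.7746 and \<open>s\<close> to values below
    0.4793, so all further quantities are nearly determined.\<close>
  have s_le_pow: "s \<le> \<rho> ^ 4 + \<rho> ^ 9 + 1.12 * \<rho> ^ 16"
  proof -
    have "\<rho> ^ 3 * S1 \<le> \<rho> ^ 3 * 1" using C1 \<rho>3 by (intro mult_left_mono) auto
    hence "s * h \<le> \<rho> ^ 3 + T" using Im R' by simp
    hence "s * h * \<rho> \<le> (\<rho> ^ 3 + T) * \<rho>" using \<rho> by (intro mult_right_mono) auto
    moreover have "s * h * \<rho> = s" using h by (simp add: mult.assoc)
    moreover have p: "\<rho> ^ 3 * \<rho> = \<rho> ^ 4" "\<rho> ^ 8 * \<rho> = \<rho> ^ 9" "\<rho> ^ 15 * \<rho> = \<rho> ^ 16"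
      by (simp_all add: power_numeral_reduce)
    ultimately have "s \<le> \<rho> ^ 3 * \<rho> + T * \<rho>" by (metis distrib_right)
    moreover have "T * \<rho> = \<rho> ^ 8 * \<rho> + 1.12 * (\<rho> ^ 15 * \<rho>)" by (simp add: T_def distrib_right)
    ultimately show ?thesis unfolding p by simp
  qed
  have pmono: "\<rho> ^ n \<le> b ^ n" if "\<rho> \<le> b" for n b using \<rho> that by (intro power_mono) auto
  have s1: "s \<le> 0.4793"
    using s_le_pow pmono[of "0.7746" 4] pmono[of "0.7746" 9] pmono[of "0.7746" 16] \<rho> by (simp add: power_divide)
  have \<rho>74: "\<rho> \<ge> 0.74"
  proof (rule ccontr)
    assume "\<not> ?thesis"
    thus False
      using s_le_pow pmono[of "0.74" 4] pmono[of "0.74" 9] pmono[of "0.74" 16] s by (simp add: power_divide)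
  qed
  have h2: "h \<le> 1.35136"
  proof -
    have "h = 1 / \<rho>" using h \<rho> by (simp add: field_simps)
    also have "\<dots> \<le> 1 / 0.74" using \<rho>74 by (intro divide_left_mono) auto
    finally show ?thesis by simp
  qed
  have S1: "S1 \<ge> 0.7317"
  proof -
    have "h ^ 3 * (s * h) = h ^ 3 * (\<rho> ^ 3 * S1) + h ^ 3 * Im R" unfolding Im by (simp add: distrib_left)
    moreover have "h ^ 3 * (\<rho> ^ 3 * S1) = (h * \<rho>) ^ 3 * S1" by (simp only: power_mult_distrib mult.assoc)
    ultimately have e: "h ^ 3 * (s * h) = S1 + h ^ 3 * Im R" by (simp add: h)
    have "1.29098 ^ 4 \<le> h ^ 4" using h1 by (intro power_mono) auto
    hence "0.38267 * 2.77765 \<le> s * h ^ 4" using s by (intro mult_mono) (auto simp: power_divide)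
    hence l: "1.0629 \<le> h ^ 3 * (s * h)" by (simp add: power_numeral_reduce algebra_simps)
    have "h ^ 3 * Im R \<le> h ^ 3 * T" using R' h1 by (intro mult_left_mono) auto
    also have "T = \<rho> ^ 3 * (\<rho> ^ 5 + 1.12 * \<rho> ^ 12)" by (simp add: T_def algebra_simps power_add[symmetric])
    also have "h ^ 3 * (\<rho> ^ 3 * (\<rho> ^ 5 + 1.12 * \<rho> ^ 12)) = (h * \<rho>) ^ 3 * (\<rho> ^ 5 + 1.12 * \<rho> ^ 12)"
      by (simp only: power_mult_distrib mult.assoc)
    also have "\<dots> \<le> 0.33112" using pw by (simp add: h)
    finally show ?thesis using e l by simp
  qed
  have C1b: "\<bar>C1\<bar> \<le> 0.6817"
  proof (rule power2_le_imp_le)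
    have "0.7317\<^sup>2 \<le> S1\<^sup>2" using S1 by (intro power_mono) auto
    thus "\<bar>C1\<bar>\<^sup>2 \<le> 0.6817\<^sup>2" using CS by (simp add: power2_eq_square)
  qed simp
  define V where "V = A * (4 * A\<^sup>2 - 3)"
  define W where "W = s * (3 - 4 * s\<^sup>2)"
  have s2: "s\<^sup>2 \<le> 0.4793\<^sup>2" using s s1 by (intro power_mono) auto
  hence A2: "0.7702 \<le> A\<^sup>2" using As by (simp add: power2_eq_square)
  have A1: "0.8776 \<le> A"
  proof (rule ccontr)
    assume "\<not> ?thesis"
    hence "A\<^sup>2 \<le> 0.8776\<^sup>2" using A by (intro power_mono) auto
    thus False using A2 by (simp add: power2_eq_square)
  qed
  have V: "0 \<le> V" "V \<le> 0.3828" using tr(1) A A2 by (auto simp: V_def)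
  have W: "0.9238 \<le> W"
  proof -
    have id: "(s - a) * (3 - 4 * (s\<^sup>2 + a * s + a\<^sup>2)) = s * (3 - 4 * s\<^sup>2) - a * (3 - 4 * a\<^sup>2)" for a
      by (simp add: power2_eq_square algebra_simps)
    have "0 \<le> (s - 0.38267) * (3 - 4 * (s\<^sup>2 + 0.38267 * s + 0.38267\<^sup>2))"
      using s s1 s2 by (intro mult_nonneg_nonneg) (auto simp: power2_eq_square)
    thus ?thesis unfolding id by (simp add: W_def power2_eq_square)
  qed
  have SW: "0.6759 \<le> S1 * W" using mult_mono[OF S1 W] S1 by simp
  have w2': "c\<^sup>2 / 2 - 1 = C1 * V + S1 * W" using w2 by (simp add: V_def W_def)
  have Ah: "1.1329 \<le> A * h" "A * h \<le> 1.2486"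
    using mult_mono[OF A1 h1] mult_mono[OF A(2) h2] A h1 by auto
  have rC: "\<bar>\<rho> ^ 3 * C1\<bar> \<le> 0.31684"
    using mult_mono[OF pw(1) C1b] \<rho>3 by (simp add: abs_mult)
  define P where "P = A * h"
  have "\<rho> ^ 3 * C1 \<le> 0.31684" "- (\<rho> ^ 3 * C1) \<le> 0.31684"
    using rC by (simp_all only: abs_le_iff)
  note rC = this
  define N where "N = \<rho> ^ 3 * C1"
  have cneg: "c \<le> 0" and c_lo: "- c \<le> 1.7194" and c_lo': "N \<le> 0 \<Longrightarrow> - c \<le> 1.4026"
    using Re Ah rC R'(1) T unfolding P_def[symmetric] N_def[symmetric] by (simp_all add: abs_le_iff)
  \<comment> \<open>The relation \<open>w2\<close> bounds \<open>c^2\<close> from below, the real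
    part bounds \<open>-c\<close> from above. A negative \<open>C1\<close> lowers both bounds, so
    the two signs need separate numbers.\<close>
  show False
  proof (cases "C1 \<ge> 0")
    case True
    have "0 \<le> C1 * V" using True V by simp
    hence "c\<^sup>2 \<ge> 3.3518" using w2' SW by simp
    moreover have "(- c)\<^sup>2 \<le> 1.7194\<^sup>2" using cneg c_lo by (intro power_mono) auto
    ultimately show False by (simp add: power2_eq_square)
  next
    case False
    have "(- C1) * V \<le> 0.6817 * 0.3828" using C1b False V by (intro mult_mono) auto
    hence "c\<^sup>2 \<ge> 2.82" using w2' SW by simp
    moreover have "N \<le> 0" using False \<rho>3 by (simp add: N_def mult_nonneg_nonpos)
    hence "- c \<le> 1.4026" by (rule c_lo')
    hence "(- c)\<^sup>2 \<le> 1.4026\<^sup>2" using cneg by (intro power_mono) auto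
    ultimately show False by (simp add: power2_eq_square)
  qed
qed

text \<open>The plan of \<open>sector_core_2\<close>, but the pair \<open>n = 3\<close>,
  \<open>n = -3\<close> is now explicit instead of being part of the remainder. In the imaginary
  part it is controlled by \<open>octuple_angle_bounds\<close>; in the real part \<open>E\<close>
  stands for \<open>cos (8\<phi>)\<close>, and the trivial bound suffices.\<close>

lemma sector_core_3:
  fixes h \<rho> A s c :: real and R :: complex
  assumes \<rho>: "0 < \<rho>" "\<rho> \<le> 0.7746" and h: "h * \<rho> = 1"
    and s: "0.38267 \<le> s" and A: "0 \<le> A" "A \<le> 0.92389" and As: "A\<^sup>2 + s\<^sup>2 = 1"
    and c: "\<bar>c\<bar> \<le> 2" and R: "norm R \<le> 2.24 * \<rho> ^ 15"
    and Im: "s * h = \<rho> ^ 3 * (c\<^sup>2 - 2) * (s * (3 - 4 * s\<^sup>2))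
        + \<rho> ^ 8 * (c ^ 3 - 3 * c) * (s * (8 * A * (1 - 2 * s\<^sup>2) * (2 * (1 - 2 * s\<^sup>2)\<^sup>2 - 1))) + Im R"
    and Re: "A * h + c + \<rho> ^ 3 * (c\<^sup>2 - 2) * (A * (4 * A\<^sup>2 - 3)) + \<rho> ^ 8 * (c ^ 3 - 3 * c) * E + Re R = 0"
    and E: "\<bar>E\<bar> \<le> 1"
  shows False
proof -
  note pw = power_le_numeral_bound[OF \<rho>]
  note tr = triple_angle_bounds[OF A s As]
  define T where "T = 2.24 * \<rho> ^ 15"
  define c' where "c' = c\<^sup>2 - 2"
  define c'' where "c'' = c ^ 3 - 3 * c"
  define g where "g = 3 - 4 * s\<^sup>2"
  define V where "V = A * (4 * A\<^sup>2 - 3)"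
  define m where "m = 1 - 2 * s\<^sup>2"
  define \<kappa> where "\<kappa> = 8 * A * m * (2 * m\<^sup>2 - 1)"
  have \<kappa>: "\<bar>\<kappa>\<bar> \<le> 2.02" "m \<le> - 0.5 \<Longrightarrow> \<bar>\<kappa>\<bar> \<le> 1.1"
    using octuple_angle_bounds[OF A s As] by (auto simp: \<kappa>_def m_def)
  have V: "- 1 \<le> V" "V \<le> 0.3828" using tr by (auto simp: V_def)
  have g: "g \<le> 2.41426" using tr by (simp add: g_def)
  have \<rho>3: "0 < \<rho> ^ 3" using \<rho> by simp
  have \<rho>8: "0 < \<rho> ^ 8" using \<rho> by simp
  have h1: "h \<ge> 1.29098" by (rule inverse_le_numeral_bound[OF \<rho> h])
  have c2: "c\<^sup>2 \<le> 4" using c power_mono[of "\<bar>c\<bar>" 2 2] by simp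
  hence c': "- 2 \<le> c'" "c' \<le> 2" by (auto simp: c'_def)
  have c''2: "\<bar>c''\<bar> \<le> 2"
  proof -
    have "0 \<le> (2 - c) * (c + 1)\<^sup>2" "0 \<le> (c + 2) * (c - 1)\<^sup>2" using c by auto
    thus ?thesis by (simp add: c''_def abs_le_iff power2_eq_square power3_eq_cube algebra_simps)
  qed
  have T: "T \<le> 0.04858" "0 \<le> T" using pw(6) \<rho> by (auto simp: T_def)
  have R': "\<bar>Re R\<bar> \<le> T" "\<bar>Im R\<bar> \<le> T"
    using R abs_Re_le_cmod[of R] abs_Im_le_cmod[of R] by (auto simp: T_def)
  have "s * h \<le> s * (\<rho> ^ 3 * c' * g + \<rho> ^ 8 * (\<bar>c''\<bar> * \<bar>\<kappa>\<bar>) + T / s)"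
  proof -
    have "s * h = s * (\<rho> ^ 3 * c' * g) + s * (\<rho> ^ 8 * (c'' * \<kappa>)) + Im R"
      using Im by (simp add: c'_def c''_def g_def \<kappa>_def m_def mult.left_commute mult.assoc)
    moreover have "c'' * \<kappa> \<le> \<bar>c''\<bar> * \<bar>\<kappa>\<bar>" by (metis abs_ge_self abs_mult)
    hence "s * (\<rho> ^ 8 * (c'' * \<kappa>)) \<le> s * (\<rho> ^ 8 * (\<bar>c''\<bar> * \<bar>\<kappa>\<bar>))" using s \<rho>8 by simp
    moreover have "s * (T / s) = T" using s by simp
    ultimately show ?thesis using R'(2) unfolding distrib_left by linarith
  qed
  hence hle: "h \<le> \<rho> ^ 3 * c' * g + \<rho> ^ 8 * (\<bar>c''\<bar> * \<bar>\<kappa>\<bar>) + T / s"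
    by (rule mult_left_le_imp_le) (use s in simp)
  have Ts: "T / s \<le> 2.61322 * T"
  proof -
    have "T / s \<le> T / 0.38267" using T s by (intro divide_left_mono) auto
    thus ?thesis using T by simp
  qed
  have c\<kappa>: "\<rho> ^ 8 * (\<bar>c''\<bar> * \<bar>\<kappa>\<bar>) \<le> 0.129605 * (b * k)" if "\<bar>c''\<bar> \<le> b" "\<bar>\<kappa>\<bar> \<le> k" for b k
    using that pw(4) \<rho>8 by (intro mult_mono) auto
  have c'pos: "c' > 0"
  proof (rule ccontr)
    assume "\<not> ?thesis"
    hence neg: "c' \<le> 0" by simp
    show False
    proof (cases "g \<ge> 0")
      case True
      have "\<rho> ^ 3 * c' * g \<le> 0" using neg True \<rho>3 by (simp add: mult_nonneg_nonpos mult_nonneg_nonpos2)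
      thus False using hle h1 Ts T c\<kappa>[OF c''2 \<kappa>(1)] by simp
    next
      case False
      have "s > 0.866"
      proof (rule ccontr)
        assume "\<not> ?thesis"
        hence "s\<^sup>2 \<le> 0.866\<^sup>2" using s by (intro power_mono) auto
        thus False using False by (simp add: g_def power2_eq_square)
      qed
      hence "T / s \<le> T / 0.866" using T by (intro divide_left_mono) auto
      moreover have "- g \<le> 1" using tr(4) s power_mono[of s 1 2] by (simp add: g_def)
      hence "(- c') * (- g) \<le> 2 * 1" using neg False c' by (intro mult_mono) auto
      hence "\<rho> ^ 3 * (c' * g) \<le> 0.464765 * 2" using pw(1) \<rho>3 neg False
        by (intro mult_mono) (auto simp: mult_nonpos_nonpos)
      moreover have "m \<le> - 0.5" using False by (simp add: g_def m_def)
      ultimately show False using hle h1 T c\<kappa>[OF c''2 \<kappa>(2)] by (simp add: mult.assoc)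
    qed
  qed
  have c'g: "\<rho> ^ 3 * c' * g \<le> 2.41426 * (\<rho> ^ 3 * c')"
  proof -
    have "c' * g \<le> 2.41426 * c'" using g c'pos mult_left_mono[of g "2.41426" c'] by simp
    hence "\<rho> ^ 3 * (c' * g) \<le> \<rho> ^ 3 * (2.41426 * c')" using \<rho>3 by (intro mult_left_mono) auto
    thus ?thesis by (simp only: mult.assoc mult.left_commute[of "2.41426"])
  qed
  have r3c: "\<rho> ^ 3 * c' \<le> 0.464765 * c'" using pw(1) c'pos by (intro mult_right_mono) auto
  have h2: "h \<le> 1.12207 * c' + 0.129605 * (b * 2.02) + 0.12696" if "\<bar>c''\<bar> \<le> b" for b
  proof -
    have "h \<le> 1.12207 * c' + 0.129605 * (b * 2.02) + 0.12696"
      if "h \<le> a + y + t" "a \<le> 2.41426 * x" "x \<le> 0.464765 * c'" "t \<le> 2.61322 * T"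
        "y \<le> 0.129605 * (b * 2.02)" for a t x y
      using that T c'pos by simp
    from this[OF hle c'g r3c Ts c\<kappa>[OF that \<kappa>(1)]] show ?thesis .
  qed
  have c'57: "c' \<ge> 0.5706" using h2[OF c''2] h1 by simp
  have Vb: "- 0.92953 \<le> \<rho> ^ 3 * c' * V" "\<rho> ^ 3 * c' * V \<le> 0.3828 * (\<rho> ^ 3 * c')"
  proof -
    have p: "0 \<le> \<rho> ^ 3 * c'" "\<rho> ^ 3 * c' \<le> 0.92953"
      using \<rho>3 c'pos mult_mono[OF pw(1) c'(2)] by auto
    have "\<rho> ^ 3 * c' * (- 1) \<le> \<rho> ^ 3 * c' * V" using p V by (intro mult_left_mono) auto
    thus "- 0.92953 \<le> \<rho> ^ 3 * c' * V" using p by simp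
    have "\<rho> ^ 3 * c' * V \<le> \<rho> ^ 3 * c' * 0.3828" using p V by (intro mult_left_mono) auto
    thus "\<rho> ^ 3 * c' * V \<le> 0.3828 * (\<rho> ^ 3 * c')" by simp
  qed
  have Eb: "\<bar>\<rho> ^ 8 * c'' * E\<bar> \<le> \<rho> ^ 8 * \<bar>c''\<bar>"
  proof -
    have "\<rho> ^ 8 * \<bar>c''\<bar> * \<bar>E\<bar> \<le> \<rho> ^ 8 * \<bar>c''\<bar> * 1" using E \<rho>8 by (intro mult_left_mono) auto
    thus ?thesis using \<rho>8 by (simp add: abs_mult)
  qed
  have Re': "A * h + c + \<rho> ^ 3 * c' * V + \<rho> ^ 8 * c'' * E + Re R = 0"
    using Re by (simp add: c'_def c''_def V_def)
  have Ah: "0 \<le> A * h" "A * h \<le> 0.92389 * h" using A h1 by (auto intro: mult_right_mono)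
  have abs_c: "\<bar>c\<bar> > 1.603"
  proof (rule ccontr)
    assume "\<not> ?thesis"
    hence "\<bar>c\<bar>\<^sup>2 \<le> 1.603\<^sup>2" by (intro power_mono) auto
    thus False using c'57 by (simp add: c'_def power2_eq_square)
  qed
  have r8: "\<rho> ^ 8 * \<bar>c''\<bar> \<le> 0.129605 * b" if "\<bar>c''\<bar> \<le> b" for b
    using that pw(4) \<rho>8 by (intro mult_mono) auto
  have cneg: "c < - 1.603"
  proof -
    have "c < - 1.603" if "p + c + x + y + z = 0" "0 \<le> p" "- 0.92953 \<le> x" "- y \<le> e" "e \<le> 0.129605 * 2" "- z \<le> T"
      for p x y z e
      using that abs_c T by (cases "c \<ge> 0") simp_all
    moreover have "- (\<rho> ^ 8 * c'' * E) \<le> \<rho> ^ 8 * \<bar>c''\<bar>" "- Re R \<le> T"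
      using Eb R'(1) by (simp_all only: abs_le_iff)
    ultimately show ?thesis using Re' Ah(1) Vb(1) r8[OF c''2] by blast
  qed
  define d where "d = - c"
  have d: "1.603 < d" "d \<le> 2" "c' = d\<^sup>2 - 2" "\<bar>c''\<bar> = \<bar>d ^ 3 - 3 * d\<bar>"
    using cneg c by (auto simp: d_def c'_def c''_def)
  have dle: "d \<le> 0.92389 * h + 0.3828 * (\<rho> ^ 3 * c') + \<rho> ^ 8 * \<bar>c''\<bar> + T"
    using Re' Ah(2) Vb(2) Eb R'(1) by (simp add: d_def abs_le_iff)
  have conv: "d\<^sup>2 \<le> (a + b) * d - a * b" if "a \<le> d" "d \<le> b" for a b
  proof -
    have "0 \<le> (d - a) * (b - d)" using that by simp
    thus ?thesis by (simp add: algebra_simps power2_eq_square)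
  qed
  \<comment> \<open>With \<open>c = 2 cos \<psi>\<close> the quantity \<open>c''\<close> is
    \<open>2 cos (3\<psi>)\<close> and vanishes at \<open>d = sqrt 3\<close>. Up to 1.74 it is at
    most 0.75 in modulus; beyond, it lies below the chord from 1.74 to 2, which rounds to
    \<open>7.51 * d - 13\<close>.\<close>
  show False
  proof (cases "d \<le> 1.74")
    case True
    have "\<bar>c''\<bar> \<le> 0.75"
    proof -
      have 1: "1.603\<^sup>2 \<le> d\<^sup>2" "d\<^sup>2 \<le> 1.74\<^sup>2" using d True by (intro power_mono; simp)+
      have "d * (3 - d\<^sup>2) \<le> 1.74 * (3 - 1.603\<^sup>2)" if "3 - d\<^sup>2 \<ge> 0"
        using 1 d True that by (intro mult_mono) auto
      moreover have "d * (d\<^sup>2 - 3) \<le> 1.74 * (1.74\<^sup>2 - 3)" if "3 - d\<^sup>2 \<le> 0"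
        using 1 d True that by (intro mult_mono) auto
      moreover have "c'' = d * (3 - d\<^sup>2)" by (simp add: c''_def d_def power3_eq_cube power2_eq_square algebra_simps)
      ultimately show ?thesis
        using d by (cases "3 - d\<^sup>2 \<ge> 0") (auto simp: abs_mult power2_eq_square)
    qed
    thus False
      using conv[of "1.603" "1.74"] d(1,3) True dle h2[of "0.75"] r8[of "0.75"] r3c T by (simp add: algebra_simps)
  next
    case False
    hence d174: "1.74 \<le> d" by simp
    have ab: "\<bar>c''\<bar> \<le> 7.51 * d - 13"
    proof -
      have id: "(d - a) * ((b - d) * (d + (a + b))) = (a\<^sup>2 + a * b + b\<^sup>2) * d - d ^ 3 - a * b * (a + b)" for a b
        by (simp add: power2_eq_square power3_eq_cube algebra_simps)
      have "0 \<le> (d - 1.74) * ((2 - d) * (d + (1.74 + 2)))" using d174 d by simp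
      hence "d ^ 3 - 3 * d \<le> 7.51 * d - 13" unfolding id using d174
        by (simp add: power2_eq_square)
      moreover have "0 \<le> d * (d\<^sup>2 - 3)"
        using d174 power_mono[OF d174, of 2] by (intro mult_nonneg_nonneg) (auto simp: power2_eq_square)
      hence "0 \<le> d ^ 3 - 3 * d" by (simp add: power2_eq_square power3_eq_cube algebra_simps)
      ultimately show ?thesis using d(4) by simp
    qed
    have hK: "h \<le> \<rho> ^ 3 * 6.2283"
    proof -
      have "T = \<rho> ^ 3 * (2.24 * \<rho> ^ 12)" by (simp add: T_def power_add[symmetric])
      also have "\<dots> \<le> \<rho> ^ 3 * 0.104517" using pw \<rho>3 by (intro mult_left_mono) auto
      finally have "T \<le> \<rho> ^ 3 * 0.104517" .
      moreover have "2.61322 * T \<le> x * 0.27313" if "T \<le> x * 0.104517" "0 < x" for x using that by simp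
      ultimately have 1: "2.61322 * T \<le> \<rho> ^ 3 * 0.27313" using \<rho>3 by blast
      have "\<bar>c''\<bar> * \<bar>\<kappa>\<bar> \<le> 2 * 2.02" using c''2 \<kappa>(1) by (intro mult_mono) auto
      hence "\<rho> ^ 5 * (\<bar>c''\<bar> * \<bar>\<kappa>\<bar>) \<le> 0.278861 * (2 * 2.02)" using pw(3)
        by (intro mult_mono[of "\<rho> ^ 5"]) (simp_all del: mult_le_cancel_left)
      hence "\<rho> ^ 3 * (\<rho> ^ 5 * (\<bar>c''\<bar> * \<bar>\<kappa>\<bar>)) \<le> \<rho> ^ 3 * 1.1266" using \<rho>3 by (intro mult_left_mono) auto
      hence 2: "\<rho> ^ 8 * (\<bar>c''\<bar> * \<bar>\<kappa>\<bar>) \<le> \<rho> ^ 3 * 1.1266"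
        by (simp add: mult.assoc[symmetric] power_add[symmetric])
      have "\<rho> ^ 3 * c' \<le> \<rho> ^ 3 * 2" using c' \<rho>3 by (intro mult_left_mono) auto
      moreover have "h \<le> r * 6.2283"
        if "h \<le> a + b + t" "a \<le> 2.41426 * x" "x \<le> r * 2" "b \<le> r * 1.1266"
          "t \<le> 2.61322 * T" "2.61322 * T \<le> r * 0.27313" "0 < r" for a b t x r
        using that by simp
      ultimately show ?thesis using hle c'g Ts 1 2 \<rho>3 by blast
    qed
    \<comment> \<open>For small \<open>\<rho>\<close> the terms with high powers of
      \<open>\<rho>\<close> are small; for large \<open>\<rho>\<close> it is
      \<open>h = 1 / \<rho>\<close> that is small.\<close>
    show False
    proof (cases "\<rho> \<le> 0.7")
      case True
      have p: "\<rho> ^ n \<le> 0.7 ^ n" for n using \<rho> True by (intro power_mono) auto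
      have "h \<le> 1.58"
        by (rule inverse_fourth_power_le[OF \<rho>(1) h hK]) (auto simp: power_divide)
      moreover have "\<rho> ^ 3 * c' \<le> 0.343 * c'" using p[of 3] c'pos by (intro mult_right_mono) (auto simp: power_divide)
      moreover have "\<rho> ^ 8 * \<bar>c''\<bar> \<le> 0.05765 * (7.51 * d - 13)"
        using p[of 8] ab by (intro mult_mono) (auto simp: power_divide)
      moreover have "T \<le> 0.0107" using p[of 15] by (simp add: T_def power_divide)
      moreover have False
        if "d \<le> 0.92389 * h + 0.3828 * x + y + T" "h \<le> 1.58" "x \<le> 0.343 * c'"
          "y \<le> 0.05765 * (7.51 * d - 13)" "T \<le> 0.0107" for x y
        using conv[OF d174 d(2)] d(1-3) d174 that by (simp add: algebra_simps)
      ultimately show False using dle by blast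
    next
      case False
      have "h \<le> 1.42858"
      proof -
        have "h = 1 / \<rho>" using h \<rho> by (simp add: field_simps)
        also have "\<dots> \<le> 1 / 0.7" using False by (intro divide_left_mono) auto
        finally show ?thesis by simp
      qed
      moreover have "\<rho> ^ 8 * \<bar>c''\<bar> \<le> 0.129605 * (7.51 * d - 13)" by (rule r8[OF ab])
      moreover have False
        if "d \<le> 0.92389 * h + 0.3828 * x + y + T" "h \<le> 1.42858" "x \<le> 0.464765 * c'"
          "y \<le> 0.129605 * (7.51 * d - 13)" for x y
        using conv[OF d174 d(2)] d(1-3) d174 that T by (simp add: algebra_simps)
      ultimately show False using dle r3c by blast
    qed
  qed
qed

text \<open>From index \<open>m\<close> on, consecutive squares differ by at least
  \<open>2m + 1\<close>, so a geometric series with ratio \<open>\<rho>^(2m+1)\<close>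
  dominates.\<close>

lemma square_power_tail_le:
  fixes \<rho> :: real
  assumes "0 \<le> \<rho>" "\<rho> < 1"
  shows "(\<Sum>n=m..k. \<rho> ^ n\<^sup>2) \<le> \<rho> ^ m\<^sup>2 / (1 - \<rho> ^ (2 * m + 1))"
proof -
  let ?b = "\<rho> ^ (2 * m + 1)"
  have b: "0 \<le> ?b" "?b < 1"
    using assms power_less_one_iff[of \<rho> "2 * m + 1"] by (auto simp del: power_Suc)
  have "(\<Sum>n=m..k. \<rho> ^ n\<^sup>2) \<le> (\<Sum>n=m..k. \<rho> ^ m\<^sup>2 * ?b ^ (n - m))"
  proof (rule sum_mono)
    fix n assume "n \<in> {m..k}"
    then obtain i where n: "n = m + i" using le_Suc_ex by auto
    have "m\<^sup>2 + (2 * m + 1) * i \<le> n\<^sup>2"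
      by (cases i) (auto simp: n power2_eq_square algebra_simps)
    hence "\<rho> ^ n\<^sup>2 \<le> \<rho> ^ (m\<^sup>2 + (2 * m + 1) * i)" using assms by (intro power_decreasing) auto
    thus "\<rho> ^ n\<^sup>2 \<le> \<rho> ^ m\<^sup>2 * ?b ^ (n - m)" unfolding n power_add power_mult by simp
  qed
  also have "\<dots> = \<rho> ^ m\<^sup>2 * (\<Sum>n=m..k. ?b ^ (n - m))" by (simp add: sum_distrib_left)
  also have "(\<Sum>n=m..k. ?b ^ (n - m)) = (\<Sum>i<Suc k - m. ?b ^ i)"
    by (rule sum.reindex_bij_witness[of _ "\<lambda>i. i + m" "\<lambda>n. n - m"]) auto
  also have "\<dots> \<le> (\<Sum>i. ?b ^ i)"
    using b by (intro sum_le_suminf summable_geometric) auto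
  also have "\<dots> = 1 / (1 - ?b)" using b by (simp add: suminf_geometric)
  finally show ?thesis using assms by (simp add: mult_left_mono)
qed

lemma unit_powers:
  fixes e :: complex
  assumes "norm e = 1"
  defines "A \<equiv> Re e" and "s \<equiv> Im e"
  shows "A\<^sup>2 + s\<^sup>2 = 1" "Re (e ^ 3) = A * (4 * A\<^sup>2 - 3)" "Im (e ^ 3) = s * (3 - 4 * s\<^sup>2)"
    "Im (e ^ 8) = s * (8 * A * (1 - 2 * s\<^sup>2) * (2 * (1 - 2 * s\<^sup>2)\<^sup>2 - 1))"
proof -
  have As: "A\<^sup>2 + s\<^sup>2 = 1" using assms(1) by (simp add: A_def s_def cmod_def)
  show "A\<^sup>2 + s\<^sup>2 = 1" by (rule As)
  have e: "e = Complex A s" by (simp add: A_def s_def)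
  have A2: "A\<^sup>2 = 1 - s\<^sup>2" and s2: "s\<^sup>2 = 1 - A\<^sup>2" using As by auto
  have "Re (e ^ 3) = A * (A\<^sup>2 - 3 * s\<^sup>2)" "Im (e ^ 3) = s * (3 * A\<^sup>2 - s\<^sup>2)"
    by (simp_all add: e power3_eq_cube power2_eq_square algebra_simps)
  note e3 = this
  show "Re (e ^ 3) = A * (4 * A\<^sup>2 - 3)" unfolding e3(1) s2 by simp
  show "Im (e ^ 3) = s * (3 - 4 * s\<^sup>2)" unfolding e3(2) A2 by simp
  define m where "m = 1 - 2 * s\<^sup>2"
  have e2: "e\<^sup>2 = Complex m (2 * A * s)"
    using A2 by (simp add: e power2_eq_square complex_eq_iff m_def)
  have "m\<^sup>2 - (2 * A * s)\<^sup>2 = 2 * m\<^sup>2 - 1"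
    by (simp add: m_def power_mult_distrib A2) (simp add: power2_eq_square algebra_simps)
  hence e4: "(e\<^sup>2)\<^sup>2 = Complex (2 * m\<^sup>2 - 1) (4 * A * s * m)"
    unfolding e2 by (simp add: power2_eq_square complex_eq_iff)
  have "e ^ 8 = ((e\<^sup>2)\<^sup>2)\<^sup>2" by (simp add: power_mult[symmetric])
  also have "Im \<dots> = s * (8 * A * m * (2 * m\<^sup>2 - 1))"
    unfolding e4 by (simp add: power2_eq_square)
  finally show "Im (e ^ 8) = s * (8 * A * (1 - 2 * s\<^sup>2) * (2 * (1 - 2 * s\<^sup>2)\<^sup>2 - 1))"
    by (simp only: m_def)
qed

lemma unit_circle_sums:
  assumes "norm w = 1"
  defines "c \<equiv> 2 * Re w"
  shows "w + cnj w = of_real c" "w\<^sup>2 + (cnj w)\<^sup>2 = of_real (c\<^sup>2 - 2)"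
    "w ^ 3 + cnj w ^ 3 = of_real (c ^ 3 - 3 * c)" "Re (w\<^sup>2) = c\<^sup>2 / 2 - 1" "\<bar>c\<bar> \<le> 2"
proof -
  have ww: "w * cnj w = 1" using assms(1) by (simp add: complex_norm_square[symmetric])
  show 1: "w + cnj w = of_real c" by (simp add: c_def complex_eq_iff)
  have "w\<^sup>2 + (cnj w)\<^sup>2 = (w + cnj w)\<^sup>2 - 2 * (w * cnj w)" by (simp add: power2_eq_square algebra_simps)
  thus 2: "w\<^sup>2 + (cnj w)\<^sup>2 = of_real (c\<^sup>2 - 2)" unfolding 1 ww by simp
  have "w ^ 3 + cnj w ^ 3 = (w + cnj w) ^ 3 - 3 * (w * cnj w) * (w + cnj w)"
    by (simp add: power3_eq_cube algebra_simps)
  thus "w ^ 3 + cnj w ^ 3 = of_real (c ^ 3 - 3 * c)" unfolding 1 ww by simp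
  have "Re (w\<^sup>2 + (cnj w)\<^sup>2) = 2 * Re (w\<^sup>2)" by (simp add: power2_eq_square)
  thus "Re (w\<^sup>2) = c\<^sup>2 / 2 - 1" unfolding 2 by simp
  show "\<bar>c\<bar> \<le> 2" using abs_Re_le_cmod[of w] assms(1) by (simp add: c_def)
qed

text \<open>The cases differ in the negative indices present. For \<open>k = 1\<close> the term
  \<open>p^3 * w^2\<close> has no partner, so it is not a real multiple of \<open>p^3\<close> and
  needs its own core. For \<open>k = 2\<close> the unpaired \<open>p^8 * w^3\<close> joins the
  remainder. From \<open>k = 3\<close> on only the tail \<open>n \<le> -4\<close> is added to it.
  Points \<open>p\<close> below the real axis are reached later by conjugation.\<close>

lemma theta_trunc_nonzero_sector:
  assumes \<rho>: "norm p \<le> 0.7746" and p0: "p \<noteq> 0" and w: "norm w = 1" and k: "k \<ge> 1"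
    and arg: "0 \<le> Re p" "Re p \<le> 0.92389 * norm p" "0.38267 * norm p \<le> Im p"
  shows "theta_trunc k p w \<noteq> 0"
proof
  assume zero: "theta_trunc k p w = 0"
  define \<rho> where "\<rho> = norm p"
  define h where "h = 1 / \<rho>"
  define e where "e = p / of_real \<rho>"
  define A where "A = Re e"
  define s where "s = Im e"
  define c where "c = 2 * Re w"
  have \<rho>p: "0 < \<rho>" "\<rho> \<le> 0.7746" "\<rho> < 1" using assms by (auto simp: \<rho>_def)
  have h: "h * \<rho> = 1" using \<rho>p by (simp add: h_def)
  have e1: "norm e = 1" using p0 by (simp add: e_def \<rho>_def norm_divide)
  have p_eq: "p = of_real \<rho> * e" using \<rho>p by (simp add: e_def)
  have A: "0 \<le> A" "A \<le> 0.92389" and s: "0.38267 \<le> s"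
    using arg \<rho>p by (auto simp: A_def s_def e_def \<rho>_def field_simps)
  note up = unit_powers[OF e1, folded A_def s_def]
  note uc = unit_circle_sums[OF w, folded c_def]
  have inv_p: "inverse p = of_real h * cnj e"
  proof (rule inverse_unique)
    have "p * (of_real h * cnj e) = of_real (h * \<rho>) * (e * cnj e)" by (simp add: p_eq)
    also have "e * cnj e = 1" using e1 by (simp add: complex_norm_square[symmetric])
    finally show "p * (of_real h * cnj e) = 1" using h by simp
  qed
  define t where "t = partial_theta (p\<^sup>2) (p ^ 7 * w)"
  have p1: "norm p < 1" using \<rho>p by (simp add: \<rho>_def)
  have \<rho>9: "\<rho> ^ 9 \<le> 0.1005"
    using power_mono[of \<rho> "0.7746" 9] \<rho>p by (simp add: power_divide)
  have inv9: "1 / (1 - \<rho> ^ 9) \<le> 1.12" using \<rho>9 by (simp add: field_simps)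
  have t: "norm t \<le> 1.12"
  proof -
    have n: "norm (p\<^sup>2 * (p ^ 7 * w)) = \<rho> ^ 9"
      by (simp add: norm_mult norm_power w \<rho>_def power_add[symmetric])
    show ?thesis unfolding t_def
      using theta_norm_le[OF norm_square_less_1[OF p1], of "p ^ 7 * w"] \<rho>9 inv9 unfolding n by simp
  qed
  define L where "L = (\<Sum>n=1..k. p ^ n\<^sup>2 * cnj w ^ n)"
  have F: "1 + p * w + p ^ 4 * w ^ 2 + p ^ 9 * w ^ 3 + p ^ 16 * w ^ 4 * t + L = 0"
  proof -
    have "w ^ k \<noteq> 0" using w by auto
    moreover have "theta_trunc k p w = w ^ k * (1 + p * w + p ^ 4 * w ^ 2 + p ^ 9 * w ^ 3 + p ^ 16 * w ^ 4 * t + L)"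
      unfolding theta_trunc_on_circle[OF w, of k p] theta_trunc_0_expand[OF p1, of w] t_def L_def ..
    ultimately show ?thesis using zero by (metis mult_eq_0_iff)
  qed
  define U where "U = p ^ 15 * w ^ 4 * t"
  have U: "norm U \<le> 1.12 * \<rho> ^ 15"
  proof -
    have "norm U = \<rho> ^ 15 * norm t" by (simp add: U_def norm_mult norm_power w \<rho>_def)
    also have "\<dots> \<le> \<rho> ^ 15 * 1.12" using t \<rho>p by (intro mult_left_mono) auto
    finally show ?thesis by simp
  qed
  have Fp: "of_real h * cnj e + w + p ^ 3 * w\<^sup>2 + p ^ 8 * w ^ 3 + U + L / p = 0"
  proof -
    have "(1 + p * w + p ^ 4 * w ^ 2 + p ^ 9 * w ^ 3 + p ^ 16 * w ^ 4 * t + L) / p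
        = inverse p + w + p ^ 3 * w\<^sup>2 + p ^ 8 * w ^ 3 + U + L / p"
      using p0 by (simp add: U_def field_simps eval_nat_numeral)
    thus ?thesis unfolding F inv_p by simp
  qed
  have p3: "p ^ 3 = of_real (\<rho> ^ 3) * e ^ 3" and p8: "p ^ 8 = of_real (\<rho> ^ 8) * e ^ 8"
    by (simp_all add: p_eq power_mult_distrib)
  have n8: "norm (p ^ 8 * w ^ 3) = \<rho> ^ 8" by (simp add: norm_mult norm_power w \<rho>_def)
  consider "k = 1" | "k = 2" | "k \<ge> 3" using k by linarith
  thus False
  proof cases
    case 1
    have "L = p * cnj w" by (simp add: L_def 1)
    hence Lp: "L / p = cnj w" using p0 by simp
    define R where "R = p ^ 8 * w ^ 3 + U"
    define \<omega> where "\<omega> = e ^ 3 * w\<^sup>2"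
    have \<omega>1: "norm \<omega> = 1" using e1 w by (simp add: \<omega>_def norm_mult norm_power)
    have eq: "of_real h * cnj e + of_real c + of_real (\<rho> ^ 3) * \<omega> + R = 0"
      using Fp unfolding Lp p3 uc(1)[symmetric] by (simp add: R_def \<omega>_def algebra_simps)
    have "\<omega> * cnj (e ^ 3) = (e * cnj e) ^ 3 * w\<^sup>2" by (simp add: \<omega>_def power_mult_distrib)
    also have "e * cnj e = 1" using e1 by (simp add: complex_norm_square[symmetric])
    finally have "w\<^sup>2 = \<omega> * cnj (e ^ 3)" by simp
    hence "Re (w\<^sup>2) = Re (\<omega> * cnj (e ^ 3))" by (simp only:)
    hence w2: "c\<^sup>2 / 2 - 1 = Re \<omega> * (A * (4 * A\<^sup>2 - 3)) + Im \<omega> * (s * (3 - 4 * s\<^sup>2))"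
      unfolding uc(4) using up(2,3) by (simp only: complex.sel times_complex.sel cnj.sel)
    show False
    proof (rule sector_core_1[OF \<rho>p(1,2) h s A up(1) _ _ w2])
      show "norm R \<le> \<rho> ^ 8 + 1.12 * \<rho> ^ 15"
        unfolding R_def using norm_triangle_ineq[of "p ^ 8 * w ^ 3" U] U n8 by linarith
      show "(Re \<omega>)\<^sup>2 + (Im \<omega>)\<^sup>2 = 1" using \<omega>1 by (simp add: cmod_def)
      show "s * h = \<rho> ^ 3 * Im \<omega> + Im R" using arg_cong[OF eq, of Im] by (simp add: s_def algebra_simps)
      show "A * h + c + \<rho> ^ 3 * Re \<omega> + Re R = 0" using arg_cong[OF eq, of Re] by (simp add: A_def algebra_simps)
    qed
  next
    case 2
    have "L = p * cnj w + p ^ 4 * (cnj w)\<^sup>2" by (simp add: L_def 2 numeral_2_eq_2 eval_nat_numeral)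
    hence Lp: "L / p = cnj w + p ^ 3 * (cnj w)\<^sup>2" using p0 by (simp add: field_simps eval_nat_numeral)
    define R where "R = p ^ 8 * w ^ 3 + U"
    have "of_real h * cnj e + (w + cnj w) + p ^ 3 * (w\<^sup>2 + (cnj w)\<^sup>2) + R = 0"
      using Fp unfolding Lp by (simp add: R_def algebra_simps)
    hence eq: "of_real h * cnj e + of_real c + of_real (\<rho> ^ 3 * (c\<^sup>2 - 2)) * e ^ 3 + R = 0"
      unfolding uc(1,2) p3 by (simp add: mult_ac)
    show False
    proof (rule sector_core_2[OF \<rho>p(1,2) h s A up(1) uc(5)])
      show "norm R \<le> \<rho> ^ 8 + 1.12 * \<rho> ^ 15"
        unfolding R_def using norm_triangle_ineq[of "p ^ 8 * w ^ 3" U] U n8 by linarith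
      show "s * h = \<rho> ^ 3 * (c\<^sup>2 - 2) * (s * (3 - 4 * s\<^sup>2)) + Im R"
        using arg_cong[OF eq, of Im] unfolding up(3)[symmetric] by (simp add: s_def algebra_simps)
      show "A * h + c + \<rho> ^ 3 * (c\<^sup>2 - 2) * (A * (4 * A\<^sup>2 - 3)) + Re R = 0"
        using arg_cong[OF eq, of Re] unfolding up(2)[symmetric] by (simp add: A_def algebra_simps)
    qed
  next
    case 3
    define M where "M = (\<Sum>n=4..k. p ^ n\<^sup>2 * cnj w ^ n)"
    have "{1..k} = {1, 2, 3} \<union> {4..k}" using 3 by auto
    hence "L = (\<Sum>n\<in>{1, 2, 3}. p ^ n\<^sup>2 * cnj w ^ n) + M"
      unfolding L_def M_def by (subst sum.union_disjoint[symmetric]) auto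
    hence "L = p * cnj w + p ^ 4 * (cnj w)\<^sup>2 + p ^ 9 * cnj w ^ 3 + M" by simp
    hence Lp: "L / p = cnj w + p ^ 3 * (cnj w)\<^sup>2 + p ^ 8 * cnj w ^ 3 + M / p"
      using p0 by (simp add: field_simps eval_nat_numeral)
    have "norm M \<le> 1.12 * \<rho> ^ 16"
    proof -
      have "norm M \<le> (\<Sum>n=4..k. \<rho> ^ n\<^sup>2)"
        unfolding M_def by (rule order_trans[OF norm_sum]) (simp add: norm_mult norm_power w \<rho>_def)
      also have "\<dots> \<le> \<rho> ^ 4\<^sup>2 / (1 - \<rho> ^ (2 * 4 + 1))"
        by (rule square_power_tail_le) (use \<rho>p in auto)
      also have "\<dots> = \<rho> ^ 16 * (1 / (1 - \<rho> ^ 9))" by simp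
      also have "\<dots> \<le> \<rho> ^ 16 * 1.12" using inv9 \<rho>p by (intro mult_left_mono) auto
      finally show ?thesis by simp
    qed
    moreover have "\<rho> ^ 16 = \<rho> * \<rho> ^ 15" by (simp add: power_Suc[symmetric])
    ultimately have Mp: "norm (M / p) \<le> 1.12 * \<rho> ^ 15"
      using \<rho>p by (simp add: norm_divide \<rho>_def[symmetric] field_simps)
    define R where "R = U + M / p"
    have "of_real h * cnj e + (w + cnj w) + p ^ 3 * (w\<^sup>2 + (cnj w)\<^sup>2) + p ^ 8 * (w ^ 3 + cnj w ^ 3) + R = 0"
      using Fp unfolding Lp by (simp add: R_def algebra_simps)
    hence eq: "of_real h * cnj e + of_real c + of_real (\<rho> ^ 3 * (c\<^sup>2 - 2)) * e ^ 3
        + of_real (\<rho> ^ 8 * (c ^ 3 - 3 * c)) * e ^ 8 + R = 0"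
      unfolding uc(1-3) p3 p8 by (simp add: mult_ac)
    show False
    proof (rule sector_core_3[OF \<rho>p(1,2) h s A up(1) uc(5)])
      show "norm R \<le> 2.24 * \<rho> ^ 15"
        unfolding R_def using norm_triangle_ineq[of U "M / p"] U Mp by simp
      show "\<bar>Re (e ^ 8)\<bar> \<le> 1" using abs_Re_le_cmod[of "e ^ 8"] e1 by (simp add: norm_power)
      show "s * h = \<rho> ^ 3 * (c\<^sup>2 - 2) * (s * (3 - 4 * s\<^sup>2))
        + \<rho> ^ 8 * (c ^ 3 - 3 * c) * (s * (8 * A * (1 - 2 * s\<^sup>2) * (2 * (1 - 2 * s\<^sup>2)\<^sup>2 - 1))) + Im R"
        using arg_cong[OF eq, of Im] unfolding up(3,4)[symmetric] by (simp add: s_def algebra_simps)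
      show "A * h + c + \<rho> ^ 3 * (c\<^sup>2 - 2) * (A * (4 * A\<^sup>2 - 3)) + \<rho> ^ 8 * (c ^ 3 - 3 * c) * Re (e ^ 8) + Re R = 0"
        using arg_cong[OF eq, of Re] unfolding up(2)[symmetric] by (simp add: A_def algebra_simps)
    qed
  qed
qed

section \<open>Conjugation symmetry and the passage from \<open>p\<close> to the sector\<close>

lemma theta_cnj:
  assumes "norm q < 1"
  shows "partial_theta (cnj q) (cnj x) = cnj (partial_theta q x)"
proof -
  have "(\<lambda>j. cnj (q ^ (j * (j + 1) div 2) * x ^ j)) sums cnj (partial_theta q x)"
    unfolding sums_cnj partial_theta_def by (rule summable_sums[OF theta_summable[OF assms]])
  thus ?thesis unfolding partial_theta_def by (simp add: sums_iff)
qed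

lemma theta_trunc_cnj:
  assumes "norm p < 1"
  shows "theta_trunc k (cnj p) (cnj w) = cnj (theta_trunc k p w)"
  by (induction k) (use theta_cnj[OF norm_square_less_1[OF assms], of "p * w"] in simp_all)

lemma cos_pi_4_le: "cos (pi / 4) \<le> 0.70711"
proof -
  have "sqrt 2 \<le> 1.41422" by (rule real_le_lsqrt) (simp_all add: power2_eq_square)
  thus ?thesis by (simp add: cos_45)
qed

lemma Re_le_in_sector:
  assumes "q \<in> sector_S"
  shows "Re q \<le> cos (pi / 4) * norm q"
proof -
  have "cos (Arg2pi q) \<le> cos (pi / 4)"
  proof (cases "Arg2pi q \<le> pi")
    case True
    thus ?thesis using assms by (intro cos_monotone_0_pi_le) (auto simp: sector_S_def)
  next
    case False
    have "cos (Arg2pi q) = cos (2 * pi - Arg2pi q)" by (simp add: cos_diff)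
    also have "\<dots> \<le> cos (pi / 4)"
      using assms False by (intro cos_monotone_0_pi_le) (auto simp: sector_S_def)
    finally show ?thesis .
  qed
  moreover have "Re q = norm q * cos (Arg2pi q)"
    using arg_cong[OF Arg2pi_eq[of q], of Re] by (simp add: Re_exp)
  ultimately show ?thesis
    using mult_left_mono[of "cos (Arg2pi q)" "cos (pi / 4)" "norm q"] by (simp add: mult.commute)
qed

lemma Re_gt_outside_sector:
  assumes "q \<notin> sector_S" "q \<noteq> 0" "norm q < 0.6"
  shows "Re q > \<bar>Im q\<bar>"
proof -
  have a: "Arg2pi q < pi / 4 \<or> 7 * pi / 4 < Arg2pi q" using assms by (auto simp: sector_S_def)
  have b: "0 \<le> Arg2pi q" "Arg2pi q < 2 * pi" using Arg2pi by auto
  have "cos (Arg2pi q) > cos (pi / 4)"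
  proof (cases "Arg2pi q < pi / 4")
    case True
    thus ?thesis using b by (intro cos_monotone_0_pi) auto
  next
    case False
    have "cos (Arg2pi q) = cos (2 * pi - Arg2pi q)" by (simp add: cos_diff)
    also have "\<dots> > cos (pi / 4)"
      using a b False by (intro cos_monotone_0_pi) auto
    finally show ?thesis .
  qed
  moreover have "Re q = norm q * cos (Arg2pi q)"
    using arg_cong[OF Arg2pi_eq[of q], of Re] by (simp add: Re_exp)
  ultimately have "norm q * cos (pi / 4) < Re q" using assms(2) by simp
  hence "(norm q * cos (pi / 4))\<^sup>2 < (Re q)\<^sup>2"
    by (intro power_strict_mono) (auto simp: cos_45)
  hence "(Re q)\<^sup>2 + (Im q)\<^sup>2 < 2 * (Re q)\<^sup>2"
    by (simp add: power_mult_distrib cos_45 power_divide cmod_power2)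
  hence "\<bar>Im q\<bar> < \<bar>Re q\<bar>" by (simp add: abs_le_square_iff not_le[symmetric])
  moreover have "Re q > 0" using \<open>norm q * cos (pi / 4) < Re q\<close>
    by (rule le_less_trans[rotated]) (simp add: cos_45)
  ultimately show ?thesis by simp
qed

lemma strongly_separated_sector:
  assumes q: "q \<in> sector_S"
  shows "strongly_separated q"
proof -
  define p where "p = csqrt q"
  define \<rho> where "\<rho> = norm p"
  have q0: "q \<noteq> 0" and q6: "norm q < 0.6" using q by (auto simp: sector_S_def)
  have qp: "p\<^sup>2 = q" by (simp add: p_def)
  have p0: "p \<noteq> 0" using qp q0 by auto
  have \<rho>2: "\<rho>\<^sup>2 = norm q" using qp by (metis \<rho>_def norm_power)
  have \<rho>0: "0 \<le> \<rho>" by (simp add: \<rho>_def)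
  have \<rho>: "\<rho> \<le> 0.7746"
  proof (rule power2_le_imp_le)
    show "\<rho>\<^sup>2 \<le> 0.7746\<^sup>2" using \<rho>2 q6 by (simp add: power2_eq_square)
  qed simp
  have Re0: "0 \<le> Re p" using Re_csqrt by (simp add: p_def)
  have Req: "Re q = (Re p)\<^sup>2 - (Im p)\<^sup>2" using qp by (metis Re_power2)
  have sum: "\<rho>\<^sup>2 = (Re p)\<^sup>2 + (Im p)\<^sup>2" by (simp add: \<rho>_def cmod_power2)
  have "cos (pi / 4) * \<rho>\<^sup>2 \<le> 0.70711 * \<rho>\<^sup>2" using cos_pi_4_le by (intro mult_right_mono) auto
  hence le: "Re q \<le> 0.70711 * \<rho>\<^sup>2" using Re_le_in_sector[OF q] \<rho>2 by simp
  \<comment> \<open>The half-angle formulas, with \<open>x\<close> and \<open>y\<close> the squares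
    of the real and imaginary parts of \<open>p\<close>.\<close>
  have "x \<le> 0.92389\<^sup>2 * (x + y)" "0.38267\<^sup>2 * (x + y) \<le> y"
    if "x - y \<le> 0.70711 * (x + y)" "0 \<le> x" "0 \<le> y" for x y :: real
    using that by (simp_all add: power2_eq_square)
  from this[of "(Re p)\<^sup>2" "(Im p)\<^sup>2"] le
  have sq: "(Re p)\<^sup>2 \<le> (0.92389 * \<rho>)\<^sup>2" "(0.38267 * \<rho>)\<^sup>2 \<le> \<bar>Im p\<bar>\<^sup>2"
    unfolding power_mult_distrib power2_abs sum Req by simp_all
  have Re1: "Re p \<le> 0.92389 * \<rho>" by (rule power2_le_imp_le[OF sq(1)]) (use \<rho>0 in simp)
  have Im1: "0.38267 * \<rho> \<le> \<bar>Im p\<bar>" by (rule power2_le_imp_le[OF sq(2)]) simp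
  have upper: "theta_trunc k (of_real t * p') w \<noteq> 0"
    if "k \<ge> 1" "0 < t" "t \<le> 1" "norm w = 1" and p': "norm p' = \<rho>" "Re p' = Re p" "Im p' = \<bar>Im p\<bar>" for k t w p'
  proof (rule theta_trunc_nonzero_sector)
    have n: "norm (of_real t * p') = t * \<rho>" using that by (simp add: norm_mult)
    have "t * \<rho> \<le> 1 * \<rho>" using that \<rho>0 by (intro mult_right_mono) auto
    thus "norm (of_real t * p') \<le> 0.7746" unfolding n using \<rho> by linarith
    show "of_real t * p' \<noteq> 0" using that p0 by (auto simp: \<rho>_def)
    show "0 \<le> Re (of_real t * p')" using Re0 that by simp
    show "Re (of_real t * p') \<le> 0.92389 * norm (of_real t * p')"
      unfolding n using mult_left_mono[OF Re1, of t] that by simp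
    show "0.38267 * norm (of_real t * p') \<le> Im (of_real t * p')"
      unfolding n using mult_left_mono[OF Im1, of t] that by simp
  qed (use that in auto)
  have "strongly_separated (p\<^sup>2)"
  proof (rule strongly_separatedI)
    show p1: "norm p < 1" using \<rho> by (simp add: \<rho>_def)
    show "p \<noteq> 0" by (rule p0)
    fix k :: nat and t :: real and w :: complex
    assume *: "k \<ge> 1" "0 < t" "t \<le> 1" "norm w = 1"
    show "theta_trunc k (of_real t * p) w \<noteq> 0"
    proof (cases "Im p \<ge> 0")
      case True
      thus ?thesis using upper[OF *, of p] by (simp add: \<rho>_def)
    next
      case False
      have "norm (of_real t * p) < 1"
        using * p1 mult_left_le_one_le[of "norm p" t] by (auto simp: norm_mult)
      hence "cnj (theta_trunc k (of_real t * p) w) = theta_trunc k (of_real t * cnj p) (cnj w)"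
        using theta_trunc_cnj[of "of_real t * p" k w] by simp
      also have "\<dots> \<noteq> 0" using * False by (intro upper) (auto simp: \<rho>_def)
      finally show ?thesis by auto
    qed
  qed
  thus ?thesis by (simp add: qp)
qed

section \<open>The disk of radius 0.31\<close>

text \<open>The constant 0.5568 exceeds \<open>sqrt 0.31\<close>. The equation says
  \<open>-p*c = 1 + p^4 * (c^2 - 2) + e\<close>, where the left side has modulus
  \<open>b \<le> 2 * \<rho>\<close>. A large \<open>b\<close> forces \<open>c^2 \<ge> 2\<close>, and
  the imaginary part then puts \<open>p\<close> near the real axis. So \<open>p^4\<close> has
  positive real part and only increases the right side: at the extreme \<open>c = -2\<close>,
  \<open>\<rho> = 0.5568\<close> it is about 1.19, while \<open>2 * \<rho>\<close> is about
  1.11.\<close>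

lemma small_core:
  fixes p e :: complex and c :: real
  assumes \<rho>: "norm p \<le> 0.5568" and c: "\<bar>c\<bar> \<le> 2" and e: "norm e \<le> 0.0105"
    and eq: "1 + p * of_real c + p ^ 4 * of_real (c\<^sup>2 - 2) + e = 0"
  shows False
proof -
  define \<rho> where "\<rho> = norm p"
  define c' where "c' = c\<^sup>2 - 2"
  define b where "b = \<rho> * \<bar>c\<bar>"
  define y where "y = Im p"
  have \<rho>0: "0 \<le> \<rho>" "\<rho> \<le> 0.5568" using \<rho> by (auto simp: \<rho>_def)
  have \<rho>4: "\<rho> ^ 4 \<le> 0.096117" "0 \<le> \<rho> ^ 4"
    using power_mono[OF \<rho>0(2,1), of 4] \<rho>0 by (auto simp: power_divide)
  have c2: "c\<^sup>2 \<le> 4" using c power_mono[of "\<bar>c\<bar>" 2 2] by simp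
  hence c': "\<bar>c'\<bar> \<le> 2" by (auto simp: c'_def abs_le_iff)
  have Ree: "\<bar>Re e\<bar> \<le> 0.0105" "\<bar>Im e\<bar> \<le> 0.0105"
    using e abs_Re_le_cmod[of e] abs_Im_le_cmod[of e] by linarith+
  have pc: "- (p * of_real c) = 1 + (p ^ 4 * of_real c' + e)" using eq by (simp add: c'_def algebra_simps eq_neg_iff_add_eq_0)
  have n4: "norm (p ^ 4 * of_real c' + e) \<le> \<rho> ^ 4 * \<bar>c'\<bar> + 0.0105"
    by (rule order_trans[OF norm_triangle_ineq]) (use e in \<open>simp add: norm_mult norm_power \<rho>_def\<close>)
  have bn: "norm (- (p * of_real c)) = b" by (simp add: norm_mult b_def \<rho>_def)
  have \<rho>c': "\<rho> ^ 4 * \<bar>c'\<bar> \<le> 0.192234" using mult_mono[OF \<rho>4(1) c'] by simp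
  have b1: "b \<ge> 0.797"
  proof -
    have "1 = - (p * of_real c) - (p ^ 4 * of_real c' + e)" unfolding pc by simp
    from arg_cong[OF this, of norm] have "1 \<le> b + norm (p ^ 4 * of_real c' + e)"
      using norm_triangle_ineq4[of "- (p * of_real c)" "p ^ 4 * of_real c' + e"] unfolding bn by simp
    thus ?thesis using n4 \<rho>c' by simp
  qed
  have b2: "b \<le> 2 * \<rho>" using c \<rho>0 mult_left_mono[OF c \<rho>0(1)] by (simp add: b_def)
  have c1: "\<bar>c\<bar> \<ge> 1.431"
  proof (rule ccontr)
    assume "\<not> ?thesis"
    hence "b \<le> 0.5568 * 1.431" unfolding b_def using \<rho>0 by (intro mult_mono) auto
    thus False using b1 by simp
  qed
  have c'0: "0 \<le> c'"
    using power_mono[OF c1, of 2] by (simp add: c'_def power2_eq_square)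
  have y_le: "\<bar>y\<bar> \<le> \<rho>" using abs_Im_le_cmod[of p] by (simp add: y_def \<rho>_def)
  have cy: "\<bar>c\<bar> * \<bar>y\<bar> \<le> 0.2028"
  proof -
    have "\<bar>c\<bar> * \<bar>y\<bar> = \<bar>Im (- (p * of_real c))\<bar>" by (simp add: y_def abs_mult)
    also have "\<dots> = \<bar>Im (p ^ 4 * of_real c' + e)\<bar>" unfolding pc by simp
    also have "\<dots> \<le> norm (p ^ 4 * of_real c' + e)" by (rule abs_Im_le_cmod)
    finally show ?thesis using n4 \<rho>c' by simp
  qed
  have Re4: "Re (p ^ 4) = \<rho> ^ 4 - 8 * \<rho>\<^sup>2 * y\<^sup>2 + 8 * y ^ 4"
  proof -
    have p: "p = Complex (Re p) y" by (simp add: y_def)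
    have r2: "\<rho>\<^sup>2 = (Re p)\<^sup>2 + y\<^sup>2" by (simp add: \<rho>_def y_def cmod_power2)
    have "\<rho> ^ 4 = (\<rho>\<^sup>2)\<^sup>2" by (simp add: power_mult[symmetric])
    thus ?thesis unfolding r2
      by (subst p) (simp add: power2_eq_square power4_eq_xxxx algebra_simps)
  qed
  have step: "b \<ge> 0.9895 + (1 - 8 * \<sigma>\<^sup>2) * \<rho> ^ 4 * c'" if "\<bar>y\<bar> \<le> \<sigma> * \<rho>" for \<sigma>
  proof -
    have "y\<^sup>2 \<le> (\<sigma> * \<rho>)\<^sup>2" using that by (metis abs_ge_zero power2_abs power_mono)
    hence "\<rho>\<^sup>2 * y\<^sup>2 \<le> \<rho>\<^sup>2 * (\<sigma> * \<rho>)\<^sup>2" by (intro mult_left_mono) auto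
    also have "\<dots> = \<sigma>\<^sup>2 * \<rho> ^ 4" by (simp add: power2_eq_square power4_eq_xxxx)
    finally have "\<rho>\<^sup>2 * y\<^sup>2 \<le> \<sigma>\<^sup>2 * \<rho> ^ 4" .
    moreover have "0 \<le> y ^ 4" by simp
    ultimately have "(1 - 8 * \<sigma>\<^sup>2) * \<rho> ^ 4 \<le> Re (p ^ 4)"
      unfolding Re4 by (simp only: left_diff_distrib mult_1_left mult.assoc)
    hence le: "(1 - 8 * \<sigma>\<^sup>2) * \<rho> ^ 4 * c' \<le> Re (p ^ 4) * c'" using c'0 by (rule mult_right_mono)
    have "Re (- (p * of_real c)) \<le> b" unfolding bn[symmetric] by (rule complex_Re_le_cmod)
    moreover have "Re (- (p * of_real c)) = 1 + Re (p ^ 4) * c' + Re e" unfolding pc by simp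
    ultimately have "1 + Re (p ^ 4) * c' + Re e \<le> b" by simp
    moreover have "0.9895 + x \<le> b" if "x \<le> r" "1 + r + z \<le> b" "\<bar>z\<bar> \<le> 0.0105" for x r z :: real
      using that(1,2) that(3)[unfolded abs_le_iff] by simp
    ultimately show ?thesis using le Ree(1) by blast
  qed
  have ratio: "\<bar>y\<bar> \<le> \<sigma> * \<rho>" if "\<beta> \<le> b" "0.2028 \<le> \<sigma> * \<beta>" "0 < \<beta>" "0 \<le> \<sigma>" for \<beta> \<sigma>
  proof -
    have "b * \<bar>y\<bar> = \<rho> * (\<bar>c\<bar> * \<bar>y\<bar>)" by (simp add: b_def)
    also have "\<dots> \<le> \<rho> * (\<sigma> * \<beta>)" using cy that(2) \<rho>0 by (intro mult_left_mono) auto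
    also have "\<dots> \<le> \<rho> * (\<sigma> * b)" using that \<rho>0 by (intro mult_left_mono) auto
    finally have "b * \<bar>y\<bar> \<le> b * (\<sigma> * \<rho>)" by (simp add: mult_ac)
    thus ?thesis by (rule mult_left_le_imp_le) (use that in linarith)
  qed
  \<comment> \<open>Bootstrap: \<open>b \<ge> 0.797\<close> gives
    \<open>|y| \<le> 0.2545 * \<rho>\<close>, just enough for \<open>1 - 8 * \<sigma>^2\<close> to
    be positive. This raises the bound on \<open>b\<close> to 0.9895, and then the ratio improves to
    0.205.\<close>
  have "b \<ge> 0.9895"
  proof -
    have "0 \<le> (1 - 8 * 0.2545\<^sup>2) * \<rho> ^ 4 * c'" using \<rho>4 c'0 by (simp add: power2_eq_square)
    thus ?thesis using step[OF ratio[OF b1, of "0.2545"]] by simp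
  qed
  hence "b \<ge> 0.9895 + (1 - 8 * 0.205\<^sup>2) * \<rho> ^ 4 * c'" by (intro step ratio) auto
  moreover have "\<rho> ^ 4 * c' = \<rho>\<^sup>2 * b\<^sup>2 - 2 * \<rho> ^ 4"
    by (simp add: c'_def b_def power_mult_distrib power2_eq_square power4_eq_xxxx algebra_simps)
  moreover have "\<rho>\<^sup>2 * b\<^sup>2 - 2 * \<rho> ^ 4 \<ge> 2 * \<rho> ^ 4 - 4 * \<rho> ^ 3 * (2 * \<rho> - b)"
  proof -
    have "\<rho>\<^sup>2 * b\<^sup>2 - 2 * \<rho> ^ 4 - (2 * \<rho> ^ 4 - 4 * \<rho> ^ 3 * (2 * \<rho> - b)) = (\<rho> * (2 * \<rho> - b))\<^sup>2"
      by (simp add: power2_eq_square power3_eq_cube power4_eq_xxxx algebra_simps)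
    thus ?thesis using zero_le_power2[of "\<rho> * (2 * \<rho> - b)"] by linarith
  qed
  moreover have "4 * \<rho> ^ 3 * (2 * \<rho> - b) \<le> 0.6906 * (2 * \<rho> - b)"
    using power_mono[OF \<rho>0(2,1), of 3] b2 by (intro mult_right_mono) (auto simp: power_divide)
  \<comment> \<open>The tangent to the fourth power at the right endpoint 0.5568, with coefficients
    rounded in the safe direction.\<close>
  moreover have "\<rho> ^ 4 \<ge> 0.096115 + 0.6905 * (\<rho> - 0.5568)"
  proof -
    have id: "\<rho> ^ 4 - r ^ 4 - 4 * r ^ 3 * (\<rho> - r) = (\<rho> - r)\<^sup>2 * (\<rho>\<^sup>2 + 2 * r * \<rho> + 3 * r\<^sup>2)" for r
      by (simp add: power2_eq_square power3_eq_cube power4_eq_xxxx algebra_simps)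
    have "0 \<le> (\<rho> - 0.5568)\<^sup>2 * (\<rho>\<^sup>2 + 2 * 0.5568 * \<rho> + 3 * 0.5568\<^sup>2)" using \<rho>0 by simp
    thus ?thesis unfolding id[symmetric] using \<rho>0 by (simp add: power_divide field_simps)
  qed
  moreover have False
    if "b \<ge> 0.9895 + (1 - 8 * 0.205\<^sup>2) * (R * c')" "R * c' = Y - 2 * R" "Y - 2 * R \<ge> 2 * R - Z"
      "Z \<le> 0.6906 * (2 * \<rho> - b)" "R \<ge> 0.096115 + 0.6905 * (\<rho> - 0.5568)" for R Y Z
    using that b2 \<rho>0 by (simp add: power2_eq_square field_simps)
  ultimately show False unfolding mult.assoc by blast
qed

text \<open>With \<open>s = 1/u\<close> and \<open>\<zeta> = 1 - q(1 + u + s)\<close> the equation becomes \<open>M \<zeta> = -(1 - \<zeta>)\<^sup>3 \<tau>\<close> with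
  \<open>\<tau>\<close> close to \<open>1\<close>. It forces \<open>u\<close> close to \<open>5/4\<close> and then the real parts of both sides
  have different signs.\<close>

lemma circle_core:
  fixes q u \<tau> :: complex
  assumes u: "norm u = 5 / 4" and q: "norm q \<le> 0.31" and \<tau>: "norm (\<tau> - 1) \<le> 0.0377"
    and eq: "q - u + u\<^sup>2 - q * u ^ 3 + q ^ 3 * u ^ 4 * \<tau> = 0"
  shows False
proof -
  define s where "s = inverse u"
  define x where "x = Re s"
  define y where "y = Im s"
  define \<kappa> where "\<kappa> = 1 + u + s"
  define \<zeta> where "\<zeta> = 1 - q * \<kappa>"
  define a where "a = Re \<zeta>"
  define b where "b = Im \<zeta>"
  define M where "M = (1 - s) * \<kappa> ^ 3 * s\<^sup>2"
  define D where "D = norm (1 - s)"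
  have u0: "u \<noteq> 0" using u by auto
  have us: "u * s = 1" using u0 by (simp add: s_def)
  have ns: "norm s = 4 / 5" unfolding s_def norm_inverse u by simp
  have xy: "y\<^sup>2 = 0.64 - x\<^sup>2"
    using cmod_power2[of s] unfolding ns x_def y_def by (simp add: power2_eq_square)
  have s: "s = Complex x y" by (simp add: x_def y_def)
  have "u * of_real ((norm s)\<^sup>2) = cnj s"
    unfolding complex_norm_square mult.assoc[symmetric] us by simp
  hence "u = cnj s * of_real 1.5625" unfolding ns by (simp add: power2_eq_square field_simps)
  hence uc: "u = Complex (1.5625 * x) (- (1.5625 * y))" by (simp add: s complex_eq_iff)
  have x_abs: "\<bar>x\<bar> \<le> 0.8" using abs_Re_le_cmod[of s] ns by (simp add: x_def)
  have D2: "D\<^sup>2 = 1.64 - 2 * x"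
    unfolding D_def cmod_power2 s using xy by (simp add: power2_eq_square algebra_simps)
  have D0: "0 \<le> D" by (simp add: D_def)
  have main: "(1 - s) * \<zeta> = - (q ^ 3 * u\<^sup>2 * \<tau>)"
  proof -
    have "(1 - s) * \<zeta> * u\<^sup>2 = q - u + u\<^sup>2 - q * u ^ 3"
    proof -
      have "(1 - s) * \<zeta> * u\<^sup>2 = (u - u * s) * (u - q * (u + u * u + u * s))"
        by (simp add: \<zeta>_def \<kappa>_def algebra_simps power2_eq_square)
      thus ?thesis unfolding us by (simp add: algebra_simps power2_eq_square power3_eq_cube)
    qed
    moreover have "((1 - s) * \<zeta> + q ^ 3 * u\<^sup>2 * \<tau>) * u\<^sup>2 = (1 - s) * \<zeta> * u\<^sup>2 + q ^ 3 * u ^ 4 * \<tau>"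
      by algebra
    ultimately have "((1 - s) * \<zeta> + q ^ 3 * u\<^sup>2 * \<tau>) * u\<^sup>2 = 0" using eq by (simp only:)
    thus ?thesis using u0 by (simp add: eq_neg_iff_add_eq_0)
  qed
  have n\<tau>: "norm \<tau> \<le> 1.0377" using \<tau> norm_triangle_ineq[of "\<tau> - 1" 1] by simp
  have q3: "norm q ^ 3 \<le> 0.029791" using power_mono[OF q norm_ge_zero, of 3] by (simp add: power_divide)
  have D\<zeta>: "D * norm \<zeta> \<le> 0.04831"
  proof -
    have "D * norm \<zeta> = norm q ^ 3 * 1.5625 * norm \<tau>"
      using arg_cong[OF main, of norm] by (simp add: D_def norm_mult norm_power u power2_eq_square)
    also have "\<dots> \<le> (0.029791 * 1.5625) * 1.0377" using q3 n\<tau> by (intro mult_mono) auto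
    finally show ?thesis by simp
  qed
  have \<kappa>: "\<kappa> = Complex (1 + 2.5625 * x) (- (0.5625 * y))"
    unfolding \<kappa>_def uc s by (simp add: complex_eq_iff)
  have \<kappa>2: "(norm \<kappa>)\<^sup>2 = 1.2025 + 5.125 * x + 6.25 * x\<^sup>2"
    unfolding cmod_power2 \<kappa> complex.sel power2_minus power_mult_distrib xy
    by (simp add: power2_eq_square field_simps)
  have q\<kappa>: "norm (q * \<kappa>) \<le> 0.31 * norm \<kappa>" unfolding norm_mult using q by (intro mult_right_mono) auto
  have \<zeta>\<kappa>: "1 - 0.31 * norm \<kappa> \<le> norm \<zeta>"
    using norm_triangle_ineq2[of 1 "q * \<kappa>"] q\<kappa> by (simp add: \<zeta>_def)
  \<comment> \<open>If \<open>x \<le> 0.7\<close>, then \<open>norm \<kappa>\<close> is so small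
    that \<open>norm \<zeta> \<ge> 0.1312\<close>, while \<open>D \<ge> 0.4898\<close>; their
    product exceeds the bound in \<open>D\<zeta>\<close>.\<close>
  have x7: "x > 0.7"
  proof (rule ccontr)
    assume n: "\<not> ?thesis"
    have "0 \<le> (0.7 - x) * (x + 0.8)" using n x_abs by auto
    hence "(norm \<kappa>)\<^sup>2 \<le> 2.8023\<^sup>2"
      unfolding \<kappa>2 using n by (simp add: power2_eq_square algebra_simps)
    hence "norm \<kappa> \<le> 2.8023" by (rule power2_le_imp_le) simp
    hence z: "0.1312 \<le> norm \<zeta>" using \<zeta>\<kappa> by simp
    have "0.4898\<^sup>2 \<le> D\<^sup>2" unfolding D2 using n by (simp add: power2_eq_square)
    hence "0.4898 \<le> D" by (rule power2_le_imp_le) (rule D0)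
    hence "0.4898 * 0.1312 \<le> D * norm \<zeta>" using z by (intro mult_mono) auto
    thus False using D\<zeta> by simp
  qed
  have x8: "x \<le> 0.8" using x_abs by simp
  have "norm \<kappa> \<le> 3.05"
    unfolding \<kappa>_def using norm_triangle_ineq[of "1 + u" s] norm_triangle_ineq[of 1 u] u ns by simp
  hence q\<kappa>': "norm (q * \<kappa>) \<le> 0.9455" using q\<kappa> by simp
  hence a1: "a \<ge> 0.0545" using complex_Re_le_cmod[of "q * \<kappa>"] by (simp add: a_def \<zeta>_def)
  have D5: "0.2 \<le> D"
  proof -
    have "0.2\<^sup>2 \<le> D\<^sup>2" unfolding D2 using x8 by (simp add: power2_eq_square)
    thus ?thesis by (rule power2_le_imp_le) (rule D0)
  qed
  have n\<zeta>: "norm \<zeta> \<le> 0.24155"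
  proof -
    have "0.2 * norm \<zeta> \<le> D * norm \<zeta>" using D5 by (intro mult_right_mono) auto
    thus ?thesis using D\<zeta> by simp
  qed
  have ab: "a\<^sup>2 + b\<^sup>2 \<le> 0.0584"
    using power_mono[OF n\<zeta>, of 2] cmod_power2[of \<zeta>] by (simp add: a_def b_def power2_eq_square)
  have a2: "a \<le> 0.24155" using complex_Re_le_cmod[of \<zeta>] n\<zeta> by (simp add: a_def)
  have cube: "Re ((1 - \<zeta>) ^ 3 * \<tau>) \<ge> 0.403"
  proof -
    have "\<zeta> = Complex a b" by (simp add: a_def b_def)
    hence "Re ((1 - \<zeta>) ^ 3) = (1 - a) * ((1 - a)\<^sup>2 - 3 * b\<^sup>2)"
      by (simp add: power2_eq_square power3_eq_cube algebra_simps)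
    moreover have "(1 - a)\<^sup>2 - 3 * b\<^sup>2 \<ge> 0.5748"
    proof -
      have "0 \<le> (2 * a - 0.5)\<^sup>2" by simp
      thus ?thesis using ab by (simp add: power2_eq_square algebra_simps)
    qed
    hence "0.75845 * 0.5748 \<le> (1 - a) * ((1 - a)\<^sup>2 - 3 * b\<^sup>2)" using a2 by (intro mult_mono) auto
    ultimately have 1: "Re ((1 - \<zeta>) ^ 3) \<ge> 0.4359" by simp
    have "norm ((1 - \<zeta>) ^ 3) = norm (q * \<kappa>) ^ 3" by (simp add: \<zeta>_def norm_power)
    also have "\<dots> \<le> 0.9455 ^ 3" using q\<kappa>' by (intro power_mono) auto
    finally have "norm ((1 - \<zeta>) ^ 3 * (\<tau> - 1)) \<le> 0.9455 ^ 3 * 0.0377"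
      unfolding norm_mult using \<tau> by (intro mult_mono) auto
    moreover have "Re ((1 - \<zeta>) ^ 3 * \<tau>) = Re ((1 - \<zeta>) ^ 3) + Re ((1 - \<zeta>) ^ 3 * (\<tau> - 1))"
      by (simp add: algebra_simps)
    ultimately show ?thesis
      using 1 abs_Re_le_cmod[of "(1 - \<zeta>) ^ 3 * (\<tau> - 1)"] by (simp add: power_divide abs_le_iff)
  qed
  have M\<zeta>: "M * \<zeta> = - ((1 - \<zeta>) ^ 3 * \<tau>)"
  proof -
    have "M * \<zeta> = ((1 - s) * \<zeta>) * (\<kappa> ^ 3 * s\<^sup>2)" by (simp add: M_def mult_ac)
    also have "\<dots> = - ((q * \<kappa>) ^ 3 * (u * s)\<^sup>2 * \<tau>)" unfolding main by (simp add: power_mult_distrib mult_ac)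
    finally show ?thesis by (simp add: us \<zeta>_def)
  qed
  define P where "P = 0.36 + x + 2 * x\<^sup>2"
  define Q where "Q = 1 + 2 * x"
  define E where "E = 0.64 + 1.5625 * x - 2 * x\<^sup>2"
  define G where "G = 1.5625 + 2 * x"
  have \<kappa>s: "\<kappa> * s = Complex P (y * Q)"
  proof -
    have "\<kappa> * s = 1 + s + s\<^sup>2" using us by (simp add: \<kappa>_def algebra_simps power2_eq_square)
    thus ?thesis using xy by (simp add: s P_def Q_def complex_eq_iff power2_eq_square algebra_simps)
  qed
  have s\<kappa>: "(1 - s) * \<kappa> = Complex E (- (y * G))"
  proof -
    have "(1 - s) * \<kappa> = u - s\<^sup>2" using us by (simp add: \<kappa>_def algebra_simps power2_eq_square)
    thus ?thesis using xy by (simp add: uc s E_def G_def complex_eq_iff power2_eq_square algebra_simps)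
  qed
  have "M = ((1 - s) * \<kappa>) * (\<kappa> * s)\<^sup>2" by (simp add: M_def power2_eq_square power3_eq_cube mult_ac)
  hence M: "Re M = E * (P\<^sup>2 - (y * Q)\<^sup>2) + 2 * y\<^sup>2 * (G * P * Q)"
      "Im M = y * (2 * E * P * Q - G * (P\<^sup>2 - (y * Q)\<^sup>2))"
    unfolding \<kappa>s s\<kappa> by (simp_all add: power2_eq_square algebra_simps)
  have x2: "0.49 \<le> x\<^sup>2" "x\<^sup>2 \<le> 0.64"
    using power_mono[of "0.7" x 2] power_mono[of x "0.8" 2] x7 x8 by (auto simp: power2_eq_square)
  have y2: "0 \<le> y\<^sup>2" "y\<^sup>2 \<le> 0.15" using x2 xy by auto
  have P: "2.04 \<le> P" "P \<le> 2.44" and Q: "2.4 \<le> Q" "Q \<le> 2.6" and G: "2.9625 \<le> G" "G \<le> 3.1625"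
    using x7 x8 x2 by (auto simp: P_def Q_def G_def)
  have E: "0.61 \<le> E" "E \<le> 0.754"
  proof -
    have "0 \<le> (0.8 - x) * (x - 0.7)" "0 \<le> (x - 0.7) * (x - 0.7)" using x7 x8 by auto
    thus "0.61 \<le> E" "E \<le> 0.754" using x7 x8 by (auto simp: E_def power2_eq_square algebra_simps)
  qed
  have P2: "4.1616 \<le> P\<^sup>2" "P\<^sup>2 \<le> 5.9536"
    using power_mono[of "2.04" P 2] power_mono[of P "2.44" 2] P by (auto simp: power2_eq_square)
  have Q2: "Q\<^sup>2 \<le> 6.76" using power_mono[of Q "2.6" 2] Q by (auto simp: power2_eq_square)
  have yQ: "(y * Q)\<^sup>2 \<le> 1.014" using mult_mono[OF y2(2) Q2] by (simp add: power_mult_distrib)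
  have EPQ: "2.98 \<le> E * P * Q" "E * P * Q \<le> 4.79"
  proof -
    have "0.61 * 2.04 * 2.4 \<le> E * P * Q" using E P Q by (intro mult_mono) auto
    thus "2.98 \<le> E * P * Q" by simp
    have "E * P * Q \<le> 0.754 * 2.44 * 2.6" using E P Q by (intro mult_mono) auto
    thus "E * P * Q \<le> 4.79" by simp
  qed
  have ReM: "Re M \<ge> 2.53"
  proof -
    have "0.61 * 4.1616 \<le> E * P\<^sup>2" using E P2 by (intro mult_mono) auto
    moreover have "y\<^sup>2 * (E * Q\<^sup>2) \<le> y\<^sup>2 * (2 * (G * P * Q))"
    proof (rule mult_left_mono[OF _ y2(1)])
      have "E * Q\<^sup>2 \<le> 0.754 * 6.76" using E Q2 by (intro mult_mono) auto
      moreover have "2.9625 * 2.04 * 2.4 \<le> G * P * Q" using G P Q by (intro mult_mono) auto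
      ultimately show "E * Q\<^sup>2 \<le> 2 * (G * P * Q)" by simp
    qed
    ultimately show ?thesis unfolding M by (simp add: algebra_simps power_mult_distrib)
  qed
  have ImM: "\<bar>Im M\<bar> \<le> 12.87 * \<bar>y\<bar>"
  proof -
    have "G * (P\<^sup>2 - (y * Q)\<^sup>2) \<le> 3.1625 * 5.9536"
    proof (rule mult_mono)
      show "P\<^sup>2 - (y * Q)\<^sup>2 \<le> 5.9536" using P2 zero_le_power2[of "y * Q"] by linarith
    qed (use G P2 yQ in auto)
    moreover have "0 \<le> G * (P\<^sup>2 - (y * Q)\<^sup>2)" using G P2 yQ by (intro mult_nonneg_nonneg) auto
    moreover have "2 * E * P * Q = 2 * (E * P * Q)" by simp
    ultimately have "\<bar>2 * E * P * Q - G * (P\<^sup>2 - (y * Q)\<^sup>2)\<bar> \<le> 12.87"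
      using EPQ unfolding abs_le_iff by simp
    hence "\<bar>y\<bar> * \<bar>2 * E * P * Q - G * (P\<^sup>2 - (y * Q)\<^sup>2)\<bar> \<le> \<bar>y\<bar> * 12.87"
      by (rule mult_left_mono) simp
    thus ?thesis unfolding M abs_mult by (simp add: mult.commute)
  qed
  \<comment> \<open>The ratio \<open>|y| / D\<close> is the sine of the angle at 1 between
    \<open>s\<close> and the real axis. It is largest for the tangent to the circle of radius
    0.8.\<close>
  have yD: "\<bar>y\<bar> \<le> 0.8 * D"
  proof (rule power2_le_imp_le)
    have "0 \<le> (0.64 - x)\<^sup>2" by simp
    thus "\<bar>y\<bar>\<^sup>2 \<le> (0.8 * D)\<^sup>2" unfolding power_mult_distrib D2 power2_abs xy
      by (simp add: power2_eq_square algebra_simps)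
  qed (use D0 in simp)
  have "\<bar>Im M * b\<bar> \<le> 0.498"
  proof -
    have "\<bar>Im M\<bar> \<le> 10.296 * D" using ImM yD by simp
    moreover have "\<bar>b\<bar> \<le> norm \<zeta>" using abs_Im_le_cmod[of \<zeta>] by (simp add: b_def)
    ultimately have "\<bar>Im M\<bar> * \<bar>b\<bar> \<le> (10.296 * D) * norm \<zeta>" using D0 by (intro mult_mono) auto
    thus ?thesis using D\<zeta> by (simp add: abs_mult)
  qed
  \<comment> \<open>The resulting lower bound for \<open>Re (M * \<zeta>)\<close> is about -0.36,
    above the upper bound -0.403.\<close>
  moreover have "2.53 * 0.0545 \<le> Re M * a" using ReM a1 by (intro mult_mono) auto
  moreover have "Re (M * \<zeta>) = Re M * a - Im M * b" by (simp add: a_def b_def)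
  moreover have "Re (M * \<zeta>) \<le> - 0.403" unfolding M\<zeta> using cube by simp
  ultimately show False by (simp add: abs_le_iff)
qed

text \<open>For the outer circles the argument of \<open>p\<close> does not matter. The pairs up to
  index 2 are kept exactly, and all terms of index 3 or more in modulus contribute at most
  0.0105.\<close>

lemma theta_trunc_nonzero_031:
  assumes \<rho>: "norm p \<le> 0.5568" and w: "norm w = 1" and k: "k \<ge> 3"
  shows "theta_trunc k p w \<noteq> 0"
proof
  assume zero: "theta_trunc k p w = 0"
  define \<rho> where "\<rho> = norm p"
  define c where "c = 2 * Re w"
  note uc = unit_circle_sums[OF w, folded c_def]
  have \<rho>p: "0 \<le> \<rho>" "\<rho> \<le> 0.5568" "\<rho> < 1" using \<rho> by (auto simp: \<rho>_def)
  have p1: "norm p < 1" using \<rho>p by (simp add: \<rho>_def)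
  define t where "t = partial_theta (p\<^sup>2) (p ^ 7 * w)"
  have pm: "\<rho> ^ n \<le> 0.5568 ^ n" for n using \<rho>p by (intro power_mono) auto
  have \<rho>s: "\<rho> ^ 9 \<le> 0.005144" "\<rho> ^ 7 \<le> 0.0166" "\<rho> ^ 16 \<le> 0.0001"
    using pm[of 9] pm[of 7] pm[of 16] by (simp_all add: power_divide)
  have t: "norm t \<le> 1.01"
  proof -
    have n: "norm (p\<^sup>2 * (p ^ 7 * w)) = \<rho> ^ 9"
      by (simp add: norm_mult norm_power w \<rho>_def power_add[symmetric])
    have "norm t \<le> 1 / (1 - \<rho> ^ 9)"
      unfolding t_def using theta_norm_le[OF norm_square_less_1[OF p1], of "p ^ 7 * w"] \<rho>s unfolding n by simp
    also have "\<dots> \<le> 1.01" using \<rho>s by (simp add: field_simps)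
    finally show ?thesis .
  qed
  define L where "L = (\<Sum>n=1..k. p ^ n\<^sup>2 * cnj w ^ n)"
  define M where "M = (\<Sum>n=3..k. p ^ n\<^sup>2 * cnj w ^ n)"
  have "w ^ k \<noteq> 0" using w by auto
  moreover have "theta_trunc k p w = w ^ k * (1 + p * w + p ^ 4 * w ^ 2 + p ^ 9 * w ^ 3 + p ^ 16 * w ^ 4 * t + L)"
    unfolding theta_trunc_on_circle[OF w, of k p] theta_trunc_0_expand[OF p1, of w] t_def L_def ..
  ultimately have F: "1 + p * w + p ^ 4 * w ^ 2 + p ^ 9 * w ^ 3 + p ^ 16 * w ^ 4 * t + L = 0"
    using zero by (metis mult_eq_0_iff)
  have "{1..k} = {1, 2} \<union> {3..k}" using k by auto
  hence "L = (\<Sum>n\<in>{1, 2}. p ^ n\<^sup>2 * cnj w ^ n) + M"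
    unfolding L_def M_def by (subst sum.union_disjoint[symmetric]) auto
  hence L: "L = p * cnj w + p ^ 4 * (cnj w)\<^sup>2 + M" by simp
  have M: "norm M \<le> 0.00524"
  proof -
    have "norm M \<le> (\<Sum>n=3..k. \<rho> ^ n\<^sup>2)"
      unfolding M_def by (rule order_trans[OF norm_sum]) (simp add: norm_mult norm_power w \<rho>_def)
    also have "\<dots> \<le> \<rho> ^ 3\<^sup>2 / (1 - \<rho> ^ (2 * 3 + 1))"
      by (rule square_power_tail_le) (use \<rho>p in auto)
    also have "\<dots> = \<rho> ^ 9 / (1 - \<rho> ^ 7)" by simp
    also have "\<dots> \<le> 0.005144 / (1 - 0.0166)" using \<rho>s by (intro frac_le) auto
    finally show ?thesis by simp
  qed
  define e where "e = p ^ 9 * w ^ 3 + p ^ 16 * w ^ 4 * t + M"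
  have "norm (p ^ 9 * w ^ 3) = \<rho> ^ 9" by (simp add: norm_mult norm_power w \<rho>_def)
  moreover have "norm (p ^ 16 * w ^ 4 * t) \<le> 0.0001 * 1.01"
    unfolding norm_mult norm_power w using t \<rho>s by (intro mult_mono) (auto simp: \<rho>_def)
  ultimately have e: "norm e \<le> 0.0105"
    unfolding e_def using M \<rho>s norm_triangle_ineq[of "p ^ 9 * w ^ 3 + p ^ 16 * w ^ 4 * t" M]
      norm_triangle_ineq[of "p ^ 9 * w ^ 3" "p ^ 16 * w ^ 4 * t"] by simp
  have "1 + p * (w + cnj w) + p ^ 4 * (w\<^sup>2 + (cnj w)\<^sup>2) + e = 0"
    using F unfolding L by (simp add: e_def algebra_simps)
  hence "1 + p * of_real c + p ^ 4 * of_real (c\<^sup>2 - 2) + e = 0" unfolding uc(1,2) .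
  from small_core[OF \<rho> uc(5) e this] show False .
qed

text \<open>Two uses of the functional equation cancel the poles of
  \<open>q * \<theta>(q, -u/q^2)\<close> at \<open>q = 0\<close>. In this form the homotopy can run
  to \<open>q = 0\<close>, and Cauchy estimates in \<open>q\<close> can be made on disks containing
  0.\<close>

definition H_fun :: "complex \<Rightarrow> complex \<Rightarrow> complex" where
  "H_fun q u = q - u + u\<^sup>2 * partial_theta q (- u)"

lemma H_fun_theta:
  assumes "norm q < 1" "q \<noteq> 0"
  shows "H_fun q u = q * partial_theta q (- (1 / q\<^sup>2) * u)"
proof -
  have 1: "partial_theta q (- (1 / q\<^sup>2) * u) = 1 - u / q * partial_theta q (- (u / q))"
    using theta_functional[OF assms(1), of "- (1 / q\<^sup>2) * u"] assms(2)
    by (simp add: power2_eq_square field_simps)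
  have 2: "partial_theta q (- (u / q)) = 1 - u * partial_theta q (- u)"
    using theta_functional[OF assms(1), of "- (u / q)"] assms(2) by simp
  show ?thesis unfolding 1 2 H_fun_def using assms(2) by (simp add: field_simps power2_eq_square)
qed

lemma H_fun_holomorphic [holomorphic_intros]:
  assumes "norm q < 1"
  shows "H_fun q holomorphic_on A"
  unfolding H_fun_def using assms by (intro holomorphic_intros) auto

lemma norm_q_power_bounds:
  fixes q :: complex
  assumes "norm q \<le> 0.31"
  shows "norm q ^ 2 \<le> 0.0961" "norm q ^ 3 \<le> 0.029791" "norm q ^ 5 \<le> 0.0028630" "norm q ^ 6 \<le> 0.00088751"
    "norm q ^ 10 \<le> 0.0000081963"
proof -
  have "norm q ^ n \<le> 0.31 ^ n" for n using assms by (intro power_mono) auto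
  from this[of 2] this[of 3] this[of 5] this[of 6] this[of 10]
  show "norm q ^ 2 \<le> 0.0961" "norm q ^ 3 \<le> 0.029791" "norm q ^ 5 \<le> 0.0028630" "norm q ^ 6 \<le> 0.00088751"
    "norm q ^ 10 \<le> 0.0000081963"
    by (simp_all add: power_divide)
qed

lemma H_fun_circle_nonzero:
  assumes q: "norm q \<le> 0.31" and u: "norm u = 5 / 4"
  shows "H_fun q u \<noteq> 0"
proof
  assume H: "H_fun q u = 0"
  have q1: "norm q < 1" using q by simp
  note f = theta_functional[OF q1]
  define \<tau> where "\<tau> = partial_theta q (- (q\<^sup>2 * u))"
  define \<tau>' where "\<tau>' = partial_theta q (- (q ^ 3 * u))"
  have qp: "norm q ^ 3 \<le> 0.029791" "norm q ^ 4 \<le> 0.0093"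
    using power_mono[OF q norm_ge_zero, of 3] power_mono[OF q norm_ge_zero, of 4] by (auto simp: power_divide)
  have "\<tau> = 1 - q ^ 3 * u * \<tau>'"
    using f[of "- (q\<^sup>2 * u)"] by (simp add: \<tau>_def \<tau>'_def power2_eq_square power3_eq_cube mult_ac)
  hence "norm (\<tau> - 1) = norm q ^ 3 * 1.25 * norm \<tau>'" by (simp add: norm_mult norm_power u)
  also have "norm \<tau>' \<le> 1.012"
  proof -
    have n: "norm (q * (- (q ^ 3 * u))) = norm q ^ 4 * 1.25"
      by (simp add: norm_mult norm_power u power_numeral_reduce)
    have "norm \<tau>' \<le> 1 / (1 - norm q ^ 4 * 1.25)"
      unfolding \<tau>'_def using theta_norm_le[OF q1, of "- (q ^ 3 * u)"] qp unfolding n by simp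
    also have "\<dots> \<le> 1.012" using qp by (simp add: field_simps)
    finally show ?thesis .
  qed
  hence "norm q ^ 3 * 1.25 * norm \<tau>' \<le> 0.029791 * 1.25 * 1.012" using qp by (intro mult_mono) auto
  finally have \<tau>: "norm (\<tau> - 1) \<le> 0.0377" by simp
  have th: "partial_theta q (- u) = 1 - q * u * (1 - q\<^sup>2 * u * \<tau>)"
    using f[of "- u"] f[of "- (q * u)"] by (simp add: \<tau>_def power2_eq_square mult_ac)
  hence "H_fun q u = q - u + u\<^sup>2 - q * u ^ 3 + q ^ 3 * u ^ 4 * \<tau>"
    unfolding H_fun_def th by algebra
  with H circle_core[OF u q \<tau>] show False by simp
qed

text \<open>The deformation ends at \<open>u^2 - u\<close>. A further application of Rouche compares
  it with \<open>u^2\<close>, using that the radius exceeds 1.\<close>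

lemma zeros_count_H_fun:
  assumes q: "norm q \<le> 0.31"
  shows "zeros_count (H_fun q) (5 / 4) = 2"
proof -
  have lt: "norm (of_real t * q) \<le> 0.31" if "t \<in> {0..1}" for t
    using that q mult_left_le_one_le[of "norm q" t] by (auto simp: norm_mult)
  have "zeros_count (H_fun (of_real 1 * q)) (5 / 4) = zeros_count (H_fun (of_real 0 * q)) (5 / 4)"
  proof (rule zeros_count_homotopy)
    show "continuous_on ({0..1} \<times> sphere 0 (5 / 4)) (\<lambda>(t, z). H_fun (of_real t * q) z)"
      unfolding case_prod_unfold H_fun_def
      by (intro continuous_intros) (use lt in force)
    show "H_fun (of_real t * q) holomorphic_on UNIV" if "t \<in> {0..1}" for t
      using lt[OF that] by (intro H_fun_holomorphic) simp
    show "H_fun (of_real t * q) z \<noteq> 0" if "t \<in> {0..1}" "norm z = 5 / 4" for t z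
      by (rule H_fun_circle_nonzero[OF lt[OF that(1)] that(2)])
  qed auto
  also have "H_fun (of_real 0 * q) = (\<lambda>u. u ^ 2 + (- u))"
    by (rule ext) (simp add: H_fun_def)
  also have "zeros_count (\<lambda>u::complex. u ^ 2 + (- u)) (5 / 4) = zeros_count (\<lambda>u. u ^ 2) (5 / 4)"
  proof (rule zeros_count_Rouche)
    fix z :: complex assume z: "norm z = 5 / 4"
    show "norm (- z) < norm (z ^ 2)" unfolding norm_minus_cancel norm_power z by (simp add: power2_eq_square)
  qed (auto intro!: holomorphic_intros)
  finally show ?thesis by (simp add: zeros_count_power)
qed

lemma zeros_count_theta_inner:
  assumes q: "norm q \<le> 0.31" "q \<noteq> 0"
  shows "zeros_count (partial_theta q) (5 / 4 / (norm q)\<^sup>2) = 2"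
proof -
  have q1: "norm q < 1" using q by simp
  have "H_fun q = (\<lambda>u. q * partial_theta q (- (1 / q\<^sup>2) * u))"
    using H_fun_theta[OF q1 q(2)] by (rule ext)
  hence "2 = zeros_count (\<lambda>u. q * partial_theta q (- (1 / q\<^sup>2) * u)) (5 / 4)"
    using zeros_count_H_fun[OF q(1)] by simp
  also have "\<dots> = zeros_count (partial_theta q) (norm (- (1 / q\<^sup>2)) * (5 / 4))"
    by (rule zeros_count_scale[OF theta_holomorphic[OF q1]]) (use q in auto)
  also have "norm (- (1 / q\<^sup>2)) * (5 / 4) = 5 / 4 / (norm q)\<^sup>2" by (simp add: norm_divide norm_power)
  finally show ?thesis by (rule sym)
qed

lemma zorder_ge_2_imp_deriv_0:
  assumes "f holomorphic_on UNIV" "zorder f z \<ge> 2" "f z = 0"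
  shows "deriv f z = 0"
proof (rule ccontr)
  assume "deriv f z \<noteq> 0"
  hence "zorder f z = 1"
    by (intro zorder_zero_eqI[OF assms(1) open_UNIV]) (use assms(3) in auto)
  thus False using assms(2) by simp
qed

text \<open>The circle \<open>|u| = 5/4\<close> encloses 2 zeros and circle number
  \<open>k \<ge> 3\<close> encloses \<open>k\<close>. So each annulus outside the first has one zero
  counted with multiplicity, which leaves no room for a multiple one.\<close>

lemma multiple_zero_location:
  assumes q: "norm q \<le> 0.31" "q \<noteq> 0" and z: "multiple_zero (partial_theta q) z"
  shows "norm z < 5 / 4 / (norm q)\<^sup>2"
proof (rule ccontr)
  assume "\<not> ?thesis"
  hence ge: "5 / 4 / (norm q)\<^sup>2 \<le> norm z" by simp
  have q1: "norm q < 1" using q by simp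
  note holo = theta_holomorphic[OF q1]
  have \<theta>0: "partial_theta q 0 \<noteq> 0" by simp
  have z': "partial_theta q z = 0" "zorder (partial_theta q) z \<ge> 2" using z by (auto simp: multiple_zero_def)
  obtain p where qp: "q = p\<^sup>2" by (metis power2_csqrt)
  have p0: "p \<noteq> 0" using q qp by auto
  have p5: "norm p \<le> 0.5568"
  proof (rule power2_le_imp_le)
    have "(norm p)\<^sup>2 = norm q" by (simp add: qp norm_power)
    thus "(norm p)\<^sup>2 \<le> 0.5568\<^sup>2" using q by (simp add: power2_eq_square)
  qed simp
  have p1: "norm p < 1" using p5 by simp
  define r where "r k = 1 / norm p ^ (2 * k + 1)" for k
  have count: "zeros_count (partial_theta q) (r k) = int k" if "k \<ge> 3" for k
    unfolding r_def qp
  proof (rule zeros_count_theta[OF p1 p0])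
    fix t :: real and w :: complex assume *: "0 < t" "t \<le> 1" "norm w = 1"
    have "norm (of_real t * p) \<le> norm p" using * by (simp add: norm_mult mult_left_le_one_le)
    thus "theta_trunc k (of_real t * p) w \<noteq> 0"
      using theta_trunc_nonzero_031[of "of_real t * p" w k] * p5 that by simp
  qed
  have "\<exists>n. (1 / norm p) ^ n > norm z"
    using p1 p0 by (intro real_arch_pow) (simp add: field_simps)
  then obtain n where "norm z < (1 / norm p) ^ n" by auto
  also have "\<dots> \<le> (1 / norm p) ^ (2 * (n + 3) + 1)"
    using p0 p1 by (intro power_increasing) (auto simp: field_simps)
  also have "\<dots> = r (n + 3)" by (simp only: r_def power_divide power_one)
  finally have ex: "\<exists>k. k \<ge> 3 \<and> norm z < r k" by (intro exI[of _ "n + 3"]) simp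
  define k where "k = (LEAST k. k \<ge> 3 \<and> norm z < r k)"
  have k: "k \<ge> 3" "norm z < r k" using LeastI_ex[OF ex] by (auto simp: k_def)
  \<comment> \<open>Circle number 2 is replaced by the smaller circle \<open>|u| = 5/4\<close>,
    since \<open>double_zero_core\<close> starts from that bound.\<close>
  define lo where "lo = (if k = 3 then 5 / 4 / (norm q)\<^sup>2 else r (k - 1))"
  have lo: "lo \<le> norm z"
  proof (cases "k = 3")
    case False
    have "\<not> (k - 1 \<ge> 3 \<and> norm z < r (k - 1))"
      by (rule not_less_Least, unfold k_def[symmetric]) (use k in simp)
    thus ?thesis using False k by (auto simp: lo_def)
  qed (use ge in \<open>simp add: lo_def\<close>)
  have "zeros_count (partial_theta q) lo = int k - 1"
  proof (cases "k = 3")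
    case False
    thus ?thesis using k count[of "k - 1"] by (simp add: lo_def)
  qed (use zeros_count_theta_inner[OF q] in \<open>simp add: lo_def\<close>)
  moreover have "zeros_count (partial_theta q) lo + (\<Sum>z\<in>{z}. zorder (partial_theta q) z) \<le> zeros_count (partial_theta q) (r k)"
    by (rule zeros_count_mono_diff[OF holo \<theta>0]) (use lo k z' in auto)
  ultimately show False using count[OF k(1)] z'(2) by simp
qed

lemma multiple_zero_H_fun:
  assumes q: "norm q \<le> 0.31" "q \<noteq> 0" and z: "multiple_zero (partial_theta q) z"
  obtains u where "norm u < 5 / 4" "H_fun q u = 0" "deriv (H_fun q) u = 0"
proof
  have q1: "norm q < 1" using q by simp
  define u where "u = - (q\<^sup>2 * z)"
  have zu: "z = - (1 / q\<^sup>2) * u" using q(2) by (simp add: u_def)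
  have eq: "H_fun q = (\<lambda>u. q * partial_theta q (- (1 / q\<^sup>2) * u))"
    using H_fun_theta[OF q1 q(2)] by (rule ext)
  have z': "partial_theta q z = 0" "zorder (partial_theta q) z \<ge> 2" using z by (auto simp: multiple_zero_def)
  note holo = theta_holomorphic[OF q1]
  have "norm u = (norm q)\<^sup>2 * norm z" by (simp add: u_def norm_mult norm_power)
  also have "\<dots> < (norm q)\<^sup>2 * (5 / 4 / (norm q)\<^sup>2)"
    using multiple_zero_location[OF assms] q(2) by (intro mult_strict_left_mono) auto
  finally show "norm u < 5 / 4" using q(2) by simp
  show "H_fun q u = 0" unfolding H_fun_theta[OF q1 q(2)] zu[symmetric] using z' by simp
  have "deriv (partial_theta q) z = 0" by (rule zorder_ge_2_imp_deriv_0[OF holo z'(2,1)])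
  hence "(partial_theta q has_field_derivative 0) (at (- (1 / q\<^sup>2) * u))"
    using holomorphic_derivI[OF holo open_UNIV, of z] unfolding zu by simp
  hence "(H_fun q has_field_derivative q * (0 * (- (1 / q\<^sup>2)))) (at u)"
    unfolding eq
    by (rule DERIV_cmult[OF DERIV_chain2]) (rule DERIV_cmult_Id)
  thus "deriv (H_fun q) u = 0" by (simp add: DERIV_imp_deriv)
qed

text \<open>The combinations \<open>3H - u \<partial>H/\<partial>u\<close> and \<open>2H - u \<partial>H/\<partial>u\<close> eliminate the terms \<open>u\<^sup>3\<close> and \<open>u\<^sup>2\<close>
  and give the two equations below.\<close>

lemma double_zero_core:
  fixes q u \<alpha> \<beta> :: complex
  assumes q: "norm q \<le> 0.31" and u: "norm u \<le> 5 / 4"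
    and \<alpha>: "norm \<alpha> \<le> 0.0065" and \<beta>: "norm \<beta> \<le> 0.0092"
    and A: "u * (2 - u) = q * (3 - q\<^sup>2 * u ^ 4) + \<alpha>"
    and B: "u = q * (2 + u ^ 3 - 2 * (q\<^sup>2 * u ^ 4)) + \<beta>"
  shows "norm u \<le> 0.86"
proof (rule ccontr)
  assume "\<not> ?thesis"
  hence u1: "norm u > 0.86" by simp
  define \<rho> where "\<rho> = norm u"
  have \<rho>: "0.86 < \<rho>" "\<rho> \<le> 1.25" using u u1 by (auto simp: \<rho>_def)
  define v where "v = q\<^sup>2 * u ^ 4"
  have q2: "norm q ^ 2 \<le> 0.0961" using power_mono[OF q norm_ge_zero, of 2] by (simp add: power_divide)
  have v_le: "norm v \<le> 0.0961 * \<rho> ^ 4"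
    unfolding v_def norm_mult norm_power \<rho>_def using q2 by (intro mult_right_mono) auto
  have pm: "\<rho> ^ n \<le> b ^ n" if "\<rho> \<le> b" for n b using \<rho> that by (intro power_mono) auto
  have A_le: "\<rho> * norm (2 - u) \<le> 0.31 * (3 + norm v) + 0.0065"
  proof -
    have "\<rho> * norm (2 - u) = norm (q * (3 - v) + \<alpha>)"
      using arg_cong[OF A, of norm] by (simp add: v_def norm_mult \<rho>_def)
    also have "\<dots> \<le> norm q * norm (3 - v) + norm \<alpha>" by (metis norm_mult norm_triangle_ineq)
    also have "norm q * norm (3 - v) \<le> 0.31 * (3 + norm v)"
      using q norm_triangle_ineq4[of 3 v] by (intro mult_mono) auto
    finally show ?thesis using \<alpha> by simp
  qed
  have B_le: "\<rho> \<le> 0.31 * (norm (2 - 2 * v) + \<rho> ^ 3) + 0.0092"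
  proof -
    have "2 + u ^ 3 - 2 * (q\<^sup>2 * u ^ 4) = (2 - 2 * v) + u ^ 3" by (simp add: v_def)
    hence "\<rho> = norm (q * ((2 - 2 * v) + u ^ 3) + \<beta>)" using B by (metis \<rho>_def)
    also have "\<dots> \<le> norm q * norm ((2 - 2 * v) + u ^ 3) + norm \<beta>" by (metis norm_mult norm_triangle_ineq)
    also have "norm q * norm ((2 - 2 * v) + u ^ 3) \<le> 0.31 * (norm (2 - 2 * v) + \<rho> ^ 3)"
      using q norm_triangle_ineq[of "2 - 2 * v" "u ^ 3"] by (intro mult_mono) (auto simp: norm_power \<rho>_def)
    finally show ?thesis using \<beta> by simp
  qed
  \<comment> \<open>In the first range equation \<open>B\<close> fails by size, in the second
    \<open>A\<close> fails because \<open>|u| |2 - u|\<close> is too large. In the third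
    \<open>A\<close> forces \<open>u\<close> close to the positive axis; this gives \<open>v\<close>
    a positive real part, hence \<open>|2 - 2v| \<le> 2\<close>, and with this \<open>B\<close>
    fails again.\<close>
  consider "\<rho> \<le> 1" | "1 \<le> \<rho>" "\<rho> \<le> 1.12" | "1.12 \<le> \<rho>" by linarith
  thus False
  proof cases
    case 1
    have "norm (2 - 2 * v) \<le> 2 + 2 * (0.0961 * \<rho> ^ 4)"
      using norm_triangle_ineq4[of 2 "2 * v"] v_le by (simp add: norm_mult)
    moreover have "\<rho> \<le> 0.6292 + 0.059582 * a + 0.31 * b"
      if "n \<le> 2 + 2 * (0.0961 * a)" "\<rho> \<le> 0.31 * (n + b) + 0.0092" for n a b
      using that by (simp add: field_simps)
    ultimately have le: "\<rho> \<le> 0.6292 + 0.059582 * \<rho> ^ 4 + 0.31 * \<rho> ^ 3" using B_le by blast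
    have sq: "\<rho>\<^sup>2 \<le> 1.86 * \<rho> - 0.86"
    proof -
      have "0 \<le> (\<rho> - 0.86) * (1 - \<rho>)" using \<rho> 1 by simp
      thus ?thesis by (simp add: power2_eq_square field_simps)
    qed
    have "\<rho> * \<rho>\<^sup>2 \<le> \<rho> * (1.86 * \<rho> - 0.86)" using sq \<rho> by (intro mult_left_mono) auto
    hence c3: "\<rho> ^ 3 \<le> 1.86 * \<rho>\<^sup>2 - 0.86 * \<rho>" by (simp add: power2_eq_square power3_eq_cube algebra_simps)
    have "\<rho> * \<rho> ^ 3 \<le> \<rho> * (1.86 * \<rho>\<^sup>2 - 0.86 * \<rho>)" using c3 \<rho> by (intro mult_left_mono) auto
    hence c4: "\<rho> ^ 4 \<le> 1.86 * \<rho> ^ 3 - 0.86 * \<rho>\<^sup>2"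
      by (simp add: power2_eq_square power3_eq_cube power4_eq_xxxx algebra_simps)
    have False
      if "\<rho> \<le> 0.6292 + 0.059582 * d + 0.31 * c" "b \<le> 1.86 * \<rho> - 0.86" "c \<le> 1.86 * b - 0.86 * \<rho>"
        "d \<le> 1.86 * c - 0.86 * b" for b c d
      using that \<rho> by (simp add: field_simps)
    thus False using le sq c3 c4 by blast
  next
    case 2
    have "\<rho> * (2 - \<rho>) \<le> \<rho> * norm (2 - u)"
      using norm_triangle_ineq2[of 2 u] \<rho> by (intro mult_left_mono) (auto simp: \<rho>_def)
    moreover have "0 \<le> (1.12 - \<rho>) * (\<rho> - 1 + 0.12)" using 2 by simp
    hence "0.9856 \<le> \<rho> * (2 - \<rho>)" by (simp add: algebra_simps)
    moreover have "norm v \<le> 0.0961 * 1.12 ^ 4" using v_le pm[OF 2(2), of 4] by simp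
    ultimately show False using A_le by (simp add: power_divide field_simps)
  next
    case 3
    have v2: "norm v \<le> 0.23463" using v_le pm[OF \<rho>(2), of 4] by (simp add: power_divide)
    define x where "x = Re u"
    define y where "y = Im u"
    have uxy: "u = Complex x y" by (simp add: x_def y_def)
    have r2: "\<rho>\<^sup>2 = x\<^sup>2 + y\<^sup>2" by (simp add: \<rho>_def x_def y_def cmod_power2)
    define R where "R = \<rho>\<^sup>2"
    have R: "1.2544 \<le> R" "R \<le> 1.5625"
      using power_mono[OF 3, of 2] pm[OF \<rho>(2), of 2] by (auto simp: R_def power2_eq_square)
    have n2u: "(norm (2 - u))\<^sup>2 = 4 - 4 * x + R"
      unfolding cmod_power2 R_def r2 by (simp add: uxy power2_eq_square algebra_simps)
    have "\<rho> * norm (2 - u) \<le> 1.00924" using A_le v2 by (simp add: field_simps)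
    hence "(\<rho> * norm (2 - u))\<^sup>2 \<le> 1.00924\<^sup>2" using \<rho> by (intro power_mono) auto
    hence "R * (4 - 4 * x + R) \<le> 1.01857"
      unfolding power_mult_distrib n2u R_def[symmetric] by (simp add: power2_eq_square)
    hence xl: "R * (4 * x) \<ge> R * (4 + R) - 1.01857" by (simp add: algebra_simps)
    have x_lin: "4 * x \<ge> 2.535 + 1.52 * R"
    proof -
      have "0 \<le> (R - 1.2544) * (1.5625 - R)" using R by simp
      hence "R * (2.535 + 1.52 * R) \<le> R * (4 + R) - 1.01857"
        using R by (simp add: field_simps)
      hence "R * (2.535 + 1.52 * R) \<le> R * (4 * x)" using xl by simp
      thus ?thesis by (rule mult_left_le_imp_le) (use R in simp)
    qed
    have x1: "1.11 \<le> x" using x_lin R by simp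
    have x2: "x \<le> 1.25" using complex_Re_le_cmod[of u] \<rho> by (simp add: x_def \<rho>_def)
    have y2: "y\<^sup>2 \<le> 0.06"
    proof -
      have "(0.63375 + 0.38 * R)\<^sup>2 \<le> x\<^sup>2" using x_lin R by (intro power_mono) auto
      hence "y\<^sup>2 \<le> R - (0.63375 + 0.38 * R)\<^sup>2" using r2 by (simp add: R_def)
      moreover have "0 \<le> (R - 1.2544) * (1.5625 - R)" "0 \<le> (1.5625 - R) * (1.5625 - R)" using R by auto
      ultimately show ?thesis using R by (simp add: power2_eq_square algebra_simps)
    qed
    have y1: "\<bar>y\<bar> \<le> 0.245"
      by (rule power2_le_imp_le) (use y2 in \<open>simp_all add: power2_eq_square\<close>)
    \<comment> \<open>Here \<open>v = g^2\<close>, and \<open>A\<close> times \<open>u^2\<close>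
      reads \<open>3 * g = Z + \<delta>\<close> with small \<open>\<delta>\<close>. As
      \<open>Z\<close> is close to the positive axis, \<open>g\<close> makes an angle below 45
      degrees with it, and its square has positive real part.\<close>
    define g where "g = q * u\<^sup>2"
    have vg: "v = g\<^sup>2" by (simp add: v_def g_def power_mult_distrib flip: power_mult)
    define Z where "Z = u\<^sup>2 * (u * (2 - u))"
    define \<delta> where "\<delta> = 3 * g - Z"
    have \<delta>: "norm \<delta> \<le> 0.124"
    proof -
      have "\<delta> = u\<^sup>2 * (q * v - \<alpha>)" unfolding \<delta>_def Z_def A by (simp add: g_def v_def algebra_simps)
      hence "norm \<delta> = R * norm (q * v - \<alpha>)" by (simp add: norm_mult norm_power R_def \<rho>_def)
      also have "norm (q * v - \<alpha>) \<le> norm q * norm v + norm \<alpha>" by (metis norm_mult norm_triangle_ineq4)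
      hence "norm (q * v - \<alpha>) \<le> 0.31 * 0.23463 + 0.0065"
        using mult_mono[OF q v2] \<alpha> by simp
      hence "R * norm (q * v - \<alpha>) \<le> 1.5625 * (0.31 * 0.23463 + 0.0065)" using R by (intro mult_mono) auto
      finally show ?thesis by simp
    qed
    define S where "S = 2 * x - x\<^sup>2 + y\<^sup>2"
    define W where "W = x\<^sup>2 - y\<^sup>2"
    have ZRe: "Re Z = W * S + 4 * x * y\<^sup>2 * (x - 1)" and ZIm: "Im Z = 2 * y * (x * S - (x - 1) * W)"
      unfolding Z_def uxy S_def W_def by (simp_all add: power2_eq_square algebra_simps)
    have xx: "1.2321 \<le> x\<^sup>2" "x\<^sup>2 \<le> 1.5625"
      using power_mono[OF x1, of 2] power_mono[OF x2, of 2] x1 by (auto simp: power2_eq_square)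
    have S: "0.9375 \<le> S" "S \<le> 1.06"
    proof -
      have "0 \<le> (1.25 - x) * (x - 0.75)" using x1 x2 by simp
      hence "0.9375 \<le> 2 * x - x\<^sup>2" by (simp add: power2_eq_square field_simps)
      thus "0.9375 \<le> S" using zero_le_power2[of y] unfolding S_def by linarith
      have "0 \<le> (x - 1)\<^sup>2" by simp
      thus "S \<le> 1.06" using y2 unfolding S_def by (simp add: power2_eq_square algebra_simps)
    qed
    have W: "1.1721 \<le> W" using xx y2 by (simp add: W_def)
    have "1.1721 * 0.9375 \<le> W * S" using W S by (intro mult_mono) auto
    hence "1.0988 \<le> W * S" by simp
    moreover have "0 \<le> 4 * x * y\<^sup>2 * (x - 1)" using x1 by (intro mult_nonneg_nonneg) auto
    ultimately have ReZ: "Re Z \<ge> 1.0988" unfolding ZRe by linarith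
    have "\<bar>Im Z\<bar> \<le> 0.6"
    proof -
      have "x * S \<le> 1.25 * 1.06" using x1 x2 S by (intro mult_mono) auto
      moreover have "0.11 * 1.1721 \<le> (x - 1) * W" using x1 W by (intro mult_mono) auto
      moreover have "1.11 * 0.9375 \<le> x * S" using x1 S by (intro mult_mono) auto
      moreover have "(x - 1) * W \<le> 0.25 * 1.5625"
      proof (rule mult_mono)
        show "W \<le> 1.5625" using xx zero_le_power2[of y] unfolding W_def by linarith
      qed (use x1 x2 W in auto)
      ultimately have "\<bar>x * S - (x - 1) * W\<bar> \<le> 1.2" by (simp add: abs_le_iff)
      hence "\<bar>y\<bar> * \<bar>x * S - (x - 1) * W\<bar> \<le> 0.245 * 1.2" using y1 by (intro mult_mono) auto
      thus ?thesis unfolding ZIm by (simp add: abs_mult)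
    qed
    moreover have "\<bar>Re \<delta>\<bar> \<le> 0.124" "\<bar>Im \<delta>\<bar> \<le> 0.124"
      using \<delta> abs_Re_le_cmod[of \<delta>] abs_Im_le_cmod[of \<delta>] by linarith+
    moreover have "3 * Re g = Re Z + Re \<delta>" "3 * Im g = Im Z + Im \<delta>" by (simp_all add: \<delta>_def)
    ultimately have gs: "Re g \<ge> 0.3249" "\<bar>Im g\<bar> \<le> 0.2414" using ReZ by (simp_all add: abs_le_iff)
    have "0.3249\<^sup>2 \<le> (Re g)\<^sup>2" using gs by (intro power_mono) auto
    moreover have "(Im g)\<^sup>2 \<le> 0.2414\<^sup>2" using power_mono[OF gs(2) abs_ge_zero, of 2] by simp
    ultimately have Rev: "Re v \<ge> 0.047" unfolding vg by (simp add: Re_power2 power2_eq_square)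
    have "(norm (2 - 2 * v))\<^sup>2 = 4 - 8 * Re v + 4 * (norm v)\<^sup>2"
      unfolding cmod_power2 by (simp add: power2_eq_square algebra_simps)
    also have "\<dots> \<le> 2\<^sup>2" using Rev power_mono[OF v2 norm_ge_zero, of 2] by (simp add: power2_eq_square)
    finally have "norm (2 - 2 * v) \<le> 2" by (rule power2_le_imp_le) simp
    hence le: "\<rho> \<le> 0.6292 + 0.31 * \<rho> ^ 3" using B_le by (simp add: field_simps)
    have sq: "\<rho>\<^sup>2 \<le> 2.37 * \<rho> - 1.4"
    proof -
      have "0 \<le> (\<rho> - 1.12) * (1.25 - \<rho>)" using \<rho> 3 by simp
      thus ?thesis by (simp add: power2_eq_square field_simps)
    qed
    have "\<rho> * \<rho>\<^sup>2 \<le> \<rho> * (2.37 * \<rho> - 1.4)" using sq \<rho> by (intro mult_left_mono) auto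
    hence "\<rho> ^ 3 \<le> 2.37 * \<rho>\<^sup>2 - 1.4 * \<rho>" by (simp add: power2_eq_square power3_eq_cube algebra_simps)
    thus False using le sq \<rho> 3 by simp
  qed
qed

text \<open>At \<open>|u| = 0.9\<close> the triangle inequality alone would give about 0.42. But
  points of this disk with modulus near 0.9 are close to the positive axis; there
  \<open>Re (q^2) \<ge> 0\<close> keeps \<open>Re (q^2 * u)\<close> from being very negative, and
  \<open>N\<close> stays near 1.\<close>

lemma critical_map_core:
  fixes q u :: complex
  assumes q: "norm q \<le> 0.31" "0 \<le> Re (q\<^sup>2)" and u: "norm (u - 1 / 2) \<le> 0.4" and e: "norm e \<le> 0.002"
  shows "norm (3 / 2 * (q * u\<^sup>2) - 2 * (q ^ 3 * u ^ 3) + e) \<le> 0.4"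
proof -
  define N where "N = norm (1 - 4 / 3 * (q\<^sup>2 * u))"
  have q2: "norm (q\<^sup>2) \<le> 0.0961"
    using power_mono[OF q(1) norm_ge_zero, of 2] by (simp add: norm_power power_divide)
  have eq: "3 / 2 * (q * u\<^sup>2) - 2 * (q ^ 3 * u ^ 3) = 3 / 2 * (q * u\<^sup>2) * (1 - 4 / 3 * (q\<^sup>2 * u))"
    by (simp add: algebra_simps power2_eq_square power3_eq_cube)
  have "norm (3 / 2 * (q * u\<^sup>2) - 2 * (q ^ 3 * u ^ 3)) = 3 / 2 * norm q * (norm u)\<^sup>2 * N"
    unfolding eq norm_mult norm_power N_def by simp
  also have "\<dots> \<le> 3 / 2 * 0.31 * (norm u)\<^sup>2 * N"
    using q(1) by (intro mult_right_mono) (auto simp: N_def)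
  finally have le: "norm (3 / 2 * (q * u\<^sup>2) - 2 * (q ^ 3 * u ^ 3)) \<le> 0.465 * ((norm u)\<^sup>2 * N)" by simp
  have u9: "norm u \<le> 0.9" using norm_triangle_ineq[of "u - 1 / 2" "1 / 2"] u by simp
  have qu: "norm (q\<^sup>2 * u) \<le> 0.0961 * norm u" unfolding norm_mult using q2 by (intro mult_right_mono) auto
  have "(norm u)\<^sup>2 * N \<le> 0.8411"
  proof (cases "(norm u)\<^sup>2 \<le> 0.75")
    case True
    have u87: "norm u \<le> 0.8661"
    proof (rule power2_le_imp_le)
      show "(norm u)\<^sup>2 \<le> 0.8661\<^sup>2" using True by (simp add: power2_eq_square)
    qed simp
    have "N \<le> 1 + 4 / 3 * norm (q\<^sup>2 * u)"
      unfolding N_def using norm_triangle_ineq4[of 1 "4 / 3 * (q\<^sup>2 * u)"] by (simp add: norm_mult)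
    also have "\<dots> \<le> 1.111" using qu u87 by simp
    finally have "(norm u)\<^sup>2 * N \<le> 0.75 * 1.111" using True by (intro mult_mono) (auto simp: N_def)
    thus ?thesis by simp
  next
    case False
    have d: "(norm (u - 1 / 2))\<^sup>2 \<le> 0.16" using power_mono[OF u norm_ge_zero, of 2] by (simp add: power2_eq_square)
    have d1: "(norm (u - 1 / 2))\<^sup>2 = (norm u)\<^sup>2 - Re u + 1 / 4"
      unfolding cmod_power2 by (simp add: power2_eq_square algebra_simps)
    have Reu: "Re u \<ge> 0.84" using d d1 False by simp
    have "(Re u - 1 / 2)\<^sup>2 + (Im u)\<^sup>2 \<le> 0.16" using d unfolding cmod_power2 by simp
    moreover have "0.34\<^sup>2 \<le> (Re u - 1 / 2)\<^sup>2" using Reu by (intro power_mono) auto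
    ultimately have "\<bar>Im u\<bar>\<^sup>2 \<le> 0.211\<^sup>2" by (simp add: power2_eq_square)
    hence Imu: "\<bar>Im u\<bar> \<le> 0.211" by (rule power2_le_imp_le) simp
    have "Im (q\<^sup>2) * Im u \<le> \<bar>Im (q\<^sup>2)\<bar> * \<bar>Im u\<bar>" by (metis abs_ge_self abs_mult)
    also have "\<dots> \<le> 0.0961 * 0.211"
      using Imu abs_Im_le_cmod[of "q\<^sup>2"] q2 by (intro mult_mono) auto
    finally have I: "Im (q\<^sup>2) * Im u \<le> 0.02028" by simp
    have "0 \<le> Re (q\<^sup>2) * Re u" using q(2) Reu by (intro mult_nonneg_nonneg) auto
    hence Re: "Re (q\<^sup>2 * u) \<ge> - 0.02028" using I unfolding times_complex.sel by simp
    have "N\<^sup>2 = 1 - 8 / 3 * Re (q\<^sup>2 * u) + 16 / 9 * (norm (q\<^sup>2 * u))\<^sup>2"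
      unfolding N_def cmod_power2 by (simp add: power2_eq_square field_simps)
    also have "\<dots> \<le> 1.0335\<^sup>2"
    proof -
      have "norm (q\<^sup>2 * u) \<le> 0.0865" using qu u9 by simp
      hence "(norm (q\<^sup>2 * u))\<^sup>2 \<le> 0.0865\<^sup>2" by (intro power_mono) auto
      moreover have "1 - 8 / 3 * a + 16 / 9 * n \<le> 1.0335\<^sup>2" if "a \<ge> - 0.02028" "n \<le> 0.0865\<^sup>2" for a n :: real
        using that by (simp add: power2_eq_square field_simps)
      ultimately show ?thesis using Re by blast
    qed
    finally have "N \<le> 1.0335" by (rule power2_le_imp_le) simp
    moreover have "(norm u)\<^sup>2 \<le> 0.81" using power_mono[OF u9 norm_ge_zero, of 2] by (simp add: power2_eq_square)
    ultimately have "(norm u)\<^sup>2 * N \<le> 0.81 * 1.0335" by (intro mult_mono) (auto simp: N_def)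
    thus ?thesis by simp
  qed
  hence "norm (3 / 2 * (q * u\<^sup>2) - 2 * (q ^ 3 * u ^ 3)) \<le> 0.3912" using le by simp
  thus ?thesis using norm_triangle_ineq[of "3 / 2 * (q * u\<^sup>2) - 2 * (q ^ 3 * u ^ 3)" e] e by simp
qed

section \<open>Double zeros and critical values\<close>

lemma norm_deriv_le:
  fixes f :: "complex \<Rightarrow> complex"
  assumes "f holomorphic_on A" "cball z r \<subseteq> A" "\<And>w. norm (w - z) = r \<Longrightarrow> norm (f w) \<le> B" "0 < r"
  shows "norm (deriv f z) \<le> B / r"
proof -
  have "norm ((deriv ^^ 1) f z) \<le> fact 1 * B / r ^ 1"
  proof (rule Cauchy_inequality)
    show "f holomorphic_on ball z r" using assms(2) by (intro holomorphic_on_subset[OF assms(1)]) auto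
    show "continuous_on (cball z r) f"
      by (rule holomorphic_on_imp_continuous_on[OF holomorphic_on_subset[OF assms(1,2)]])
  qed (use assms(3,4) in \<open>auto simp: norm_minus_commute\<close>)
  thus ?thesis by simp
qed

section \<open>The tail of \<open>H_fun\<close> and the location of double zeros\<close>

definition H_tail :: "complex \<Rightarrow> complex \<Rightarrow> complex" where
  "H_tail q u = q ^ 10 * u ^ 6 * partial_theta q (- (q ^ 4 * u))"

lemma H_tail_holomorphic:
  assumes "norm q < 1"
  shows "H_tail q holomorphic_on A"
  unfolding H_tail_def using assms by (intro holomorphic_intros) auto

lemma H_fun_eq_tail:
  assumes "norm q < 1"
  shows "H_fun q u = q - u + u\<^sup>2 - q * u ^ 3 + q ^ 3 * u ^ 4 - q ^ 6 * u ^ 5 + H_tail q u"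
proof -
  have th: "partial_theta q (- u) = 1 - q * u + q ^ 3 * u ^ 2 - q ^ 6 * u ^ 3 + q ^ 10 * u ^ 4 * partial_theta q (- (q ^ 4 * u))"
    using theta_expand(2)[OF assms, of "- u"] by (simp add: power3_eq_cube power4_eq_xxxx power2_eq_square mult_ac)
  show ?thesis unfolding H_fun_def H_tail_def th by algebra
qed

lemma H_tail_bound:
  assumes q: "norm q \<le> 0.31" and u: "norm u \<le> R" "R \<le> 2"
  shows "norm (H_tail q u) \<le> 0.00000825 * R ^ 6"
proof -
  note qp = norm_q_power_bounds[OF q]
  have R0: "0 \<le> R" using u norm_ge_zero order_trans by blast
  have n: "norm (q * (- (q ^ 4 * u))) = norm q ^ 5 * norm u"
    by (simp add: norm_mult norm_power power_numeral_reduce)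
  have le: "norm q ^ 5 * norm u \<le> 0.0028630 * 2" using qp u by (intro mult_mono) auto
  have "norm (partial_theta q (- (q ^ 4 * u))) \<le> 1 / (1 - norm q ^ 5 * norm u)"
    using theta_norm_le[of q "- (q ^ 4 * u)"] q le unfolding n by simp
  also have "\<dots> \<le> 1.006" using le by (simp add: field_simps)
  finally have t: "norm (partial_theta q (- (q ^ 4 * u))) \<le> 1.006" .
  have "norm (H_tail q u) = norm q ^ 10 * norm u ^ 6 * norm (partial_theta q (- (q ^ 4 * u)))"
    by (simp add: H_tail_def norm_mult norm_power)
  also have "\<dots> \<le> 0.0000081963 * R ^ 6 * 1.006"
    using qp u t R0 by (intro mult_mono power_mono) auto
  also have "\<dots> \<le> 0.00000825 * R ^ 6" using R0 by simp
  finally show ?thesis .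
qed

lemma H_tail_deriv_bound:
  assumes q: "norm q \<le> 0.31" and u: "norm u \<le> 5 / 4"
  shows "norm (deriv (H_tail q) u) \<le> 0.000704"
proof -
  have q1: "norm q < 1" using q by simp
  have "norm (deriv (H_tail q) u) \<le> 0.000528 / (3 / 4)"
  \<comment> \<open>The radius 3/4 keeps the circle inside \<open>|w| \<le> 2\<close>, where
    \<open>H_tail_bound\<close> gives \<open>0.00000825 * 2^6 = 0.000528\<close>.\<close>
  proof (rule norm_deriv_le[OF H_tail_holomorphic[OF q1] subset_UNIV])
    fix w assume "norm (w - u) = 3 / 4"
    hence "norm w \<le> 2" using u norm_triangle_ineq[of "w - u" u] by simp
    from H_tail_bound[OF q this] show "norm (H_tail q w) \<le> 0.000528" by simp
  qed simp
  thus ?thesis by simp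
qed

lemma H_tail_deriv_Lipschitz:
  assumes q: "norm q \<le> 0.31" and u: "norm u \<le> 0.9" "norm u' \<le> 0.9"
  shows "norm (deriv (H_tail q) u - deriv (H_tail q) u') \<le> 0.00202 * norm (u - u')"
proof (rule field_differentiable_bound)
  have q1: "norm q < 1" using q by simp
  have h: "deriv (H_tail q) holomorphic_on UNIV"
    by (intro holomorphic_deriv H_tail_holomorphic q1) auto
  show "(deriv (H_tail q) has_field_derivative deriv (deriv (H_tail q)) z) (at z within cball 0 0.9)" for z
    using holomorphic_derivI[OF h open_UNIV, of z] DERIV_subset by blast
  fix z :: complex assume z: "z \<in> cball 0 0.9"
  have "norm (deriv (deriv (H_tail q)) z) \<le> 0.000704 / 0.35"
  proof (rule norm_deriv_le[OF h subset_UNIV])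
    fix w assume "norm (w - z) = 0.35"
    hence "norm w \<le> 5 / 4" using z norm_triangle_ineq[of "w - z" z] by simp
    thus "norm (deriv (H_tail q) w) \<le> 0.000704" by (rule H_tail_deriv_bound[OF q])
  qed simp
  thus "norm (deriv (deriv (H_tail q)) z) \<le> 0.00202" by simp
qed (use u in auto)

lemma H_fun_has_deriv:
  assumes "norm q < 1"
  shows "(H_fun q has_field_derivative
    (- 1 + 2 * u - 3 * q * u\<^sup>2 + 4 * q ^ 3 * u ^ 3 - 5 * q ^ 6 * u ^ 4 + deriv (H_tail q) u)) (at u)"
proof -
  have t: "(H_tail q has_field_derivative deriv (H_tail q) u) (at u)"
    using holomorphic_derivI[OF H_tail_holomorphic[OF assms] open_UNIV, of u] by simp
  have eq: "H_fun q = (\<lambda>u. q - u + u\<^sup>2 - q * u ^ 3 + q ^ 3 * u ^ 4 - q ^ 6 * u ^ 5 + H_tail q u)"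
    using H_fun_eq_tail[OF assms] by (rule ext)
  show ?thesis unfolding eq
    by (rule derivative_eq_intros t refl | simp)+
qed

lemmas H_fun_deriv = DERIV_imp_deriv[OF H_fun_has_deriv]

text \<open>Once \<open>double_zero_core\<close> has reduced 5/4 to 0.86, the derivative equation
  solved for \<open>u - 1/2\<close> places \<open>u\<close> in the disk on which
  \<open>crit_map\<close> is a contraction.\<close>

lemma double_zero_small:
  assumes q: "norm q \<le> 0.31" and u: "norm u < 5 / 4" and H: "H_fun q u = 0" "deriv (H_fun q) u = 0"
  shows "norm (u - 1 / 2) \<le> 0.4"
proof -
  have q1: "norm q < 1" using q by simp
  note qp = norm_q_power_bounds[OF q]
  define r where "r = H_tail q u"
  define r' where "r' = deriv (H_tail q) u"
  have u5: "norm u \<le> 5 / 4" using u by simp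
  have r: "norm r \<le> 0.0000315" unfolding r_def using H_tail_bound[OF q u5] by (simp add: power_divide)
  have r': "norm r' \<le> 0.000704" unfolding r'_def by (rule H_tail_deriv_bound[OF q u5])
  have E1: "q - u + u\<^sup>2 - q * u ^ 3 + q ^ 3 * u ^ 4 - q ^ 6 * u ^ 5 + r = 0"
    using H(1) H_fun_eq_tail[OF q1, of u] by (simp add: r_def)
  have E2: "- 1 + 2 * u - 3 * q * u\<^sup>2 + 4 * q ^ 3 * u ^ 3 - 5 * q ^ 6 * u ^ 4 + r' = 0"
    using H(2) H_fun_deriv[OF q1, of u] by (simp add: r'_def)
  define \<alpha> where "\<alpha> = 2 * (q ^ 6 * u ^ 5) + (3 * r - u * r')"
  define \<beta> where "\<beta> = 3 * (q ^ 6 * u ^ 5) + (2 * r - u * r')"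
  have q6: "norm (q ^ 6 * u ^ 5) \<le> 0.00271"
  proof -
    have "norm (q ^ 6 * u ^ 5) \<le> 0.00088751 * (5 / 4) ^ 5"
      unfolding norm_mult norm_power using qp u5 by (intro mult_mono power_mono) auto
    thus ?thesis by (simp add: power_divide)
  qed
  have ur: "norm (u * r') \<le> 0.00088" using mult_mono[OF u5 r'] by (simp add: norm_mult)
  have A: "u * (2 - u) = q * (3 - q\<^sup>2 * u ^ 4) + \<alpha>"
    using E1 E2 unfolding \<alpha>_def by algebra
  have B: "u = q * (2 + u ^ 3 - 2 * (q\<^sup>2 * u ^ 4)) + \<beta>"
    using E1 E2 unfolding \<beta>_def by algebra
  have "norm \<alpha> \<le> 2 * norm (q ^ 6 * u ^ 5) + (3 * norm r + norm (u * r'))"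
    unfolding \<alpha>_def using norm_triangle_ineq[of "2 * (q ^ 6 * u ^ 5)" "3 * r - u * r'"] norm_triangle_ineq4[of "3 * r" "u * r'"]
    by (simp add: norm_mult)
  hence \<alpha>: "norm \<alpha> \<le> 0.0065" using q6 r ur by simp
  have "norm \<beta> \<le> 3 * norm (q ^ 6 * u ^ 5) + (2 * norm r + norm (u * r'))"
    unfolding \<beta>_def using norm_triangle_ineq[of "3 * (q ^ 6 * u ^ 5)" "2 * r - u * r'"] norm_triangle_ineq4[of "2 * r" "u * r'"]
    by (simp add: norm_mult)
  hence \<beta>: "norm \<beta> \<le> 0.0092" using q6 r ur by simp
  have u86: "norm u \<le> 0.86" by (rule double_zero_core[OF q u5 \<alpha> \<beta> A B])
  have eq: "2 * (u - 1 / 2) = 3 * (q * u\<^sup>2) * (1 - 4 / 3 * (q\<^sup>2 * u)) + (5 * (q ^ 6 * u ^ 4) - r')"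
    using E2 by (simp add: algebra_simps power2_eq_square power3_eq_cube)
  have b1: "norm (q * u\<^sup>2) \<le> 0.31 * 0.86\<^sup>2" unfolding norm_mult norm_power using q u86 by (intro mult_mono power_mono) auto
  have b2: "norm (q\<^sup>2 * u) \<le> 0.0961 * 0.86" unfolding norm_mult norm_power using qp u86 by (intro mult_mono power_mono) auto
  have b3: "norm (q ^ 6 * u ^ 4) \<le> 0.00088751 * 0.86 ^ 4" unfolding norm_mult norm_power using qp u86 by (intro mult_mono power_mono) auto
  have b4: "norm (1 - 4 / 3 * (q\<^sup>2 * u)) \<le> 1.1102"
    using norm_triangle_ineq4[of 1 "4 / 3 * (q\<^sup>2 * u)"] b2 by (simp add: norm_mult)
  have "2 * norm (u - 1 / 2) = norm (2 * (u - 1 / 2))" unfolding norm_mult by simp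
  also have "\<dots> \<le> 3 * (norm (q * u\<^sup>2) * norm (1 - 4 / 3 * (q\<^sup>2 * u))) + (5 * norm (q ^ 6 * u ^ 4) + norm r')"
    unfolding eq
    using norm_triangle_ineq[of "3 * (q * u\<^sup>2) * (1 - 4 / 3 * (q\<^sup>2 * u))" "5 * (q ^ 6 * u ^ 4) - r'"]
      norm_triangle_ineq4[of "5 * (q ^ 6 * u ^ 4)" r'] by (simp add: norm_mult)
  also have "norm (q * u\<^sup>2) * norm (1 - 4 / 3 * (q\<^sup>2 * u)) \<le> 0.31 * 0.86\<^sup>2 * 1.1102"
    using b1 b4 by (intro mult_mono) auto
  finally show ?thesis using b3 r' by (simp add: power_divide)
qed

text \<open>A Newton step for the derivative with the slope frozen at 2, its value at
  \<open>q = 0\<close>, where the map is constantly 1/2. The fixed points are the critical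
  points.\<close>

definition crit_map :: "complex \<Rightarrow> complex \<Rightarrow> complex" where
  "crit_map q u = u - deriv (H_fun q) u / 2"

lemma crit_map_eq:
  assumes "norm q < 1"
  shows "crit_map q u = 1 / 2 + 3 / 2 * (q * u\<^sup>2) - 2 * (q ^ 3 * u ^ 3) + 5 / 2 * (q ^ 6 * u ^ 4) - deriv (H_tail q) u / 2"
  unfolding crit_map_def H_fun_deriv[OF assms] by (simp add: field_simps)

lemma norm_le_of_near_half: "norm (u - 1 / 2 :: complex) \<le> 0.4 \<Longrightarrow> norm u \<le> 0.9"
  using norm_triangle_ineq[of "u - 1 / 2" "1 / 2"] by simp

lemma crit_map_maps:
  assumes q: "norm q \<le> 0.31" "0 \<le> Re (q\<^sup>2)" and u: "norm (u - 1 / 2) \<le> 0.4"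
  shows "norm (crit_map q u - 1 / 2) \<le> 0.4"
proof -
  have q1: "norm q < 1" using q by simp
  have u9: "norm u \<le> 0.9" by (rule norm_le_of_near_half[OF u])
  define e where "e = 5 / 2 * (q ^ 6 * u ^ 4) - deriv (H_tail q) u / 2"
  have b3: "norm (q ^ 6 * u ^ 4) \<le> 0.00088751 * 0.9 ^ 4"
    unfolding norm_mult norm_power using norm_q_power_bounds[OF q(1)] u9 by (intro mult_mono power_mono) auto
  have "norm e \<le> 5 / 2 * norm (q ^ 6 * u ^ 4) + norm (deriv (H_tail q) u) / 2"
    unfolding e_def using norm_triangle_ineq4[of "5 / 2 * (q ^ 6 * u ^ 4)" "deriv (H_tail q) u / 2"]
    by (simp add: norm_mult norm_divide)
  hence e: "norm e \<le> 0.002" using b3 H_tail_deriv_bound[OF q(1), of u] u9 by (simp add: power_divide)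
  have "crit_map q u - 1 / 2 = 3 / 2 * (q * u\<^sup>2) - 2 * (q ^ 3 * u ^ 3) + e"
    unfolding crit_map_eq[OF q1] e_def by simp
  thus ?thesis using critical_map_core[OF q u e] by simp
qed

lemma norm_power_diff_le:
  fixes a b :: complex
  assumes "norm a \<le> R" "norm b \<le> R"
  shows "norm (a ^ n - b ^ n) \<le> real n * R ^ (n - 1) * norm (a - b)"
proof (rule field_differentiable_bound[of "cball 0 R" "\<lambda>z. z ^ n" "\<lambda>z. of_nat n * z ^ (n - 1)"])
  show "((\<lambda>z. z ^ n) has_field_derivative of_nat n * z ^ (n - 1)) (at z within cball 0 R)" for z :: complex
    by (auto intro!: derivative_eq_intros)
  show "norm (of_nat n * z ^ (n - 1)) \<le> real n * R ^ (n - 1)" if "z \<in> cball 0 R" for z :: complex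
    unfolding norm_mult norm_power norm_of_nat using that by (intro mult_left_mono power_mono) auto
qed (use assms in auto)

text \<open>The Lipschitz constants of the four terms depending on \<open>u\<close> add up to about
  0.9893, of which the quadratic term alone contributes
  \<open>3 * 0.31 * 0.9 = 0.837\<close>.\<close>

lemma crit_map_contraction:
  assumes q: "norm q \<le> 0.31" and u: "norm (u - 1 / 2) \<le> 0.4" "norm (u' - 1 / 2) \<le> 0.4"
  shows "norm (crit_map q u - crit_map q u') \<le> 0.99 * norm (u - u')"
proof -
  have q1: "norm q < 1" using q by simp
  note qp = norm_q_power_bounds[OF q]
  have u9: "norm u \<le> 0.9" "norm u' \<le> 0.9" using norm_le_of_near_half[OF u(1)] norm_le_of_near_half[OF u(2)] .
  define d where "d = norm (u - u')"
  have pw: "norm (c * (u ^ n - u' ^ n)) \<le> C * (real n * 0.9 ^ (n - 1) * d)" if "norm c \<le> C" for c C n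
    unfolding norm_mult d_def
    by (intro mult_mono norm_power_diff_le u9 that order_trans[OF norm_ge_zero that]) auto
  define a where "a = 3 / 2 * (q * (u ^ 2 - u' ^ 2))"
  define b where "b = 2 * (q ^ 3 * (u ^ 3 - u' ^ 3))"
  define c where "c = 5 / 2 * (q ^ 6 * (u ^ 4 - u' ^ 4))"
  define e where "e = (deriv (H_tail q) u - deriv (H_tail q) u') / 2"
  have eq: "crit_map q u - crit_map q u' = a - b + c - e"
    unfolding crit_map_eq[OF q1] a_def b_def c_def e_def by (simp add: field_simps)
  have "norm a = 3 / 2 * norm (q * (u ^ 2 - u' ^ 2))" "norm b = 2 * norm (q ^ 3 * (u ^ 3 - u' ^ 3))"
      "norm c = 5 / 2 * norm (q ^ 6 * (u ^ 4 - u' ^ 4))"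
    by (simp_all add: a_def b_def c_def norm_mult)
  hence "norm a \<le> 3 / 2 * (0.31 * (real 2 * 0.9 ^ (2 - 1) * d))"
      "norm b \<le> 2 * (0.029791 * (real 3 * 0.9 ^ (3 - 1) * d))"
      "norm c \<le> 5 / 2 * (0.00088751 * (real 4 * 0.9 ^ (4 - 1) * d))"
    using pw[of q "0.31" 2] pw[of "q ^ 3" "0.029791" 3] pw[of "q ^ 6" "0.00088751" 4] q qp
    by (simp_all add: norm_power power_divide)
  moreover have "norm e \<le> 0.00101 * d"
    using H_tail_deriv_Lipschitz[OF q u9] by (simp add: e_def norm_divide d_def)
  moreover have "norm (a - b + c - e) \<le> norm a + norm b + norm c + norm e"
    using norm_triangle_ineq4[of "a - b + c" e] norm_triangle_ineq[of "a - b" c] norm_triangle_ineq4[of a b]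
    by linarith
  moreover have "0 \<le> d" by (simp add: d_def)
  ultimately show ?thesis unfolding eq d_def[symmetric] by (simp add: power_divide)
qed

lemma crit_point_ex1:
  assumes q: "norm q \<le> 0.31" "0 \<le> Re (q\<^sup>2)"
  shows "\<exists>!u. norm (u - 1 / 2) \<le> 0.4 \<and> deriv (H_fun q) u = 0"
proof -
  have "\<exists>!u\<in>cball (1 / 2) 0.4. crit_map q u = u"
  proof (rule Banach_fix[of _ "0.99"])
    show "complete (cball (1 / 2 :: complex) 0.4)" by (intro compact_imp_complete) auto
    show "crit_map q ` cball (1 / 2) 0.4 \<subseteq> cball (1 / 2) 0.4"
      using crit_map_maps[OF q] by (auto simp: dist_norm norm_minus_commute)
    show "dist (crit_map q u) (crit_map q u') \<le> 0.99 * dist u u'"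
      if "u \<in> cball (1 / 2) 0.4" "u' \<in> cball (1 / 2) 0.4" for u u'
      using crit_map_contraction[OF q(1), of u u'] that by (simp add: dist_norm norm_minus_commute)
  qed auto
  moreover have "crit_map q u = u \<longleftrightarrow> deriv (H_fun q) u = 0" for u by (simp add: crit_map_def)
  moreover have "u \<in> cball (1 / 2) 0.4 \<longleftrightarrow> norm (u - 1 / 2) \<le> 0.4" for u :: complex
    by (simp add: dist_norm norm_minus_commute)
  ultimately show ?thesis by (simp only:)
qed

definition crit_point :: "complex \<Rightarrow> complex" where
  "crit_point q = (THE u. norm (u - 1 / 2) \<le> 0.4 \<and> deriv (H_fun q) u = 0)"

lemma crit_point:
  assumes "norm q \<le> 0.31" "0 \<le> Re (q\<^sup>2)"
  shows "norm (crit_point q - 1 / 2) \<le> 0.4" "deriv (H_fun q) (crit_point q) = 0"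
  using theI'[OF crit_point_ex1[OF assms]] by (auto simp: crit_point_def)

lemma crit_point_eqI:
  assumes "norm q \<le> 0.31" "0 \<le> Re (q\<^sup>2)" "norm (u - 1 / 2) \<le> 0.4" "deriv (H_fun q) u = 0"
  shows "crit_point q = u"
  unfolding crit_point_def by (rule the1_equality[OF crit_point_ex1[OF assms(1,2)]]) (use assms in auto)

text \<open>For a contraction with constant 0.99, the distance to the fixed point is at most 100
  times the displacement, and the displacement is half the derivative.\<close>

lemma dist_crit_point_le:
  assumes q: "norm q \<le> 0.31" "0 \<le> Re (q\<^sup>2)" and u: "norm (u - 1 / 2) \<le> 0.4"
  shows "norm (u - crit_point q) \<le> 50 * norm (deriv (H_fun q) u)"
proof -
  note c = crit_point[OF q]
  have "crit_map q (crit_point q) = crit_point q" by (simp add: crit_map_def c)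
  moreover have "crit_map q u = u - deriv (H_fun q) u / 2" by (simp add: crit_map_def)
  ultimately have "u - crit_point q = (crit_map q u - crit_map q (crit_point q)) + deriv (H_fun q) u / 2" by simp
  also have "norm \<dots> \<le> 0.99 * norm (u - crit_point q) + norm (deriv (H_fun q) u) / 2"
    using norm_triangle_ineq[of "crit_map q u - crit_map q (crit_point q)" "deriv (H_fun q) u / 2"]
      crit_map_contraction[OF q(1) u c(1)] by (simp add: norm_divide)
  finally show ?thesis by simp
qed

text \<open>The derivative is twice the displacement of \<open>crit_map\<close>, hence at most
  \<open>2 * 1.99\<close> times the distance to the critical point. The mean value bound along the
  segment makes the change of value quadratic.\<close>

lemma H_fun_near_crit_point:
  assumes q: "norm q \<le> 0.31" "0 \<le> Re (q\<^sup>2)" and u: "norm (u - 1 / 2) \<le> 0.4"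
  shows "norm (H_fun q u - H_fun q (crit_point q)) \<le> 4 * (norm (u - crit_point q))\<^sup>2"
proof -
  note c = crit_point[OF q]
  have q1: "norm q < 1" using q by simp
  have "norm (H_fun q u - H_fun q (crit_point q)) \<le> (4 * norm (u - crit_point q)) * norm (u - crit_point q)"
  proof (rule field_differentiable_bound)
    show "convex (closed_segment (crit_point q) u)" by (rule convex_closed_segment)
    show "(H_fun q has_field_derivative deriv (H_fun q) z) (at z within closed_segment (crit_point q) u)" for z
      using holomorphic_derivI[OF H_fun_holomorphic[OF q1] open_UNIV, of z] DERIV_subset by blast
    fix z assume z: "z \<in> closed_segment (crit_point q) u"
    have "closed_segment (crit_point q) u \<subseteq> cball (1 / 2) 0.4"
      using c u by (intro closed_segment_subset) (auto simp: dist_norm norm_minus_commute)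
    hence z4: "norm (z - 1 / 2) \<le> 0.4" using z by (auto simp: dist_norm norm_minus_commute)
    have "deriv (H_fun q) z = 2 * ((z - crit_point q) - (crit_map q z - crit_map q (crit_point q)))"
      by (simp add: crit_map_def c(2))
    also have "norm \<dots> \<le> 2 * (norm (z - crit_point q) + 0.99 * norm (z - crit_point q))"
      using norm_triangle_ineq4[of "z - crit_point q" "crit_map q z - crit_map q (crit_point q)"]
        crit_map_contraction[OF q(1) z4 c(1)] unfolding norm_mult by simp
    also have "norm (z - crit_point q) \<le> norm (u - crit_point q)"
      using segment_bound[OF z] by (simp add: norm_minus_commute)
    finally have "norm (deriv (H_fun q) z) \<le> 2 * (norm (u - crit_point q) + 0.99 * norm (u - crit_point q))" by simp
    moreover have "2 * (x + 0.99 * x) \<le> 4 * x" if "0 \<le> x" for x :: real using that by simp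
    ultimately show "norm (deriv (H_fun q) z) \<le> 4 * norm (u - crit_point q)"
      using norm_ge_zero order_trans by blast
  qed auto
  thus ?thesis by (simp add: power2_eq_square)
qed

text \<open>Avoids differentiating \<open>f\<close>. If \<open>f x = f y\<close>, cut the segment
  into \<open>m\<close> equal steps: the linear errors add up to \<open>c * d\<close>, the quadratic
  ones to \<open>K * d^2 / m\<close>, and for large \<open>m\<close> the total is below
  \<open>d\<close>, the amount by which \<open>f\<close> fails to follow the identity.\<close>

lemma near_identity_inj_on:
  fixes f :: "complex \<Rightarrow> complex"
  assumes S: "convex S" and c: "c < 1"
    and near: "\<And>x y. x \<in> S \<Longrightarrow> y \<in> S \<Longrightarrow> norm (f y - f x - (y - x)) \<le> c * norm (y - x) + K * (norm (y - x))\<^sup>2"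
  shows "inj_on f S"
proof (rule inj_onI, rule ccontr)
  fix x y assume xy: "x \<in> S" "y \<in> S" "f x = f y" "x \<noteq> y"
  define d where "d = norm (y - x)"
  have d: "d > 0" using xy by (simp add: d_def)
  obtain n :: nat where n: "n > K * d / (1 - c)" using reals_Archimedean2 by blast
  define m where "m = Suc n"
  define z where "z j = x + of_real (real j / real m) * (y - x)" for j
  have m: "real m > 0" "real m > K * d / (1 - c)" using n by (auto simp: m_def)
  have zS: "z j \<in> S" if "j \<le> m" for j
  proof -
    have "(1 - real j / real m) *\<^sub>R x + (real j / real m) *\<^sub>R y \<in> S"
      using that m by (intro convexD[OF S xy(1,2)]) auto
    thus ?thesis by (simp add: z_def scaleR_conv_of_real algebra_simps diff_divide_distrib)
  qed
  have step: "z (Suc j) - z j = of_real (1 / real m) * (y - x)" for j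
    by (simp add: z_def add_divide_distrib algebra_simps)
  hence nstep: "norm (z (Suc j) - z j) = d / real m" for j
    using m by (simp add: norm_mult norm_divide d_def)
  have "(\<Sum>j<m. f (z (Suc j)) - f (z j) - (z (Suc j) - z j)) = (\<Sum>j<m. (f (z (Suc j)) - z (Suc j)) - (f (z j) - z j))"
    by (rule sum.cong) simp_all
  also have "\<dots> = (f (z m) - z m) - (f (z 0) - z 0)" by (rule sum_lessThan_telescope)
  finally have tel: "(\<Sum>j<m. f (z (Suc j)) - f (z j) - (z (Suc j) - z j)) = (f (z m) - z m) - (f (z 0) - z 0)" .
  have "z m = y" "z 0 = x" using m by (auto simp: z_def)
  with tel have "d = norm (\<Sum>j<m. f (z (Suc j)) - f (z j) - (z (Suc j) - z j))"
    using xy(3) by (simp only: d_def) (simp add: norm_minus_commute)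
  also have "\<dots> \<le> (\<Sum>j<m. c * (d / real m) + K * (d / real m)\<^sup>2)"
  proof (rule sum_norm_le)
    fix j assume "j \<in> {..<m}"
    hence "z j \<in> S" "z (Suc j) \<in> S" by (auto intro!: zS)
    from near[OF this] show "norm (f (z (Suc j)) - f (z j) - (z (Suc j) - z j)) \<le> c * (d / real m) + K * (d / real m)\<^sup>2"
      unfolding nstep .
  qed
  also have "\<dots> = c * d + K * d\<^sup>2 / real m" using m by (simp add: power2_eq_square field_simps)
  finally have "(1 - c) * d * real m \<le> K * d * d" using m by (simp add: field_simps power2_eq_square)
  hence "(1 - c) * real m \<le> K * d" using d by (simp add: mult.assoc mult.commute mult.left_commute)
  thus False using m c by (simp add: field_simps)
qed

lemma H_fun_holomorphic_in_q: "(\<lambda>q. H_fun q u) holomorphic_on ball 0 1"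
  unfolding H_fun_def by (intro holomorphic_intros theta_holomorphic_in_q)

text \<open>For \<open>|w| \<le> 0.4\<close> and \<open>|u| \<le> 2\<close> the product
  \<open>w * u\<close> stays within 0.8, so \<open>theta_norm_le\<close> applies on the circles of
  the Cauchy estimates in \<open>q\<close>.\<close>

lemma cball_small_q:
  assumes "norm q \<le> 0.31"
  shows "cball q 0.09 \<subseteq> ball (0::complex) 1" "\<And>w. norm (w - q) = 0.09 \<Longrightarrow> norm w \<le> 0.4"
proof -
  have "norm w \<le> 0.4" if "norm (w - q) \<le> 0.09" for w
    using that assms norm_triangle_ineq[of "w - q" q] by simp
  thus "cball q 0.09 \<subseteq> ball (0::complex) 1" "\<And>w. norm (w - q) = 0.09 \<Longrightarrow> norm w \<le> 0.4"
    by (fastforce simp: dist_norm norm_minus_commute)+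
qed

text \<open>The constant may be crude: it reaches \<open>crit_value_near_identity\<close> only
  through the quadratic term, which does not affect injectivity.\<close>

lemma H_fun_Lipschitz_q:
  assumes u: "norm u \<le> 2" and q: "norm q \<le> 0.31" "norm q' \<le> 0.31"
  shows "norm (H_fun q u - H_fun q' u) \<le> 249 * norm (q - q')"
proof (rule field_differentiable_bound)
  show "((\<lambda>q. H_fun q u) has_field_derivative deriv (\<lambda>q. H_fun q u) z) (at z within cball 0 0.31)"
    if "z \<in> cball 0 0.31" for z
    using holomorphic_derivI[OF H_fun_holomorphic_in_q open_ball, of z u] that DERIV_subset by fastforce
  fix z :: complex assume "z \<in> cball 0 0.31"
  hence z: "norm z \<le> 0.31" by simp
  have "norm (deriv (\<lambda>q. H_fun q u) z) \<le> 22.4 / 0.09"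
  proof (rule norm_deriv_le[OF H_fun_holomorphic_in_q cball_small_q(1)[OF z]])
    fix w assume "norm (w - z) = 0.09"
    hence w: "norm w \<le> 0.4" using cball_small_q(2)[OF z] by blast
    have wu: "norm (w * (- u)) \<le> 0.8" using mult_mono[OF w u] by (simp add: norm_mult)
    have "norm (partial_theta w (- u)) \<le> 1 / (1 - norm (w * (- u)))"
      using w wu by (intro theta_norm_le) auto
    also have "\<dots> \<le> 5" using wu by (simp add: field_simps)
    finally have t: "norm (partial_theta w (- u)) \<le> 5" .
    have "norm (u\<^sup>2 * partial_theta w (- u)) \<le> 4 * 5"
      unfolding norm_mult norm_power using t power_mono[OF u norm_ge_zero, of 2] by (intro mult_mono) auto
    thus "norm (H_fun w u) \<le> 22.4"
      unfolding H_fun_def using norm_triangle_ineq[of "w - u" "u\<^sup>2 * partial_theta w (- u)"]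
        norm_triangle_ineq4[of w u] u w by simp
  qed simp
  thus "norm (deriv (\<lambda>q. H_fun q u) z) \<le> 249" by simp
qed (use q in auto)

lemma H_fun_deriv_Lipschitz_q:
  assumes u: "norm u \<le> 0.9" and q: "norm q \<le> 0.31" "norm q' \<le> 0.31"
  shows "norm (deriv (H_fun q) u - deriv (H_fun q') u) \<le> 227 * norm (q - q')"
proof -
  have q1: "norm q < 1" "norm q' < 1" using q by auto
  have "deriv (H_fun q) u - deriv (H_fun q') u = deriv (\<lambda>u. H_fun q u - H_fun q' u) u"
    by (rule deriv_diff[symmetric])
       (use holomorphic_on_imp_differentiable_at[OF H_fun_holomorphic open_UNIV] q1 in auto)
  also have "norm \<dots> \<le> 249 * norm (q - q') / 1.1"
  proof (rule norm_deriv_le)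
    show "(\<lambda>u. H_fun q u - H_fun q' u) holomorphic_on UNIV" using q1 by (intro holomorphic_intros)
    fix w assume "norm (w - u) = 1.1"
    hence "norm w \<le> 2" using u norm_triangle_ineq[of "w - u" u] by simp
    thus "norm (H_fun q w - H_fun q' w) \<le> 249 * norm (q - q')" by (rule H_fun_Lipschitz_q[OF _ q])
  qed auto
  also have "\<dots> \<le> 227 * norm (q - q')" by simp
  finally show ?thesis .
qed

text \<open>The \<open>q\<close>-derivative of \<open>H - q\<close> is \<open>-u\<^sup>3 + 3q\<^sup>2u\<^sup>4 - \<dots>\<close>, and \<open>0.9\<^sup>3 = 0.729\<close> leaves room for the rest.\<close>

lemma H_fun_near_identity_q:
  assumes u: "norm u \<le> 0.9" and q: "norm q \<le> 0.31" "norm q' \<le> 0.31"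
  shows "norm (H_fun q' u - H_fun q u - (q' - q)) \<le> 0.94 * norm (q' - q)"
proof -
  define f where "f z = H_fun z u - z" for z
  define g where "g z = H_fun z u - (z - u + u\<^sup>2 - z * u ^ 3 + z ^ 3 * u ^ 4 - z ^ 6 * u ^ 5)" for z
  have gh: "g holomorphic_on ball 0 1"
    unfolding g_def by (intro holomorphic_intros H_fun_holomorphic_in_q)
  have f_eq: "f = (\<lambda>z. - u + u\<^sup>2 - z * u ^ 3 + z ^ 3 * u ^ 4 - z ^ 6 * u ^ 5 + g z)"
    by (auto simp: f_def g_def)
  have "norm (f q' - f q) \<le> 0.94 * norm (q' - q)"
  proof (rule field_differentiable_bound)
    fix z :: complex assume "z \<in> cball 0 0.31"
    hence z: "norm z \<le> 0.31" by simp
    have g': "(g has_field_derivative deriv g z) (at z)"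
      using holomorphic_derivI[OF gh open_ball, of z] z by simp
    show "(f has_field_derivative - (u ^ 3) + 3 * z\<^sup>2 * u ^ 4 - 6 * z ^ 5 * u ^ 5 + deriv g z) (at z within cball 0 0.31)"
      unfolding f_eq by (rule derivative_eq_intros refl DERIV_subset[OF g'] | simp)+
    have "norm (deriv g z) \<le> 0.00006 / 0.09"
    proof (rule norm_deriv_le[OF gh cball_small_q(1)[OF z]])
      fix w assume "norm (w - z) = 0.09"
      hence w: "norm w \<le> 0.4" using cball_small_q(2)[OF z] by blast
      have gw: "g w = H_tail w u" unfolding g_def using H_fun_eq_tail[of w u] w by simp
      have n: "norm (w * (- (w ^ 4 * u))) = norm w ^ 5 * norm u"
        by (simp add: norm_mult norm_power power_numeral_reduce)
      have le: "norm w ^ 5 * norm u \<le> 0.4 ^ 5 * 0.9" using w u by (intro mult_mono power_mono) auto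
      hence le': "norm w ^ 5 * norm u \<le> 0.0093" by (simp add: power_divide)
      have "norm (partial_theta w (- (w ^ 4 * u))) \<le> 1 / (1 - norm w ^ 5 * norm u)"
        using theta_norm_le[of w "- (w ^ 4 * u)"] w le' unfolding n by simp
      also have "\<dots> \<le> 1.01" using le' by (simp add: field_simps)
      finally have t: "norm (partial_theta w (- (w ^ 4 * u))) \<le> 1.01" .
      have "norm (g w) = norm w ^ 10 * norm u ^ 6 * norm (partial_theta w (- (w ^ 4 * u)))"
        by (simp add: gw H_tail_def norm_mult norm_power)
      also have "\<dots> \<le> 0.4 ^ 10 * 0.9 ^ 6 * 1.01"
        using w u t by (intro mult_mono power_mono) auto
      finally show "norm (g w) \<le> 0.00006" by (simp add: power_divide)
    qed simp
    moreover have "norm (u ^ 3) \<le> 0.9 ^ 3" unfolding norm_power using u by (intro power_mono) auto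
    moreover have "norm (3 * z\<^sup>2 * u ^ 4) \<le> 3 * 0.31\<^sup>2 * 0.9 ^ 4"
      unfolding norm_mult norm_power using z u by (intro mult_mono power_mono) auto
    moreover have "norm (6 * z ^ 5 * u ^ 5) \<le> 6 * 0.31 ^ 5 * 0.9 ^ 5"
      unfolding norm_mult norm_power using z u by (intro mult_mono power_mono) auto
    moreover have "norm (- (u ^ 3) + 3 * z\<^sup>2 * u ^ 4 - 6 * z ^ 5 * u ^ 5 + deriv g z)
        \<le> norm (u ^ 3) + norm (3 * z\<^sup>2 * u ^ 4) + norm (6 * z ^ 5 * u ^ 5) + norm (deriv g z)"
      using norm_triangle_ineq[of "- (u ^ 3) + 3 * z\<^sup>2 * u ^ 4 - 6 * z ^ 5 * u ^ 5" "deriv g z"]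
        norm_triangle_ineq4[of "- (u ^ 3) + 3 * z\<^sup>2 * u ^ 4" "6 * z ^ 5 * u ^ 5"]
        norm_triangle_ineq[of "- (u ^ 3)" "3 * z\<^sup>2 * u ^ 4"] norm_minus_cancel[of "u ^ 3"] by linarith
    ultimately show "norm (- (u ^ 3) + 3 * z\<^sup>2 * u ^ 4 - 6 * z ^ 5 * u ^ 5 + deriv g z) \<le> 0.94"
      by (simp add: power_divide)
  qed (use q in auto)
  thus ?thesis by (simp add: f_def algebra_simps)
qed

text \<open>Contains every \<open>q\<close> of modulus at most 0.31 outside \<open>sector_S\<close>.
  It is convex, as the subdivision of segments in \<open>near_identity_inj_on\<close> requires, and
  \<open>Re (q^2) \<ge> 0\<close> on it.\<close>

definition q_sector :: "complex set" where
  "q_sector = {q. norm q \<le> 0.31 \<and> \<bar>Im q\<bar> \<le> Re q}"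

lemma q_sectorD:
  assumes "q \<in> q_sector"
  shows "norm q \<le> 0.31" "0 \<le> Re (q\<^sup>2)"
proof -
  show "norm q \<le> 0.31" using assms by (simp add: q_sector_def)
  have "\<bar>Im q\<bar> \<le> \<bar>Re q\<bar>"
    using assms by (auto simp: q_sector_def intro: order_trans[OF _ abs_ge_self])
  thus "0 \<le> Re (q\<^sup>2)" by (simp add: Re_power2 abs_le_square_iff)
qed

lemma convex_q_sector: "convex q_sector"
proof -
  have eq: "q_sector = cball 0 0.31 \<inter> ({q. Im q - Re q \<le> 0} \<inter> {q. - Im q - Re q \<le> 0})"
    by (auto simp: q_sector_def)
  have c: "convex {q::complex. Im q - Re q \<le> 0}" "convex {q::complex. - Im q - Re q \<le> 0}"
    by (auto simp: convex_def) (smt (verit) mult_left_mono distrib_left)+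
  show ?thesis unfolding eq by (intro convex_Int convex_cball c)
qed

definition crit_value :: "complex \<Rightarrow> complex" where
  "crit_value q = H_fun q (crit_point q)"

text \<open>Since \<open>\<partial>H/\<partial>u\<close> vanishes at the critical point, its displacement contributes only to second order.\<close>

lemma crit_value_near_identity:
  assumes q: "q \<in> q_sector" "q' \<in> q_sector"
  shows "norm (crit_value q' - crit_value q - (q' - q)) \<le> 0.94 * norm (q' - q) + 515290000 * (norm (q' - q))\<^sup>2"
proof -
  note a = q_sectorD[OF q(1)] and b = q_sectorD[OF q(2)]
  define u where "u = crit_point q"
  define u' where "u' = crit_point q'"
  define d where "d = norm (q' - q)"
  have u': "norm (u' - 1 / 2) \<le> 0.4" "deriv (H_fun q') u' = 0" using crit_point[OF b] by (auto simp: u'_def)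
  have u9: "norm u' \<le> 0.9" by (rule norm_le_of_near_half[OF u'(1)])
  have "norm (u' - u) \<le> 50 * norm (deriv (H_fun q) u')"
    unfolding u_def by (rule dist_crit_point_le[OF a u'(1)])
  also have "norm (deriv (H_fun q) u') \<le> 227 * d"
    using H_fun_deriv_Lipschitz_q[OF u9 a(1) b(1)] u'(2) by (simp add: d_def norm_minus_commute)
  \<comment> \<open>\<open>11350 = 50 * 227\<close>, and \<open>4 * 11350^2\<close> is the
    coefficient 515290000 in the statement.\<close>
  finally have "norm (u' - u) \<le> 11350 * d" by simp
  hence "(norm (u' - u))\<^sup>2 \<le> (11350 * d)\<^sup>2" by (intro power_mono) auto
  hence b': "norm (H_fun q u' - H_fun q u) \<le> 4 * (11350 * d)\<^sup>2"
    using H_fun_near_crit_point[OF a u'(1)] unfolding u_def by linarith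
  have c: "norm (H_fun q' u' - H_fun q u' - (q' - q)) \<le> 0.94 * d"
    unfolding d_def by (rule H_fun_near_identity_q[OF u9 a(1) b(1)])
  have "crit_value q' - crit_value q - (q' - q) = (H_fun q' u' - H_fun q u' - (q' - q)) + (H_fun q u' - H_fun q u)"
    by (simp add: crit_value_def u_def u'_def)
  hence "norm (crit_value q' - crit_value q - (q' - q))
      \<le> norm (H_fun q' u' - H_fun q u' - (q' - q)) + norm (H_fun q u' - H_fun q u)"
    by (simp only: norm_triangle_ineq)
  also have "\<dots> \<le> 0.94 * d + 4 * (11350 * d)\<^sup>2" by (rule add_mono[OF c b'])
  finally show ?thesis by (simp add: d_def power_mult_distrib)
qed

lemma crit_value_inj: "inj_on crit_value q_sector"
  by (rule near_identity_inj_on[OF convex_q_sector, of "0.94"]) (use crit_value_near_identity in auto)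



section \<open>Reality and continuity of the critical value, and its zeros\<close>

lemma H_fun_cnj:
  assumes "norm q < 1"
  shows "H_fun (cnj q) (cnj u) = cnj (H_fun q u)"
  using theta_cnj[OF assms, of "- u"] by (simp add: H_fun_def)

text \<open>For real \<open>q\<close> conjugation preserves both the critical points and the disk
  around 1/2, so uniqueness applies.\<close>

lemma crit_point_real:
  assumes q: "q \<in> q_sector" "cnj q = q"
  shows "cnj (crit_point q) = crit_point q"
proof -
  note a = q_sectorD[OF q(1)]
  note c = crit_point[OF a]
  have q1: "norm q < 1" using a by simp
  have eq: "cnj \<circ> H_fun q \<circ> cnj = H_fun q"
  proof
    fix u
    show "(cnj \<circ> H_fun q \<circ> cnj) u = H_fun q u" using H_fun_cnj[OF q1, of u] q(2) by (metis comp_apply complex_cnj_cnj)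
  qed
  have "(H_fun q has_field_derivative 0) (at (crit_point q))"
    using holomorphic_derivI[OF H_fun_holomorphic[OF q1] open_UNIV, of "crit_point q"] c(2) by simp
  hence "(cnj \<circ> H_fun q \<circ> cnj has_field_derivative cnj 0) (at (cnj (crit_point q)))"
    by (intro has_field_derivative_cnj_cnj) simp
  hence d: "deriv (H_fun q) (cnj (crit_point q)) = 0" unfolding eq by (simp add: DERIV_imp_deriv)
  have "cnj (crit_point q) - 1 / 2 = cnj (crit_point q - 1 / 2)" by simp
  hence "norm (cnj (crit_point q) - 1 / 2) \<le> 0.4" using c(1) by (metis complex_mod_cnj)
  from crit_point_eqI[OF a this d] show ?thesis by (rule sym)
qed

lemma crit_value_real:
  assumes q: "q \<in> q_sector" "cnj q = q"
  shows "Im (crit_value q) = 0"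
proof -
  have q1: "norm q < 1" using q_sectorD[OF q(1)] by simp
  have "cnj (crit_value q) = crit_value q"
    using H_fun_cnj[OF q1, of "crit_point q"] crit_point_real[OF q] q(2) by (simp add: crit_value_def)
  thus ?thesis by (metis Reals_cnj_iff complex_is_Real_iff)
qed

lemma continuous_on_crit_value: "continuous_on q_sector crit_value"
  unfolding continuous_on_iff
proof (intro ballI allI impI)
  fix q :: complex and e :: real
  assume q: "q \<in> q_sector" and e: "0 < e"
  \<comment> \<open>Exceeds \<open>0.94 + 1 + 515290000\<close>, a Lipschitz constant for steps of
    length below 1, where the square is at most the length.\<close>
  define L :: real where "L = 515290002"
  show "\<exists>d>0. \<forall>q'\<in>q_sector. dist q' q < d \<longrightarrow> dist (crit_value q') (crit_value q) < e"
  proof (intro exI[of _ "min 1 (e / L)"] conjI ballI impI)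
    show "0 < min 1 (e / L)" using e by (simp add: L_def)
    fix q' assume q': "q' \<in> q_sector" and d: "dist q' q < min 1 (e / L)"
    define n where "n = norm (q' - q)"
    have n: "0 \<le> n" "n < 1" "L * n < e" using d by (auto simp: n_def dist_norm L_def field_simps)
    have "n\<^sup>2 \<le> n" using n by (simp add: power2_eq_square mult_left_le)
    moreover have "norm (crit_value q' - crit_value q) \<le> norm (crit_value q' - crit_value q - (q' - q)) + n"
      using norm_triangle_ineq[of "crit_value q' - crit_value q - (q' - q)" "q' - q"] by (simp add: n_def)
    ultimately have "norm (crit_value q' - crit_value q) \<le> L * n"
      using crit_value_near_identity[OF q q'] n unfolding n_def[symmetric] L_def by simp
    thus "dist (crit_value q') (crit_value q) < e" using n by (simp add: dist_norm)
  qed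
qed

lemma crit_value_zero_imp_spectral:
  assumes q: "q \<in> q_sector" "q \<noteq> 0" "crit_value q = 0"
  shows "spectral_number q"
proof -
  note a = q_sectorD[OF q(1)]
  have q1: "norm q < 1" using a by simp
  define u where "u = crit_point q"
  define c where "c = - (1 / q\<^sup>2)"
  define z where "z = c * u"
  have c0: "c \<noteq> 0" using q(2) by (simp add: c_def)
  note holo = theta_holomorphic[OF q1]
  have eq: "H_fun q = (\<lambda>u. q * partial_theta q (c * u))"
    using H_fun_theta[OF q1 q(2)] unfolding c_def by (rule ext)
  have z0: "partial_theta q z = 0"
    using q(2,3) unfolding crit_value_def eq u_def[symmetric] z_def by simp
  have "(partial_theta q has_field_derivative deriv (partial_theta q) z) (at (c * u))"
    using holomorphic_derivI[OF holo open_UNIV, of z] by (simp add: z_def)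
  hence "(H_fun q has_field_derivative q * (deriv (partial_theta q) z * c)) (at u)"
    unfolding eq by (rule DERIV_cmult[OF DERIV_chain2]) (rule DERIV_cmult_Id)
  hence "q * (deriv (partial_theta q) z * c) = 0"
    using crit_point(2)[OF a] by (simp add: DERIV_imp_deriv u_def)
  hence d0: "deriv (partial_theta q) z = 0" using q(2) c0 by simp
  \<comment> \<open>The value 1 at 0 shows that the function is not identically zero, as
    \<open>zorder_geI\<close> requires.\<close>
  have "zorder (partial_theta q) z \<ge> int 2"
  proof (rule zorder_geI[OF _ holo open_UNIV connected_UNIV])
    show "partial_theta q analytic_on {z}" by (rule holomorphic_on_imp_analytic_at[OF holo]) auto
    show "partial_theta q 0 \<noteq> 0" by simp
    show "(deriv ^^ k) (partial_theta q) z = 0" if "k < 2" for k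
    proof -
      have "k = 0 \<or> k = 1" using that by auto
      thus ?thesis using z0 d0 by auto
    qed
  qed auto
  thus ?thesis using z0 q1 unfolding spectral_number_def multiple_zero_def by auto
qed

lemma spectral_imp_crit_value_zero:
  assumes q: "spectral_number q" "norm q < 0.31" "q \<notin> sector_S"
  shows "q \<in> q_sector" "crit_value q = 0" "q \<noteq> 0"
proof -
  obtain z where z: "multiple_zero (partial_theta q) z" using q by (auto simp: spectral_number_def)
  show q0: "q \<noteq> 0" using z by (auto simp: multiple_zero_def)
  show qs: "q \<in> q_sector"
    using Re_gt_outside_sector[OF q(3) q0] q(2) by (simp add: q_sector_def)
  note a = q_sectorD[OF qs]
  obtain u where u: "norm u < 5 / 4" "H_fun q u = 0" "deriv (H_fun q) u = 0"
    using multiple_zero_H_fun[OF a(1) q0 z] .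
  have "crit_point q = u" by (rule crit_point_eqI[OF a double_zero_small[OF a(1) u] u(3)])
  thus "crit_value q = 0" using u(2) by (simp add: crit_value_def)
qed

section \<open>Numerical bracketing of the real spectral number\<close>

lemma H_tail_expand:
  assumes "norm q < 1"
  shows "H_tail q u = q ^ 10 * u ^ 6 - q ^ 15 * u ^ 7 * partial_theta q (- (q ^ 5 * u))"
proof -
  have th: "partial_theta q (- (q ^ 4 * u)) = 1 - q ^ 5 * u * partial_theta q (- (q ^ 5 * u))"
    using theta_functional[OF assms, of "- (q ^ 4 * u)"] by (simp add: power_numeral_reduce mult_ac)
  show ?thesis unfolding H_tail_def th by algebra
qed

text \<open>The next term \<open>-q\<^sup>1\<^sup>5u\<^sup>7\<close> of the series is already smaller than the margin by which the
  two rational endpoints bracket the spectral number.\<close>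

lemma crit_value_approx:
  fixes q u :: real
  defines "P \<equiv> q - u + u\<^sup>2 - q * u ^ 3 + q ^ 3 * u ^ 4 - q ^ 6 * u ^ 5 + q ^ 10 * u ^ 6"
    and "P' \<equiv> - 1 + 2 * u - 3 * q * u\<^sup>2 + 4 * q ^ 3 * u ^ 3 - 5 * q ^ 6 * u ^ 4 + 6 * q ^ 10 * u ^ 5"
  assumes q: "0 \<le> q" "q \<le> 0.30925" and u: "0.1 \<le> u" "u \<le> 0.72" and P': "\<bar>P'\<bar> \<le> 0.0000004"
  shows "Re (crit_value (of_real q)) \<le> P + 0.00000001" "P - 0.00000001 \<le> Re (crit_value (of_real q))"
proof -
  define Q where "Q = complex_of_real q"
  define U where "U = complex_of_real u"
  have QS: "Q \<in> q_sector" using q by (simp add: q_sector_def Q_def)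
  note a = q_sectorD[OF QS]
  have q1: "norm Q < 1" using a by simp
  define T where "T w = - (Q ^ 15 * w ^ 7 * partial_theta Q (- (Q ^ 5 * w)))" for w
  have Th: "T holomorphic_on UNIV" unfolding T_def using q1 by (intro holomorphic_intros) auto
  have nQ: "norm Q \<le> 0.30925" using q by (simp add: Q_def)
  have T_le: "norm (T w) \<le> 0.00000000585" if w: "norm w \<le> 0.82" for w
  proof -
    have n: "norm (Q * (- (Q ^ 5 * w))) = norm Q ^ 6 * norm w"
      by (simp add: norm_mult norm_power power_numeral_reduce)
    have le: "norm Q ^ 6 * norm w \<le> 0.30925 ^ 6 * 0.82" using nQ w by (intro mult_mono power_mono) auto
    hence le': "norm Q ^ 6 * norm w \<le> 0.00073" by (simp add: power_divide)
    have "norm (partial_theta Q (- (Q ^ 5 * w))) \<le> 1 / (1 - norm Q ^ 6 * norm w)"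
      using theta_norm_le[of Q "- (Q ^ 5 * w)"] q1 le' unfolding n by simp
    also have "\<dots> \<le> 1.001" using le' by (simp add: field_simps)
    finally have t: "norm (partial_theta Q (- (Q ^ 5 * w))) \<le> 1.001" .
    have "norm (T w) = norm Q ^ 15 * norm w ^ 7 * norm (partial_theta Q (- (Q ^ 5 * w)))"
      by (simp add: T_def norm_mult norm_power)
    also have "\<dots> \<le> 0.30925 ^ 15 * 0.82 ^ 7 * 1.001" using nQ w t by (intro mult_mono power_mono) auto
    finally show ?thesis by (simp add: power_divide)
  qed
  have nU: "norm U \<le> 0.72" using u by (simp add: U_def)
  have T': "norm (deriv T U) \<le> 0.0000000585"
  proof -
    have "norm (deriv T U) \<le> 0.00000000585 / 0.1"
    proof (rule norm_deriv_le[OF Th subset_UNIV])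
      fix w assume "norm (w - U) = 0.1"
      hence "norm w \<le> 0.82" using nU norm_triangle_ineq[of "w - U" U] by simp
      thus "norm (T w) \<le> 0.00000000585" by (rule T_le)
    qed simp
    thus ?thesis by simp
  qed
  have tail: "H_tail Q = (\<lambda>w. Q ^ 10 * w ^ 6 + T w)"
    by (rule ext) (simp add: H_tail_expand[OF q1] T_def)
  have dtail: "deriv (H_tail Q) U = 6 * Q ^ 10 * U ^ 5 + deriv T U"
  proof (rule DERIV_imp_deriv)
    have t: "(T has_field_derivative deriv T U) (at U)"
      using holomorphic_derivI[OF Th open_UNIV, of U] by simp
    show "(H_tail Q has_field_derivative 6 * Q ^ 10 * U ^ 5 + deriv T U) (at U)"
      unfolding tail by (rule derivative_eq_intros t refl | simp)+
  qed
  have HP: "H_fun Q U = of_real P + T U"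
    unfolding H_fun_eq_tail[OF q1] tail by (simp add: P_def Q_def U_def)
  have DP: "deriv (H_fun Q) U = of_real P' + deriv T U"
    unfolding H_fun_deriv[OF q1] dtail by (simp add: P'_def Q_def U_def)
  have U4: "norm (U - 1 / 2) \<le> 0.4"
  proof -
    have "U - 1 / 2 = of_real (u - 1 / 2)" by (simp add: U_def)
    moreover have "\<bar>u - 1 / 2\<bar> \<le> 0.4" using u unfolding abs_le_iff by simp
    ultimately show ?thesis by (simp only: norm_of_real)
  qed
  have "norm (deriv (H_fun Q) U) \<le> \<bar>P'\<bar> + norm (deriv T U)"
    unfolding DP using norm_triangle_ineq[of "of_real P'" "deriv T U"] by simp
  hence "norm (deriv (H_fun Q) U) \<le> 0.00000046" using P' T' by simp
  \<comment> \<open>\<open>0.000023 = 50 * 0.00000046\<close>. The value changes only by 4 times its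
    square, about 2.1e-9; together with 5.85e-9 from \<open>T\<close> this stays below 1e-8.\<close>
  hence "norm (U - crit_point Q) \<le> 0.000023" using dist_crit_point_le[OF a U4] by simp
  hence "(norm (U - crit_point Q))\<^sup>2 \<le> 0.000023\<^sup>2" by (intro power_mono) auto
  hence "norm (H_fun Q U - crit_value Q) \<le> 4 * 0.000023\<^sup>2"
    using H_fun_near_crit_point[OF a U4] unfolding crit_value_def by linarith
  moreover have "crit_value Q - of_real P = T U - (H_fun Q U - crit_value Q)" by (simp add: HP)
  hence "norm (crit_value Q - of_real P) \<le> norm (T U) + norm (H_fun Q U - crit_value Q)"
    by (metis norm_triangle_ineq4)
  ultimately have "norm (crit_value Q - of_real P) \<le> 0.00000001"
    using T_le[of U] nU by (simp add: power2_eq_square)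
  moreover have "\<bar>Re (crit_value Q) - P\<bar> \<le> norm (crit_value Q - of_real P)"
    using abs_Re_le_cmod[of "crit_value Q - of_real P"] by simp
  ultimately have "\<bar>Re (crit_value Q) - P\<bar> \<le> 0.00000001" by (rule order_trans[rotated])
  thus "Re (crit_value (of_real q)) \<le> P + 0.00000001" "P - 0.00000001 \<le> Re (crit_value (of_real q))"
    by (auto simp only: Q_def abs_diff_le_iff add_diff_eq diff_le_eq)
qed

text \<open>The numbers 0.717575 and 0.717576 approximate the critical points at the two endpoints,
  closely enough for \<open>P'\<close> to meet the bound 4e-7. The signs are then decided by
  rational arithmetic.\<close>

lemma crit_value_signs:
  "Re (crit_value (of_real 0.309249)) < 0" "Re (crit_value (of_real 0.30925)) > 0"
proof -
  let ?P = "\<lambda>q u :: real. q - u + u\<^sup>2 - q * u ^ 3 + q ^ 3 * u ^ 4 - q ^ 6 * u ^ 5 + q ^ 10 * u ^ 6"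
  let ?P' = "\<lambda>q u :: real. - 1 + 2 * u - 3 * q * u\<^sup>2 + 4 * q ^ 3 * u ^ 3 - 5 * q ^ 6 * u ^ 4 + 6 * q ^ 10 * u ^ 5"
  have d1: "\<bar>?P' 0.309249 0.717575\<bar> \<le> 0.0000004" by (simp add: power_divide)
  have n1: "?P 0.309249 0.717575 + 0.00000001 < 0" by (simp add: power_divide)
  have "Re (crit_value (of_real 0.309249)) \<le> ?P 0.309249 0.717575 + 0.00000001"
    by (rule crit_value_approx(1)[OF _ _ _ _ d1]) simp_all
  from order.strict_trans1[OF this n1] show "Re (crit_value (of_real 0.309249)) < 0" .
  have d2: "\<bar>?P' 0.30925 0.717576\<bar> \<le> 0.0000004" by (simp add: power_divide)
  have n2: "?P 0.30925 0.717576 - 0.00000001 > 0" by (simp add: power_divide)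
  have "?P 0.30925 0.717576 - 0.00000001 \<le> Re (crit_value (of_real 0.30925))"
    by (rule crit_value_approx(2)[OF _ _ _ _ d2]) simp_all
  from order.strict_trans2[OF n2 this] show "Re (crit_value (of_real 0.30925)) > 0" .
qed

lemma spectral_number_exists:
  "\<exists>q. 0.309249 \<le> q \<and> q < 0.30925 \<and> spectral_number (complex_of_real q)"
proof -
  have sec: "complex_of_real t \<in> q_sector" if "0 \<le> t" "t \<le> 0.31" for t
    using that by (simp add: q_sector_def)
  have "\<exists>t. 0.309249 \<le> t \<and> t \<le> 0.30925 \<and> Re (crit_value (of_real t)) = 0"
  proof (rule IVT')
    show "continuous_on {0.309249..0.30925} (\<lambda>t. Re (crit_value (complex_of_real t)))"
      by (intro continuous_on_Re continuous_on_compose2[OF continuous_on_crit_value] continuous_intros)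
         (auto intro!: sec)
  qed (use crit_value_signs in auto)
  then obtain t where t: "0.309249 \<le> t" "t \<le> 0.30925" "Re (crit_value (of_real t)) = 0" by blast
  \<comment> \<open>Makes the upper inequality strict, as the digits \<open>0.309249...\<close>
    demand.\<close>
  have ne: "t \<noteq> 0.30925"
  proof
    assume "t = 0.30925"
    thus False using t(3) crit_value_signs(2) by (simp only:)
  qed
  have "complex_of_real t \<in> q_sector" using t by (intro sec) auto
  moreover from crit_value_real[OF this] t(3) have "crit_value (of_real t) = 0"
    by (simp add: complex_eq_iff)
  ultimately have "spectral_number (of_real t)" using t by (intro crit_value_zero_imp_spectral) auto
  thus ?thesis using t ne by (intro exI[of _ t]) auto
qed

lemma spectral_number_unique:
  assumes "spectral_number q" "spectral_number q'" "q \<in> sector_S \<union> ball 0 0.31" "q' \<in> sector_S \<union> ball 0 0.31"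
  shows "q = q'"
proof -
  have "q \<notin> sector_S" "q' \<notin> sector_S"
    using assms strongly_separated_sector strongly_separated_not_spectral by blast+
  hence "norm q < 0.31" "norm q' < 0.31" using assms(3,4) by auto
  note a = spectral_imp_crit_value_zero[OF assms(1) this(1) \<open>q \<notin> sector_S\<close>]
    and b = spectral_imp_crit_value_zero[OF assms(2) this(2) \<open>q' \<notin> sector_S\<close>]
  show ?thesis using inj_onD[OF crit_value_inj _ a(1) b(1)] a(2) b(2) by simp
qed

theorem theorem1:
  shows "(\<forall>q \<in> sector_S \<union> ball 0 c0. q \<noteq> 0 \<longrightarrow> strongly_separated q) \<and>
         {q \<in> sector_S \<union> ball 0 0.31. spectral_number q} = {complex_of_real q1_tilde} \<and>
         0.309249 \<le> q1_tilde \<and> q1_tilde < 0.309250"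
proof -
  obtain q0 where q0: "0.309249 \<le> q0" "q0 < 0.30925" "spectral_number (complex_of_real q0)"
    using spectral_number_exists by blast
  have in_ball: "complex_of_real q0 \<in> sector_S \<union> ball 0 0.31" using q0 by simp
  have q1: "q1_tilde = q0"
    unfolding q1_tilde_def
  proof (rule Least_equality)
    show "0 < q0 \<and> spectral_number (complex_of_real q0)" using q0 by simp
    fix y assume y: "0 < y \<and> spectral_number (complex_of_real y)"
    show "q0 \<le> y"
    proof (rule ccontr)
      assume "\<not> q0 \<le> y"
      \<comment> \<open>A smaller positive spectral number would also lie in the disk of radius
        0.31, where uniqueness holds.\<close>
      hence "complex_of_real y \<in> sector_S \<union> ball 0 0.31" using y q0 by simp
      hence "complex_of_real y = complex_of_real q0"
        using spectral_number_unique y q0(3) in_ball by blast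
      thus False using \<open>\<not> q0 \<le> y\<close> by simp
    qed
  qed
  have "{q \<in> sector_S \<union> ball 0 0.31. spectral_number q} = {complex_of_real q0}"
    using q0(3) in_ball spectral_number_unique by blast
  moreover have "\<forall>q \<in> sector_S \<union> ball 0 c0. q \<noteq> 0 \<longrightarrow> strongly_separated q"
    using strongly_separated_sector strongly_separated_small by auto
  ultimately show ?thesis using q0 unfolding q1 by simp
qed

end
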